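(* Let $L$ be a proper pseudo-Finsler metric on $A$ of non-definite signature and let $n\ge3$. Then there exists at most one $\mathrm{N}=\mathrm{N}^L+\dot\partial\mathcal{Z}$, with $\mathcal{Z}\in\mathrm{h}^2\mathcal{T}^1_0(M_A)$, which is a symmetric proper solution of the affine equation of $L$ and such that the spray difference $-2\mathcal{Z}$ (equivalently, the connection difference $\dot\partial\mathcal{Z}=\mathrm{N}-\mathrm{N}^L$) is fiberwise analytic on $\overline{A}$.
   Context: $M$ is a connected smooth manifold of dimension $n$, $\pi:TM\to M$ the projection. Charts $(x^i)$ of $M$ induce charts $(x^i,y^i)$ of $TM$; $\partial_i=\partial/\partial x^i$, $\dot\partial_i=\partial/\partial y^i$; repeated indices are summed. $A\subseteq TM\setminus\mathbf{0}$ is open and conic ($\lambda v\in A$ for $v\in A$, $\lambda>0$) with $\pi(A)=M$; $A_p=A\cap T_pM$; $\overline A$ is the closure of $A$ in $TM\setminus\mathbf 0$, $\partial A=\overline A\setminus A$. An anisotropic tensor of type $(r,s)$ is a smooth section of the pullback to $A$ of $\bigotimes^rTM\otimes\bigotimes^sT^*M$, with components $T^{i_1\dots i_r}_{j_1\dots j_s}(x,y)$; the space of those with components positively $\alpha$-homogeneous in $y$ is $\mathrm{h}^\alpha\mathcal{T}^r_s(M_A)$. A subscript $\cdot i$ denotes $\dot\partial_i$; $(\dot\partial\mathcal{Z})_i^k=\mathcal{Z}^k_{\cdot i}$. An anisotropic tensor smooth on $\overline A$ is fiberwise analytic on $\overline A$ if for each $p\in M$ its restriction to $\overline{A_p}\subseteq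 T_pM$ is real analytic (i.e. its components are real analytic in $y$, up to the boundary). A homogeneous nonlinear connection $\mathrm{N}$ on $A$ is given in each chart by smooth functions $\mathrm{N}_i^k(x,y)$, positively $1$-homogeneous in $y$, transforming by $\bar{\mathrm{N}}_i^k=\frac{\partial\bar x^k}{\partial x^c}\frac{\partial^2x^c}{\partial\bar x^i\partial\bar x^b}\bar y^b+\frac{\partial\bar x^k}{\partial x^c}\frac{\partial x^a}{\partial\bar x^i}\mathrm{N}_a^c$. Differences of two such lie in $\mathrm{h}^1\mathcal{T}^1_1(M_A)$. $\mathrm{N}$ is symmetric if $\mathrm{N}^k_{i\cdot j}=\mathrm{N}^k_{j\cdot i}$. A pseudo-Finsler metric on $A$ is a smooth positively $2$-homogeneous $L:A\to\mathbb{R}$ with $g_{ij}=\frac12L_{\cdot i\cdot j}$ non-degenerate everywhere. It is proper if (i) each $A_p$ is connected and $L>0$ on $A$, and (ii) $L$ extends smoothly to $\overline A$ with $L=0$ and $g$ non-degenerate on $\partial A$ (then $g$ has constant signature). Indices are moved with $g$; $y_i=g_{ia}y^a$. $(\mathrm{G}^L)^i=\frac14g^{ia}(2\partial_cg_{ab}-\partial_ag_{bc})y^by^c$; $(\mathrm{N}^L)_i^k=\dot\partial_i(\mathrm{G}^L)^k$. $\mathrm{C}_{ijk}=\frac12g_{ij\cdot k}$, $\mathrm{C}_i=g^{ab}\mathrm{C}_{abi}$. $\mathrm{Lan}_{ijk}=\frac12\nabla^L_kg_{ij}$ with $\nabla^L_kg_{ij}=(\partial_k-(\mathrm{N}^L)_k^a\dot\partial_a)g_{ij}-(\mathrm{N}^L)^a_{k\cdot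 i}g_{aj}-(\mathrm{N}^L)^a_{k\cdot j}g_{ia}$, $\mathrm{Lan}_i=g^{ab}\mathrm{Lan}_{abi}$. $\mathrm{N}=\mathrm{N}^L+\mathcal{J}$, $\mathcal{J}\in\mathrm{h}^1\mathcal{T}^1_1(M_A)$, is a solution of the affine equation of $L$ if on $A$ $$\Big\{2\mathrm{Lan}_b+(n+2)\tfrac{y_a}{L}\mathcal{J}^a_b-2\mathrm{C}_a\mathcal{J}^a_b-(\mathcal{J}^a_{b\cdot a}+\mathcal{J}^a_{a\cdot b})\Big\}(\delta^b_iy^j-y^b\delta^j_i)-(\mathcal{J}^j_{i\cdot a}-\mathcal{J}^j_{a\cdot i})y^a=0 ;$$ it is a proper solution if moreover $\mathrm{N}$ extends smoothly to $\overline A$. *)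

theory Defs
  imports "HOL-Analysis.Analysis"
begin

section \<open>Smooth and real analytic functions\<close>

text \<open>\<open>Ck_on k S f\<close> and \<open>smooth_on S f\<close> are only meant for open \<open>S\<close>. Smoothness up to the boundary
  of an open set is expressed by \<open>extends_smoothly\<close>.\<close>

primrec Ck_on :: "nat \<Rightarrow> 'a::euclidean_space set \<Rightarrow> ('a \<Rightarrow> 'b::euclidean_space) \<Rightarrow> bool" where
  "Ck_on 0 S f \<longleftrightarrow> continuous_on S f"
| "Ck_on (Suc k) S f \<longleftrightarrow> (\<forall>x\<in>S. f differentiable (at x)) \<and>
     (\<forall>v. Ck_on k S (\<lambda>x. frechet_derivative f (at x) v))"

definition smooth_on :: "'a::euclidean_space set \<Rightarrow> ('a \<Rightarrow> 'b::euclidean_space) \<Rightarrow> bool" where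
  "smooth_on S f \<longleftrightarrow> (\<forall>k. Ck_on k S f)"

definition smooth_extension ::
    "'a::euclidean_space set \<Rightarrow> 'a set \<Rightarrow> ('a \<Rightarrow> 'b::euclidean_space) \<Rightarrow> ('a \<Rightarrow> 'b) \<Rightarrow> bool" where
  "smooth_extension S T f F \<longleftrightarrow>
     (\<exists>W. open W \<and> S \<subseteq> W \<and> T \<subseteq> W \<and> smooth_on W F) \<and> (\<forall>z\<in>S. F z = f z)"

definition extends_smoothly ::
    "'a::euclidean_space set \<Rightarrow> 'a set \<Rightarrow> ('a \<Rightarrow> 'b::euclidean_space) \<Rightarrow> bool" where
  "extends_smoothly S T f \<longleftrightarrow> (\<exists>F. smooth_extension S T f F)"

text \<open>The set \<open>S\<close> is arbitrary here: around each of its points, \<open>f\<close> agrees on \<open>S\<close> with the sum of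
  a power series that converges in a full neighbourhood. The coefficients are indexed by the
  multi-indices \<open>\<alpha> :: 'n \<Rightarrow> nat\<close>.\<close>

definition real_analytic_on :: "(real^'n::finite) set \<Rightarrow> (real^'n \<Rightarrow> real) \<Rightarrow> bool" where
  "real_analytic_on S f \<longleftrightarrow>
     (\<forall>y\<in>S. \<exists>(a :: ('n \<Rightarrow> nat) \<Rightarrow> real) r. r > 0 \<and>
        (\<forall>z\<in>ball y r. (\<lambda>\<alpha>. a \<alpha> * (\<Prod>i\<in>UNIV. (z$i - y$i) ^ \<alpha> i)) summable_on UNIV) \<and>
        (\<forall>z\<in>S \<inter> ball y r.
           ((\<lambda>\<alpha>. a \<alpha> * (\<Prod>i\<in>UNIV. (z$i - y$i) ^ \<alpha> i)) has_sum f z) UNIV))"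


section \<open>Manifolds and tangent bundles\<close>

text \<open>A chart is a pair of its domain and its coordinate map; the values of the map outside the domain
  play no role. The smooth structure is given by any (not necessarily maximal) smooth atlas.\<close>

type_synonym ('m, 'n) chart = "'m set \<times> ('m \<Rightarrow> real^'n)"

definition transition :: "('m, 'n::finite) chart \<Rightarrow> ('m, 'n) chart \<Rightarrow> real^'n \<Rightarrow> real^'n" where
  "transition c d = snd d \<circ> inv_into (fst c) (snd c)"

definition smooth_atlas :: "'m topology \<Rightarrow> ('m, 'n::finite) chart set \<Rightarrow> bool" where
  "smooth_atlas X \<A> \<longleftrightarrow>
     (\<Union>c\<in>\<A>. fst c) = topspace X \<and>
     (\<forall>(U, \<phi>)\<in>\<A>. openin X U \<and> open (\<phi> ` U) \<and>
        homeomorphic_map (subtopology X U) (top_of_set (\<phi> ` U)) \<phi>) \<and>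
     (\<forall>c\<in>\<A>. \<forall>d\<in>\<A>. smooth_on (snd c ` (fst c \<inter> fst d)) (transition c d))"

definition connected_smooth_manifold :: "'m topology \<Rightarrow> ('m, 'n::finite) chart set \<Rightarrow> bool" where
  "connected_smooth_manifold X \<A> \<longleftrightarrow>
     Hausdorff_space X \<and> second_countable X \<and> connected_space X \<and> smooth_atlas X \<A>"

text \<open>A tangent vector at \<open>p\<close> is a pair \<open>(p, v)\<close>, where \<open>v c\<close> is the vector of its components in the
  chart \<open>c\<close> and the components in two charts around \<open>p\<close> are related by the differential of the
  transition map. The value \<open>0\<close> for the other arguments makes the representation unique.\<close>

type_synonym ('m, 'n) tvec = "'m \<times> (('m, 'n) chart \<Rightarrow> real^'n)"

definition tangent_bundle :: "('m, 'n::finite) chart set \<Rightarrow> ('m, 'n) tvec set" where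
  "tangent_bundle \<A> = {(p, v).
     (\<exists>c\<in>\<A>. p \<in> fst c) \<and>
     (\<forall>c\<in>\<A>. \<forall>d\<in>\<A>. p \<in> fst c \<inter> fst d \<longrightarrow>
        v d = frechet_derivative (transition c d) (at (snd c p)) (v c)) \<and>
     (\<forall>c. c \<notin> \<A> \<or> p \<notin> fst c \<longrightarrow> v c = 0)}"

definition scale_tvec :: "real \<Rightarrow> ('m, 'n::finite) tvec \<Rightarrow> ('m, 'n) tvec" where
  "scale_tvec t w = (fst w, \<lambda>c. t *\<^sub>R snd w c)"

definition slit_tangent_bundle :: "('m, 'n::finite) chart set \<Rightarrow> ('m, 'n) tvec set" where
  "slit_tangent_bundle \<A> = {w \<in> tangent_bundle \<A>. snd w \<noteq> (\<lambda>c. 0)}"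

definition fibre :: "('m, 'n::finite) tvec set \<Rightarrow> 'm \<Rightarrow> ('m, 'n) tvec set" where
  "fibre B p = {w \<in> B. fst w = p}"

text \<open>The induced chart \<open>(x, y)\<close> of the tangent bundle.\<close>

definition tdom :: "('m, 'n::finite) chart set \<Rightarrow> ('m, 'n) chart \<Rightarrow> ('m, 'n) tvec set" where
  "tdom \<A> c = {w \<in> tangent_bundle \<A>. fst w \<in> fst c}"

definition tchart :: "('m, 'n::finite) chart \<Rightarrow> ('m, 'n) tvec \<Rightarrow> (real^'n) \<times> (real^'n)" where
  "tchart c w = (snd c (fst w), snd w c)"

definition tangent_topology :: "('m, 'n::finite) chart set \<Rightarrow> ('m, 'n) tvec topology" where
  "tangent_topology \<A> =
     topology_generated_by {tdom \<A> c \<inter> tchart c -` W | c W. c \<in> \<A> \<and> open W}"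

text \<open>Coordinate expression of a subset of, and of a function on, the tangent bundle.\<close>

definition coord_set ::
    "('m, 'n::finite) chart set \<Rightarrow> ('m, 'n) chart \<Rightarrow> ('m, 'n) tvec set \<Rightarrow> ((real^'n) \<times> (real^'n)) set" where
  "coord_set \<A> c B = tchart c ` (B \<inter> tdom \<A> c)"

definition coord_fun ::
    "('m, 'n::finite) chart set \<Rightarrow> ('m, 'n) chart \<Rightarrow> (('m, 'n) tvec \<Rightarrow> real) \<Rightarrow> (real^'n) \<times> (real^'n) \<Rightarrow> real" where
  "coord_fun \<A> c f = f \<circ> inv_into (tdom \<A> c) (tchart c)"

definition smooth_function ::
    "('m, 'n::finite) chart set \<Rightarrow> ('m, 'n) tvec set \<Rightarrow> (('m, 'n) tvec \<Rightarrow> real) \<Rightarrow> bool" where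
  "smooth_function \<A> B f \<longleftrightarrow> (\<forall>c\<in>\<A>. smooth_on (coord_set \<A> c B) (coord_fun \<A> c f))"


section \<open>Conic domains, anisotropic tensors and nonlinear connections\<close>

definition conic_domain :: "('m, 'n::finite) chart set \<Rightarrow> ('m, 'n) tvec set \<Rightarrow> bool" where
  "conic_domain \<A> A \<longleftrightarrow>
     A \<subseteq> slit_tangent_bundle \<A> \<and> openin (tangent_topology \<A>) A \<and>
     (\<forall>w\<in>A. \<forall>t>0. scale_tvec t w \<in> A) \<and>
     fst ` A = (\<Union>c\<in>\<A>. fst c)"

text \<open>Closures are taken in the slit tangent bundle, respectively in the tangent space at \<open>p\<close> without
  its zero vector.\<close>

definition slit_closure :: "('m, 'n::finite) chart set \<Rightarrow> ('m, 'n) tvec set \<Rightarrow> ('m, 'n) tvec set" where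
  "slit_closure \<A> A = subtopology (tangent_topology \<A>) (slit_tangent_bundle \<A>) closure_of A"

definition slit_boundary :: "('m, 'n::finite) chart set \<Rightarrow> ('m, 'n) tvec set \<Rightarrow> ('m, 'n) tvec set" where
  "slit_boundary \<A> A = slit_closure \<A> A - A"

definition fibre_closure ::
    "('m, 'n::finite) chart set \<Rightarrow> ('m, 'n) tvec set \<Rightarrow> 'm \<Rightarrow> ('m, 'n) tvec set" where
  "fibre_closure \<A> A p =
     subtopology (tangent_topology \<A>) (fibre (slit_tangent_bundle \<A>) p) closure_of fibre A p"

text \<open>The partial derivatives: \<open>pd i\<close> on \<open>\<real>\<^sup>n\<close>; \<open>pdx i\<close> and \<open>pdy i\<close> with respect to \<open>x\<^sup>i\<close> and \<open>y\<^sup>i\<close> in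
  an induced chart.\<close>

definition pd :: "'n::finite \<Rightarrow> (real^'n \<Rightarrow> real) \<Rightarrow> real^'n \<Rightarrow> real" where
  "pd i f x = frechet_derivative f (at x) (axis i 1)"

definition pdx :: "'n::finite \<Rightarrow> ((real^'n) \<times> (real^'n) \<Rightarrow> real) \<Rightarrow> (real^'n) \<times> (real^'n) \<Rightarrow> real" where
  "pdx i f z = frechet_derivative f (at z) (axis i 1, 0)"

definition pdy :: "'n::finite \<Rightarrow> ((real^'n) \<times> (real^'n) \<Rightarrow> real) \<Rightarrow> (real^'n) \<times> (real^'n) \<Rightarrow> real" where
  "pdy i f z = frechet_derivative f (at z) (0, axis i 1)"

text \<open>The Jacobian entry \<open>\<partial>(x_d)\<^sup>k / \<partial>(x_c)\<^sup>a\<close> at the point \<open>p\<close>.\<close>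

definition jac :: "('m, 'n::finite) chart \<Rightarrow> ('m, 'n) chart \<Rightarrow> 'm \<Rightarrow> 'n \<Rightarrow> 'n \<Rightarrow> real" where
  "jac c d p k a = pd a (\<lambda>x. transition c d x $ k) (snd c p)"

text \<open>The second derivative \<open>\<partial>\<^sup>2(x_c)\<^sup>e / \<partial>(x_d)\<^sup>i\<partial>(x_d)\<^sup>b\<close> at the point \<open>p\<close>.\<close>

definition jac2 :: "('m, 'n::finite) chart \<Rightarrow> ('m, 'n) chart \<Rightarrow> 'm \<Rightarrow> 'n \<Rightarrow> 'n \<Rightarrow> 'n \<Rightarrow> real" where
  "jac2 d c p e i b = pd i (pd b (\<lambda>x. transition d c x $ e)) (snd d p)"

definition pos_homogeneous :: "nat \<Rightarrow> ((real^'n::finite) \<times> (real^'n)) set \<Rightarrow> ((real^'n) \<times> (real^'n) \<Rightarrow> real) \<Rightarrow> bool" where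
  "pos_homogeneous \<alpha> S f \<longleftrightarrow> (\<forall>(x, y)\<in>S. \<forall>t>0. f (x, t *\<^sub>R y) = t ^ \<alpha> * f (x, y))"

text \<open>Anisotropic tensors of type \<open>(1, 0)\<close> and \<open>(1, 1)\<close> and nonlinear connections on \<open>A\<close> are given by
  their components in each chart of the atlas: \<open>Z c k\<close> is \<open>Z\<^sup>k\<close>; \<open>J c i k\<close> and \<open>N c i k\<close> are the
  components with lower index \<open>i\<close> and upper index \<open>k\<close>. The values of these functions
  outside the coordinate image of \<open>A\<close> play no role.\<close>

type_synonym ('m, 'n) comps10 = "('m, 'n) chart \<Rightarrow> 'n \<Rightarrow> (real^'n) \<times> (real^'n) \<Rightarrow> real"
type_synonym ('m, 'n) comps11 = "('m, 'n) chart \<Rightarrow> 'n \<Rightarrow> 'n \<Rightarrow> (real^'n) \<times> (real^'n) \<Rightarrow> real"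

definition hom_tensor10 ::
    "nat \<Rightarrow> ('m, 'n::finite) chart set \<Rightarrow> ('m, 'n) tvec set \<Rightarrow> ('m, 'n) comps10 \<Rightarrow> bool" where
  "hom_tensor10 \<alpha> \<A> A Z \<longleftrightarrow>
     (\<forall>c\<in>\<A>. \<forall>k. smooth_on (coord_set \<A> c A) (Z c k) \<and> pos_homogeneous \<alpha> (coord_set \<A> c A) (Z c k)) \<and>
     (\<forall>c\<in>\<A>. \<forall>d\<in>\<A>. \<forall>w\<in>A. fst w \<in> fst c \<inter> fst d \<longrightarrow>
        (\<forall>k. Z d k (tchart d w) = (\<Sum>a\<in>UNIV. jac c d (fst w) k a * Z c a (tchart c w))))"

definition hom_tensor11 ::
    "nat \<Rightarrow> ('m, 'n::finite) chart set \<Rightarrow> ('m, 'n) tvec set \<Rightarrow> ('m, 'n) comps11 \<Rightarrow> bool" where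
  "hom_tensor11 \<alpha> \<A> A J \<longleftrightarrow>
     (\<forall>c\<in>\<A>. \<forall>i k. smooth_on (coord_set \<A> c A) (J c i k) \<and> pos_homogeneous \<alpha> (coord_set \<A> c A) (J c i k)) \<and>
     (\<forall>c\<in>\<A>. \<forall>d\<in>\<A>. \<forall>w\<in>A. fst w \<in> fst c \<inter> fst d \<longrightarrow>
        (\<forall>i k. J d i k (tchart d w) =
           (\<Sum>e\<in>UNIV. \<Sum>a\<in>UNIV. jac c d (fst w) k e * jac d c (fst w) a i * J c a e (tchart c w))))"

definition nonlinear_connection ::
    "('m, 'n::finite) chart set \<Rightarrow> ('m, 'n) tvec set \<Rightarrow> ('m, 'n) comps11 \<Rightarrow> bool" where
  "nonlinear_connection \<A> A N \<longleftrightarrow>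
     (\<forall>c\<in>\<A>. \<forall>i k. smooth_on (coord_set \<A> c A) (N c i k) \<and> pos_homogeneous 1 (coord_set \<A> c A) (N c i k)) \<and>
     (\<forall>c\<in>\<A>. \<forall>d\<in>\<A>. \<forall>w\<in>A. fst w \<in> fst c \<inter> fst d \<longrightarrow>
        (\<forall>i k. N d i k (tchart d w) =
           (\<Sum>e\<in>UNIV. \<Sum>b\<in>UNIV. jac c d (fst w) k e * jac2 d c (fst w) e i b * snd w d $ b) +
           (\<Sum>e\<in>UNIV. \<Sum>a\<in>UNIV. jac c d (fst w) k e * jac d c (fst w) a i * N c a e (tchart c w))))"

definition symmetric_connection ::
    "('m, 'n::finite) chart set \<Rightarrow> ('m, 'n) tvec set \<Rightarrow> ('m, 'n) comps11 \<Rightarrow> bool" where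
  "symmetric_connection \<A> A N \<longleftrightarrow>
     (\<forall>c\<in>\<A>. \<forall>z\<in>coord_set \<A> c A. \<forall>i j k. pdy j (N c i k) z = pdy i (N c j k) z)"

definition vertical_derivative :: "('m, 'n::finite) comps10 \<Rightarrow> ('m, 'n) comps11" where
  "vertical_derivative Z = (\<lambda>c i k. pdy i (Z c k))"

definition connection_smooth_up_to_boundary ::
    "('m, 'n::finite) chart set \<Rightarrow> ('m, 'n) tvec set \<Rightarrow> ('m, 'n) comps11 \<Rightarrow> bool" where
  "connection_smooth_up_to_boundary \<A> A N \<longleftrightarrow>
     (\<forall>c\<in>\<A>. \<forall>i k. extends_smoothly (coord_set \<A> c A) (coord_set \<A> c (slit_closure \<A> A)) (N c i k))"

definition fiberwise_analytic10 ::
    "('m, 'n::finite) chart set \<Rightarrow> ('m, 'n) tvec set \<Rightarrow> ('m, 'n) comps10 \<Rightarrow> bool" where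
  "fiberwise_analytic10 \<A> A Z \<longleftrightarrow>
     (\<forall>c\<in>\<A>. \<forall>k. \<exists>F.
        smooth_extension (coord_set \<A> c A) (coord_set \<A> c (slit_closure \<A> A)) (Z c k) F \<and>
        (\<forall>p\<in>fst c. real_analytic_on ((\<lambda>w. snd w c) ` fibre_closure \<A> A p) (\<lambda>y. F (snd c p, y))))"


section \<open>Pseudo-Finsler metrics\<close>

text \<open>The following local expressions are computed from the coordinate expression \<open>F\<close> of \<open>L\<close> in an
  induced chart.\<close>

definition fund_tensor :: "((real^'n::finite) \<times> (real^'n) \<Rightarrow> real) \<Rightarrow> (real^'n) \<times> (real^'n) \<Rightarrow> real^'n^'n" where
  "fund_tensor F z = (\<chi> i j. 1/2 * pdy j (pdy i F) z)"

definition g_low :: "((real^'n::finite) \<times> (real^'n) \<Rightarrow> real) \<Rightarrow> 'n \<Rightarrow> 'n \<Rightarrow> (real^'n) \<times> (real^'n) \<Rightarrow> real" where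
  "g_low F i j z = fund_tensor F z $ i $ j"

definition g_up :: "((real^'n::finite) \<times> (real^'n) \<Rightarrow> real) \<Rightarrow> 'n \<Rightarrow> 'n \<Rightarrow> (real^'n) \<times> (real^'n) \<Rightarrow> real" where
  "g_up F i j z = matrix_inv (fund_tensor F z) $ i $ j"

definition y_low :: "((real^'n::finite) \<times> (real^'n) \<Rightarrow> real) \<Rightarrow> 'n \<Rightarrow> (real^'n) \<times> (real^'n) \<Rightarrow> real" where
  "y_low F i z = (\<Sum>a\<in>UNIV. g_low F i a z * snd z $ a)"

definition spray :: "((real^'n::finite) \<times> (real^'n) \<Rightarrow> real) \<Rightarrow> 'n \<Rightarrow> (real^'n) \<times> (real^'n) \<Rightarrow> real" where
  "spray F i z = 1/4 * (\<Sum>a\<in>UNIV. \<Sum>b\<in>UNIV. \<Sum>c\<in>UNIV.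
     g_up F i a z * (2 * pdx c (g_low F a b) z - pdx a (g_low F b c) z) * snd z $ b * snd z $ c)"

definition metric_conn :: "((real^'n::finite) \<times> (real^'n) \<Rightarrow> real) \<Rightarrow> 'n \<Rightarrow> 'n \<Rightarrow> (real^'n) \<times> (real^'n) \<Rightarrow> real" where
  "metric_conn F i k = pdy i (spray F k)"

definition cartan :: "((real^'n::finite) \<times> (real^'n) \<Rightarrow> real) \<Rightarrow> 'n \<Rightarrow> 'n \<Rightarrow> 'n \<Rightarrow> (real^'n) \<times> (real^'n) \<Rightarrow> real" where
  "cartan F i j k z = 1/2 * pdy k (g_low F i j) z"

definition mean_cartan :: "((real^'n::finite) \<times> (real^'n) \<Rightarrow> real) \<Rightarrow> 'n \<Rightarrow> (real^'n) \<times> (real^'n) \<Rightarrow> real" where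
  "mean_cartan F i z = (\<Sum>a\<in>UNIV. \<Sum>b\<in>UNIV. g_up F a b z * cartan F a b i z)"

definition landsberg :: "((real^'n::finite) \<times> (real^'n) \<Rightarrow> real) \<Rightarrow> 'n \<Rightarrow> 'n \<Rightarrow> 'n \<Rightarrow> (real^'n) \<times> (real^'n) \<Rightarrow> real" where
  "landsberg F i j k z = 1/2 *
     (pdx k (g_low F i j) z - (\<Sum>a\<in>UNIV. metric_conn F k a z * pdy a (g_low F i j) z)
      - (\<Sum>a\<in>UNIV. pdy i (metric_conn F k a) z * g_low F a j z)
      - (\<Sum>a\<in>UNIV. pdy j (metric_conn F k a) z * g_low F i a z))"

definition mean_landsberg :: "((real^'n::finite) \<times> (real^'n) \<Rightarrow> real) \<Rightarrow> 'n \<Rightarrow> (real^'n) \<times> (real^'n) \<Rightarrow> real" where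
  "mean_landsberg F i z = (\<Sum>a\<in>UNIV. \<Sum>b\<in>UNIV. g_up F a b z * landsberg F a b i z)"

definition definite_matrix :: "real^'n^'n::finite \<Rightarrow> bool" where
  "definite_matrix G \<longleftrightarrow> (\<forall>v. v \<noteq> 0 \<longrightarrow> v \<bullet> (G *v v) > 0) \<or> (\<forall>v. v \<noteq> 0 \<longrightarrow> v \<bullet> (G *v v) < 0)"

definition pseudo_finsler ::
    "('m, 'n::finite) chart set \<Rightarrow> ('m, 'n) tvec set \<Rightarrow> (('m, 'n) tvec \<Rightarrow> real) \<Rightarrow> bool" where
  "pseudo_finsler \<A> A L \<longleftrightarrow>
     smooth_function \<A> A L \<and>
     (\<forall>w\<in>A. \<forall>t>0. L (scale_tvec t w) = t\<^sup>2 * L w) \<and>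
     (\<forall>c\<in>\<A>. \<forall>z\<in>coord_set \<A> c A. invertible (fund_tensor (coord_fun \<A> c L) z))"

definition proper_pseudo_finsler ::
    "('m, 'n::finite) chart set \<Rightarrow> ('m, 'n) tvec set \<Rightarrow> (('m, 'n) tvec \<Rightarrow> real) \<Rightarrow> bool" where
  "proper_pseudo_finsler \<A> A L \<longleftrightarrow>
     pseudo_finsler \<A> A L \<and>
     (\<forall>p\<in>(\<Union>c\<in>\<A>. fst c). connectedin (tangent_topology \<A>) (fibre A p)) \<and>
     (\<forall>w\<in>A. L w > 0) \<and>
     (\<exists>W L'. openin (tangent_topology \<A>) W \<and> slit_closure \<A> A \<subseteq> W \<and> smooth_function \<A> W L' \<and>
        (\<forall>w\<in>A. L' w = L w) \<and>
        (\<forall>w\<in>slit_boundary \<A> A. L' w = 0) \<and>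
        (\<forall>c\<in>\<A>. \<forall>z\<in>coord_set \<A> c (slit_boundary \<A> A). invertible (fund_tensor (coord_fun \<A> c L') z)))"

definition nondefinite_signature ::
    "('m, 'n::finite) chart set \<Rightarrow> ('m, 'n) tvec set \<Rightarrow> (('m, 'n) tvec \<Rightarrow> real) \<Rightarrow> bool" where
  "nondefinite_signature \<A> A L \<longleftrightarrow>
     (\<forall>c\<in>\<A>. \<forall>z\<in>coord_set \<A> c A. \<not> definite_matrix (fund_tensor (coord_fun \<A> c L) z))"


section \<open>The affine equation\<close>

definition sum_with_metric_conn ::
    "('m, 'n::finite) chart set \<Rightarrow> ('m, 'n) tvec set \<Rightarrow> (('m, 'n) tvec \<Rightarrow> real) \<Rightarrow>
     ('m, 'n) comps11 \<Rightarrow> ('m, 'n) comps11 \<Rightarrow> bool" where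
  "sum_with_metric_conn \<A> A L J N \<longleftrightarrow>
     (\<forall>c\<in>\<A>. \<forall>z\<in>coord_set \<A> c A. \<forall>i k. N c i k z = metric_conn (coord_fun \<A> c L) i k z + J c i k z)"

definition kron :: "'n \<Rightarrow> 'n \<Rightarrow> real" where
  "kron i j = (if i = j then 1 else 0)"

text \<open>The left-hand side of the affine equation in a chart, with \<open>F\<close> and \<open>J\<close> the coordinate
  expressions of \<open>L\<close> and of the connection difference (\<open>J a b\<close> is the component with lower index \<open>a\<close>
  and upper index \<open>b\<close>).\<close>

definition affine_lhs ::
    "((real^'n::finite) \<times> (real^'n) \<Rightarrow> real) \<Rightarrow> ('n \<Rightarrow> 'n \<Rightarrow> (real^'n) \<times> (real^'n) \<Rightarrow> real) \<Rightarrow>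
     'n \<Rightarrow> 'n \<Rightarrow> (real^'n) \<times> (real^'n) \<Rightarrow> real" where
  "affine_lhs F J i j z =
     (\<Sum>b\<in>UNIV.
        (2 * mean_landsberg F b z
         + (real CARD('n) + 2) * (\<Sum>a\<in>UNIV. y_low F a z / F z * J b a z)
         - 2 * (\<Sum>a\<in>UNIV. mean_cartan F a z * J b a z)
         - (\<Sum>a\<in>UNIV. pdy a (J b a) z + pdy b (J a a) z))
        * (kron b i * snd z $ j - snd z $ b * kron j i))
     - (\<Sum>a\<in>UNIV. (pdy a (J i j) z - pdy i (J a j) z) * snd z $ a)"

definition affine_solution ::
    "('m, 'n::finite) chart set \<Rightarrow> ('m, 'n) tvec set \<Rightarrow> (('m, 'n) tvec \<Rightarrow> real) \<Rightarrow>
     ('m, 'n) comps11 \<Rightarrow> bool" where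
  "affine_solution \<A> A L N \<longleftrightarrow>
     nonlinear_connection \<A> A N \<and>
     (\<exists>J. hom_tensor11 1 \<A> A J \<and> sum_with_metric_conn \<A> A L J N \<and>
        (\<forall>c\<in>\<A>. \<forall>z\<in>coord_set \<A> c A. \<forall>i j. affine_lhs (coord_fun \<A> c L) (J c) i j z = 0))"

definition proper_affine_solution ::
    "('m, 'n::finite) chart set \<Rightarrow> ('m, 'n) tvec set \<Rightarrow> (('m, 'n) tvec \<Rightarrow> real) \<Rightarrow>
     ('m, 'n) comps11 \<Rightarrow> bool" where
  "proper_affine_solution \<A> A L N \<longleftrightarrow>
     affine_solution \<A> A L N \<and> connection_smooth_up_to_boundary \<A> A N"

definition connections_agree ::
    "('m, 'n::finite) chart set \<Rightarrow> ('m, 'n) tvec set \<Rightarrow> ('m, 'n) comps11 \<Rightarrow> ('m, 'n) comps11 \<Rightarrow> bool" where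
  "connections_agree \<A> A N N' \<longleftrightarrow> (\<forall>c\<in>\<A>. \<forall>z\<in>coord_set \<A> c A. \<forall>i k. N c i k z = N' c i k z)"

end

theory Submission
  imports Defs
begin

text \<open>
  Let \<open>\<zeta> = \<Z> - \<Z>'\<close> be the difference of the vector fields of the two solutions. For a connection difference
  \<open>\<J>\<^sup>a\<^sub>b = \<Z>\<^sup>a\<^sub>\<cdot>\<^sub>b\<close> that is a vertical derivative the torsion term of the affine equation vanishes, and
  what remains says that the covector in braces is zero (\<open>affine_covector_zero\<close>). Subtracting the two
  equations removes the Landsberg term. So, on each tangent space, where only derivatives in \<open>y\<close> occur,
  \<open>(n+2) y\<^sub>a \<zeta>\<^sup>a\<^sub>\<cdot>\<^sub>b = 2 L (C\<^sub>a \<zeta>\<^sup>a\<^sub>\<cdot>\<^sub>b + (\<zeta>\<^sup>a\<^sub>\<cdot>\<^sub>a)\<^sub>\<cdot>\<^sub>b)\<close>.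

  The point is that this equation lets one divide \<open>\<zeta>\<close> by \<open>L\<close> as often as one likes. Split
  \<open>\<zeta> = \<eta> + \<rho> y\<close> with \<open>y\<^sub>a \<eta>\<^sup>a = 0\<close>; the equation gives \<open>\<rho> = \<eta>\<^sup>a\<^sub>\<cdot>\<^sub>a + 2 C\<^sub>a \<eta>\<^sup>a\<close> and expresses
  \<open>\<eta>\<^sub>b - \<rho> y\<^sub>b\<close> as a multiple of \<open>L\<close> (\<open>orthogonal_splitting\<close>). If \<open>\<eta> = L\<^sup>k \<theta>\<close>, inserting this yields
  \<open>\<theta> = \<tau> y + L \<xi>\<close>, and taking the divergence and the product with \<open>y\<close> shows that
  \<open>(1 - (1-2k)(n-1-2k)) \<tau>\<close> is a multiple of \<open>L\<close>. For \<open>n \<ge> 3\<close> the integer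
  \<open>(1-2k)(n-1-2k)\<close> is never \<open>1\<close>; so \<open>\<theta>\<close> itself is a multiple of \<open>L\<close>, and \<open>\<eta>\<close> is divisible by \<open>L\<^sup>k\<^sup>+\<^sup>1\<close>
  (\<open>orthogonal_part_divide_by_L\<close>). All quotients are given by explicit
  differential expressions, hence they stay smooth up to the boundary of \<open>A\<^sub>p\<close>, where \<open>L\<close> vanishes. Therefore \<open>\<zeta>\<close>
  vanishes to infinite order at every boundary point (\<open>affine_eq_flat_at_boundary\<close>).

  A boundary point \<open>y\<^sub>0 \<noteq> 0\<close> exists: otherwise \<open>A\<^sub>p\<close> would be the whole punctured tangent space, and
  \<open>g\<close> would be positive definite where the positive function \<open>L\<close> is minimal on the unit sphere
  (\<open>positive_function_hessian_definite_somewhere\<close>). Moreover \<open>y\<^sub>0\<close> can be chosen on the sphere around a ball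
  inside \<open>A\<^sub>p\<close>. On each segment from \<open>y\<^sub>0\<close> into that ball, \<open>\<zeta>\<close> is a power series in one variable which is flat at \<open>0\<close>.
  So \<open>\<zeta>\<close> vanishes on the ball and, by the identity theorem, on the connected set \<open>A\<^sub>p\<close>
  (\<open>real_analytic_on_flat_at_boundary\<close>).
\<close>

section \<open>Smooth functions on open sets\<close>

lemma Ck_on_subset: "Ck_on k S f \<Longrightarrow> T \<subseteq> S \<Longrightarrow> Ck_on k T f"
  by (induction k arbitrary: f) (auto intro: continuous_on_subset)

lemma Ck_on_SucD: "Ck_on (Suc k) S f \<Longrightarrow> Ck_on k S f"
proof (induction k arbitrary: f)
  case 0
  then show ?case
    by (auto intro!: continuous_at_imp_continuous_on differentiable_imp_continuous_within)
next
  case (Suc k)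
  from Suc.prems have "\<forall>x\<in>S. f differentiable (at x)"
    and "\<And>v. Ck_on (Suc k) S (\<lambda>x. frechet_derivative f (at x) v)"
    by simp_all
  with Suc.IH show ?case by simp
qed

lemma frechet_derivative_cong_open:
  assumes "open S" "x \<in> S" "\<And>x. x \<in> S \<Longrightarrow> f x = g x"
  shows "frechet_derivative f (at x) = frechet_derivative g (at x)"
proof -
  have "(f has_derivative D) (at x) \<longleftrightarrow> (g has_derivative D) (at x)" for D
    using assms has_derivative_transform_within_open[of f D x UNIV S g]
      has_derivative_transform_within_open[of g D x UNIV S f]
    by auto
  then show ?thesis
    by (simp add: frechet_derivative_def)
qed

lemma differentiable_cong_open:
  assumes "open S" "x \<in> S" "\<And>x. x \<in> S \<Longrightarrow> f x = g x" "f differentiable (at x)"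
  shows "g differentiable (at x)"
  using assms has_derivative_transform_within_open[of f _ x UNIV S g]
  unfolding differentiable_def by blast

lemma Ck_on_cong:
  assumes "open S" "\<And>x. x \<in> S \<Longrightarrow> f x = g x" "Ck_on k S f"
  shows "Ck_on k S g"
  using assms(2,3)
proof (induction k arbitrary: f g)
  case 0
  then show ?case using continuous_on_cong[of S S f g] by simp
next
  case (Suc k)
  have "Ck_on k S (\<lambda>x. frechet_derivative g (at x) v)" for v
    using Suc.IH[of "\<lambda>x. frechet_derivative f (at x) v" "\<lambda>x. frechet_derivative g (at x) v"]
      Suc.prems frechet_derivative_cong_open[OF assms(1), of _ f g]
    by simp
  moreover have "\<forall>x\<in>S. g differentiable (at x)"
    using Suc.prems differentiable_cong_open[OF assms(1), of _ f g] by auto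
  ultimately show ?case by simp
qed

lemma Ck_on_const: "Ck_on k S (\<lambda>x. c)"
  by (induction k arbitrary: c) (auto simp: frechet_derivative_const)

lemma Ck_on_bounded_linear:
  assumes "bounded_linear f"
  shows "Ck_on k S f"
proof (cases k)
  case 0
  then show ?thesis using assms linear_continuous_on by auto
next
  case (Suc j)
  have "(f has_derivative f) (at x)" for x
    using assms bounded_linear_imp_has_derivative by blast
  then have "f differentiable (at x)" and fD: "f = frechet_derivative f (at x)" for x
    using frechet_derivative_at by (blast intro: differentiableI)+
  show ?thesis using Suc \<open>\<And>x. f differentiable (at x)\<close> by (simp add: Ck_on_const fD[symmetric])
qed

lemma frechet_derivative_add_fun:
  assumes "f differentiable (at x)" "g differentiable (at x)"
  shows "frechet_derivative (\<lambda>x. f x + g x) (at x) v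
    = frechet_derivative f (at x) v + frechet_derivative g (at x) v"
proof -
  have "((\<lambda>x. f x + g x) has_derivative
     (\<lambda>h. frechet_derivative f (at x) h + frechet_derivative g (at x) h)) (at x)"
    using assms by (intro has_derivative_add) (auto simp: frechet_derivative_works)
  then show ?thesis by (metis frechet_derivative_at)
qed

lemma frechet_derivative_mult_fun:
  fixes f g :: "'a::real_normed_vector \<Rightarrow> real"
  assumes "f differentiable (at x)" "g differentiable (at x)"
  shows "frechet_derivative (\<lambda>x. f x * g x) (at x) v
    = f x * frechet_derivative g (at x) v + frechet_derivative f (at x) v * g x"
proof -
  have "((\<lambda>x. f x * g x) has_derivative
     (\<lambda>h. f x * frechet_derivative g (at x) h + frechet_derivative f (at x) h * g x)) (at x)"
    using assms by (intro has_derivative_mult) (auto simp: frechet_derivative_works)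
  then show ?thesis by (metis frechet_derivative_at)
qed

lemma Ck_on_add:
  assumes "open S" "Ck_on k S f" "Ck_on k S g"
  shows "Ck_on k S (\<lambda>x. f x + g x)"
  using assms(2,3)
proof (induction k arbitrary: f g)
  case 0
  then show ?case by (auto intro: continuous_intros)
next
  case (Suc k)
  have "Ck_on k S (\<lambda>x. frechet_derivative (\<lambda>x. f x + g x) (at x) v)" for v
    by (rule Ck_on_cong[OF assms(1), of "\<lambda>x. frechet_derivative f (at x) v + frechet_derivative g (at x) v"])
      (use Suc in \<open>auto simp: frechet_derivative_add_fun\<close>)
  then show ?case using Suc.prems by auto
qed

lemma Ck_on_mult:
  fixes f g :: "'a::euclidean_space \<Rightarrow> real"
  assumes "open S" "Ck_on k S f" "Ck_on k S g"
  shows "Ck_on k S (\<lambda>x. f x * g x)"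
  using assms(2,3)
proof (induction k arbitrary: f g)
  case 0
  then show ?case by (auto intro: continuous_intros)
next
  case (Suc k)
  have "Ck_on k S (\<lambda>x. frechet_derivative (\<lambda>x. f x * g x) (at x) v)" for v
  proof (rule Ck_on_cong[OF assms(1)])
    show "Ck_on k S (\<lambda>x. f x * frechet_derivative g (at x) v + frechet_derivative f (at x) v * g x)"
      using Suc.prems Suc.prems[THEN Ck_on_SucD] by (intro Ck_on_add[OF assms(1)] Suc.IH) auto
    show "f x * frechet_derivative g (at x) v + frechet_derivative f (at x) v * g x
        = frechet_derivative (\<lambda>x. f x * g x) (at x) v" if "x \<in> S" for x
      using Suc.prems that by (simp add: frechet_derivative_mult_fun)
  qed
  then show ?case using Suc.prems by auto
qed

lemma frechet_derivative_inverse_fun: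
  fixes f :: "'a::euclidean_space \<Rightarrow> real"
  assumes "f differentiable (at x)" "f x \<noteq> 0"
  shows "frechet_derivative (\<lambda>x. inverse (f x)) (at x) v
    = - (inverse (f x) * frechet_derivative f (at x) v * inverse (f x))"
proof -
  have "((\<lambda>x. inverse (f x)) has_derivative
     (\<lambda>h. - (inverse (f x) * frechet_derivative f (at x) h * inverse (f x)))) (at x)"
    using assms by (intro Deriv.has_derivative_inverse) (auto simp: frechet_derivative_works)
  then show ?thesis by (metis frechet_derivative_at)
qed

lemma Ck_on_inverse:
  fixes f :: "'a::euclidean_space \<Rightarrow> real"
  assumes "open S" "Ck_on k S f" "\<And>x. x \<in> S \<Longrightarrow> f x \<noteq> 0"
  shows "Ck_on k S (\<lambda>x. inverse (f x))"
  using assms(2)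
proof (induction k)
  case 0
  then show ?case using assms(3) by (auto intro: continuous_intros)
next
  case (Suc k)
  have IH: "Ck_on k S (\<lambda>x. inverse (f x))"
    using Suc Ck_on_SucD by blast
  have "Ck_on k S (\<lambda>x. frechet_derivative (\<lambda>x. inverse (f x)) (at x) v)" for v
  proof (rule Ck_on_cong[OF assms(1)])
    show "Ck_on k S (\<lambda>x. (- 1) * (inverse (f x) * frechet_derivative f (at x) v * inverse (f x)))"
      using Suc.prems by (intro Ck_on_mult[OF assms(1)] IH Ck_on_const) auto
    show "(- 1) * (inverse (f x) * frechet_derivative f (at x) v * inverse (f x))
        = frechet_derivative (\<lambda>x. inverse (f x)) (at x) v" if "x \<in> S" for x
      using Suc.prems that assms(3)[OF that] by (simp add: frechet_derivative_inverse_fun)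
  qed
  then show ?case using Suc.prems assms(3) by auto
qed

lemma has_derivative_slice:
  fixes F :: "'a::euclidean_space \<times> 'c::euclidean_space \<Rightarrow> 'b::euclidean_space"
  assumes "F differentiable (at (a, y))"
  shows "((\<lambda>y. F (a, y)) has_derivative (\<lambda>v. frechet_derivative F (at (a, y)) (0, v))) (at y)"
proof -
  have "((\<lambda>y. (a, y)) has_derivative (\<lambda>v. (0, v))) (at y)"
    by (auto intro!: derivative_eq_intros)
  moreover have "(F has_derivative frechet_derivative F (at (a, y))) (at (a, y))"
    using assms by (simp add: frechet_derivative_works)
  ultimately show ?thesis
    using has_derivative_compose by blast
qed

lemma open_slice: "open W \<Longrightarrow> open {y. (a, y) \<in> W}"
  using open_vimage[of W "\<lambda>y. (a, y)"] by (simp add: vimage_def continuous_intros)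

lemma Ck_on_slice:
  assumes "open W" "Ck_on k W F"
  shows "Ck_on k {y. (a, y) \<in> W} (\<lambda>y. F (a, y))"
  using assms(2)
proof (induction k arbitrary: F)
  case 0
  then have "continuous_on W F" by simp
  then show ?case
    by (auto intro!: continuous_on_compose2[of W F] continuous_intros)
next
  case (Suc k)
  note op = open_slice[OF assms(1)]
  have "Ck_on k {y. (a, y) \<in> W} (\<lambda>y. frechet_derivative (\<lambda>y. F (a, y)) (at y) v)" for v
  proof (rule Ck_on_cong[OF op])
    show "Ck_on k {y. (a, y) \<in> W} (\<lambda>y. frechet_derivative F (at (a, y)) (0, v))"
      using Suc.prems by (intro Suc.IH) simp
    show "frechet_derivative F (at (a, y)) (0, v) = frechet_derivative (\<lambda>y. F (a, y)) (at y) v"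
      if "y \<in> {y. (a, y) \<in> W}" for y
      using that Suc.prems frechet_derivative_at[OF has_derivative_slice, of F a y] by (auto dest: fun_cong)
  qed
  moreover have "\<forall>y. (a, y) \<in> W \<longrightarrow> (\<lambda>y. F (a, y)) differentiable (at y)"
    using Suc.prems differentiableI[OF has_derivative_slice, of F a] by auto
  ultimately show ?case by simp
qed

lemma smooth_on_imp_continuous_on: "smooth_on S f \<Longrightarrow> continuous_on S f"
  unfolding smooth_on_def by (metis Ck_on.simps(1))

lemma smooth_on_imp_differentiable: "smooth_on S f \<Longrightarrow> x \<in> S \<Longrightarrow> f differentiable (at x)"
  unfolding smooth_on_def by (metis Ck_on.simps(2))

lemma smooth_on_frechet_derivative:
  "smooth_on S f \<Longrightarrow> smooth_on S (\<lambda>x. frechet_derivative f (at x) v)"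
  unfolding smooth_on_def by (metis Ck_on.simps(2))

lemma smooth_on_pd: "smooth_on S f \<Longrightarrow> smooth_on S (pd i f)"
  using smooth_on_frechet_derivative[of S f "axis i 1"] by (simp add: pd_def[abs_def])

lemma smooth_on_subset: "smooth_on S f \<Longrightarrow> T \<subseteq> S \<Longrightarrow> smooth_on T f"
  unfolding smooth_on_def using Ck_on_subset by blast

lemma smooth_on_cong:
  "open S \<Longrightarrow> (\<And>x. x \<in> S \<Longrightarrow> f x = g x) \<Longrightarrow> smooth_on S f \<Longrightarrow> smooth_on S g"
  unfolding smooth_on_def using Ck_on_cong by blast

lemma smooth_on_const: "smooth_on S (\<lambda>x. c)"
  unfolding smooth_on_def using Ck_on_const by blast

lemma smooth_on_component: "smooth_on S (\<lambda>y::real^'n::finite. y $ i)"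
  unfolding smooth_on_def using Ck_on_bounded_linear bounded_linear_vec_nth by blast

lemma smooth_on_add: "open S \<Longrightarrow> smooth_on S f \<Longrightarrow> smooth_on S g \<Longrightarrow> smooth_on S (\<lambda>x. f x + g x)"
  unfolding smooth_on_def using Ck_on_add by blast

lemma smooth_on_mult:
  fixes f g :: "'a::euclidean_space \<Rightarrow> real"
  shows "open S \<Longrightarrow> smooth_on S f \<Longrightarrow> smooth_on S g \<Longrightarrow> smooth_on S (\<lambda>x. f x * g x)"
  unfolding smooth_on_def using Ck_on_mult by blast

lemma smooth_on_inverse:
  fixes f :: "'a::euclidean_space \<Rightarrow> real"
  shows "open S \<Longrightarrow> smooth_on S f \<Longrightarrow> (\<And>x. x \<in> S \<Longrightarrow> f x \<noteq> 0) \<Longrightarrow> smooth_on S (\<lambda>x. inverse (f x))"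
  unfolding smooth_on_def using Ck_on_inverse by blast

lemma smooth_on_slice:
  "open W \<Longrightarrow> smooth_on W F \<Longrightarrow> smooth_on {y. (a, y) \<in> W} (\<lambda>y. F (a, y))"
  unfolding smooth_on_def using Ck_on_slice by blast

lemma smooth_on_sum:
  "open S \<Longrightarrow> (\<And>i. i \<in> I \<Longrightarrow> smooth_on S (f i)) \<Longrightarrow> smooth_on S (\<lambda>x. \<Sum>i\<in>I. f i x)"
  by (induction I rule: infinite_finite_induct) (auto intro: smooth_on_add smooth_on_const)

lemma smooth_on_prod:
  fixes f :: "'i \<Rightarrow> 'a::euclidean_space \<Rightarrow> real"
  shows "open S \<Longrightarrow> (\<And>i. i \<in> I \<Longrightarrow> smooth_on S (f i)) \<Longrightarrow> smooth_on S (\<lambda>x. \<Prod>i\<in>I. f i x)"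
  by (induction I rule: infinite_finite_induct) (auto intro: smooth_on_mult smooth_on_const)

lemma smooth_on_det:
  fixes G :: "'a::euclidean_space \<Rightarrow> real^'n::finite^'n"
  assumes "open S" "\<And>i j. smooth_on S (\<lambda>x. G x $ i $ j)"
  shows "smooth_on S (\<lambda>x. det (G x))"
  unfolding det_def
  by (intro smooth_on_sum smooth_on_mult smooth_on_prod smooth_on_const assms)

lemma invertible_matrix_inv:
  assumes "invertible A"
  shows "A ** matrix_inv A = mat 1" "matrix_inv A ** A = mat 1"
  using assms someI_ex[of "\<lambda>B. A ** B = mat 1 \<and> B ** A = mat 1"]
  unfolding invertible_def matrix_inv_def by auto

text \<open>By Cramer's rule the entries of the inverse are quotients of determinants, that is, of polynomials in
  the entries.\<close>

lemma smooth_on_matrix_inv: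
  fixes G :: "'a::euclidean_space \<Rightarrow> real^'n::finite^'n"
  assumes "open S" and G: "\<And>i j. smooth_on S (\<lambda>x. G x $ i $ j)"
    and inv: "\<And>x. x \<in> S \<Longrightarrow> invertible (G x)"
  shows "smooth_on S (\<lambda>x. matrix_inv (G x) $ i $ j)"
proof -
  have det: "det (G x) \<noteq> 0" if "x \<in> S" for x
    using inv[OF that] by (simp add: invertible_det_nz)
  define B where "B x = (\<chi> r c. if c = i then axis j 1 $ r else G x $ r $ c)" for x
  have eq: "det (B x) * inverse (det (G x)) = matrix_inv (G x) $ i $ j" if "x \<in> S" for x
  proof -
    have "G x *v (matrix_inv (G x) *v axis j 1) = axis j 1"
      using inv[OF that] by (simp add: matrix_vector_mul_assoc invertible_matrix_inv)
    then have "(matrix_inv (G x) *v axis j 1) $ i = det (B x) / det (G x)"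
      using cramer[OF det[OF that]] by (simp add: B_def)
    then show ?thesis
      by (simp add: matrix_vector_mult_basis column_def divide_inverse)
  qed
  have "smooth_on S (\<lambda>x. B x $ r $ c)" for r c
    by (cases "c = i") (auto simp: B_def intro: smooth_on_const G)
  then have "smooth_on S (\<lambda>x. det (B x) * inverse (det (G x)))"
    by (intro smooth_on_mult smooth_on_inverse smooth_on_det assms det) auto
  then show ?thesis
    by (rule smooth_on_cong[OF assms(1) eq, rotated])
qed

lemma has_field_derivative_along_line:
  fixes f :: "'a::euclidean_space \<Rightarrow> real"
  assumes "f differentiable (at (x + s *\<^sub>R v))"
  shows "((\<lambda>s. f (x + s *\<^sub>R v)) has_real_derivative frechet_derivative f (at (x + s *\<^sub>R v)) v) (at s)"
proof -
  have "((\<lambda>s. x + s *\<^sub>R v) has_derivative (\<lambda>t. t *\<^sub>R v)) (at s)"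
    by (auto intro!: derivative_eq_intros)
  moreover have D: "(f has_derivative frechet_derivative f (at (x + s *\<^sub>R v))) (at (x + s *\<^sub>R v))"
    using assms by (simp add: frechet_derivative_works)
  ultimately have "((\<lambda>s. f (x + s *\<^sub>R v)) has_derivative
      (\<lambda>t. frechet_derivative f (at (x + s *\<^sub>R v)) (t *\<^sub>R v))) (at s)"
    using has_derivative_compose by blast
  moreover have "frechet_derivative f (at (x + s *\<^sub>R v)) (t *\<^sub>R v)
      = t * frechet_derivative f (at (x + s *\<^sub>R v)) v" for t
    using linear_frechet_derivative[OF assms] by (simp add: linear_scale)
  ultimately show ?thesis
    by (simp add: has_field_derivative_def mult.commute[of _ "frechet_derivative f (at (x + s *\<^sub>R v)) v"])
qed

text \<open>The left-hand side of the final equation is symmetric in \<open>v\<close> and \<open>w\<close>; applying the mean value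
  theorem first along \<open>v\<close> and then along \<open>w\<close> identifies it with one mixed derivative, and exchanging the roles
  with the other one. Letting \<open>h\<close> tend to \<open>0\<close> gives Schwarz's theorem, the next lemma.\<close>

lemma second_difference_eq_mixed_derivative:
  fixes f :: "'a::euclidean_space \<Rightarrow> real"
  defines "D \<equiv> \<lambda>v (f :: 'a \<Rightarrow> real) x. frechet_derivative f (at x) v"
  assumes h: "h > 0"
    and f: "\<And>s t. 0 \<le> s \<Longrightarrow> s \<le> h \<Longrightarrow> 0 \<le> t \<Longrightarrow> t \<le> h \<Longrightarrow>
       f differentiable (at (x + s *\<^sub>R v + t *\<^sub>R w)) \<and> D v f differentiable (at (x + s *\<^sub>R v + t *\<^sub>R w))"
  shows "\<exists>s t. 0 < s \<and> s < h \<and> 0 < t \<and> t < h \<and>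
    f (x + h *\<^sub>R v + h *\<^sub>R w) - f (x + h *\<^sub>R v) - f (x + h *\<^sub>R w) + f x
      = h * h * D w (D v f) (x + s *\<^sub>R v + t *\<^sub>R w)"
proof -
  define p where "p s = f ((x + h *\<^sub>R w) + s *\<^sub>R v) - f (x + s *\<^sub>R v)" for s
  have "\<exists>s. 0 < s \<and> s < h \<and> p h - p 0 = (h - 0) * (D v f ((x + h *\<^sub>R w) + s *\<^sub>R v) - D v f (x + s *\<^sub>R v))"
  proof (rule MVT2)
    fix s assume "0 \<le> s" "s \<le> h"
    with f[of s h] f[of s 0] h show "DERIV p s :> D v f ((x + h *\<^sub>R w) + s *\<^sub>R v) - D v f (x + s *\<^sub>R v)"
      unfolding p_def[abs_def] D_def
      by (intro DERIV_diff has_field_derivative_along_line) (simp_all add: algebra_simps)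
  qed (use h in auto)
  then obtain s where s: "0 < s" "s < h"
    and 1: "p h - p 0 = h * (D v f ((x + s *\<^sub>R v) + h *\<^sub>R w) - D v f ((x + s *\<^sub>R v) + 0 *\<^sub>R w))"
    by (auto simp: algebra_simps)
  have "\<exists>t. 0 < t \<and> t < h \<and> D v f ((x + s *\<^sub>R v) + h *\<^sub>R w) - D v f ((x + s *\<^sub>R v) + 0 *\<^sub>R w)
      = (h - 0) * (D w (D v f) ((x + s *\<^sub>R v) + t *\<^sub>R w))"
  proof (rule MVT2)
    fix t assume "0 \<le> t" "t \<le> h"
    with f[of s t] s have "D v f differentiable (at (x + s *\<^sub>R v + t *\<^sub>R w))" by simp
    from has_field_derivative_along_line[OF this]
    show "DERIV (\<lambda>t. D v f ((x + s *\<^sub>R v) + t *\<^sub>R w)) t :> D w (D v f) ((x + s *\<^sub>R v) + t *\<^sub>R w)"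
      unfolding D_def .
  qed (use h in auto)
  then obtain t where t: "0 < t" "t < h" "D v f ((x + s *\<^sub>R v) + h *\<^sub>R w) - D v f ((x + s *\<^sub>R v) + 0 *\<^sub>R w)
      = h * (D w (D v f) ((x + s *\<^sub>R v) + t *\<^sub>R w))"
    by auto
  have "f (x + h *\<^sub>R v + h *\<^sub>R w) - f (x + h *\<^sub>R v) - f (x + h *\<^sub>R w) + f x = p h - p 0"
    by (simp add: p_def algebra_simps)
  also have "\<dots> = h * h * D w (D v f) (x + s *\<^sub>R v + t *\<^sub>R w)"
    using 1 t by simp
  finally show ?thesis using s t by blast
qed

lemma frechet_derivative_commute:
  fixes f :: "'a::euclidean_space \<Rightarrow> real"
  assumes W: "open W" "x \<in> W" and f: "smooth_on W f"
  shows "frechet_derivative (\<lambda>x. frechet_derivative f (at x) v) (at x) w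
       = frechet_derivative (\<lambda>x. frechet_derivative f (at x) w) (at x) v"
proof -
  define D where "D v f x = frechet_derivative f (at x) v" for v and f :: "'a \<Rightarrow> real" and x
  have sm: "smooth_on W (D v f)" "smooth_on W (D w (D v f))" "smooth_on W (D v (D w f))" "smooth_on W (D w f)"
    unfolding D_def by (intro smooth_on_frechet_derivative f)+
  obtain e where e: "e > 0" "ball x e \<subseteq> W" using W openE by blast
  have "dist (D w (D v f) x) (D v (D w f) x) < \<epsilon>" if "\<epsilon> > 0" for \<epsilon>
  proof -
    have close: "\<exists>d>0. \<forall>y. dist y x < d \<longrightarrow> dist (g y) (g x) < \<epsilon> / 2" if "smooth_on W g" for g :: "'a \<Rightarrow> real"
    proof -
      have "isCont g x"
        using that W smooth_on_imp_differentiable differentiable_imp_continuous_within by blast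
      then show ?thesis
        using \<open>\<epsilon> > 0\<close> half_gt_zero[of \<epsilon>] unfolding continuous_at_eps_delta by blast
    qed
    obtain d1 where d1: "d1 > 0" "\<And>y. dist y x < d1 \<Longrightarrow> dist (D w (D v f) y) (D w (D v f) x) < \<epsilon> / 2"
      using close[OF sm(2)] by blast
    obtain d2 where d2: "d2 > 0" "\<And>y. dist y x < d2 \<Longrightarrow> dist (D v (D w f) y) (D v (D w f) x) < \<epsilon> / 2"
      using close[OF sm(3)] by blast
    define d where "d = min e (min d1 d2)"
    define h where "h = d / (norm v + norm w + 1)"
    have nz: "norm v + norm w + 1 > 0"
      by (smt (verit) norm_ge_zero)
    have "d > 0" using d1 d2 e by (simp add: d_def)
    then have h: "h > 0" using nz by (simp add: h_def)
    have hd: "h * (norm v + norm w + 1) = d" using nz by (simp add: h_def)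
    have near: "dist (x + s *\<^sub>R v + t *\<^sub>R w) x < d" if "0 \<le> s" "s \<le> h" "0 \<le> t" "t \<le> h" for s t
    proof -
      have "dist (x + s *\<^sub>R v + t *\<^sub>R w) x = norm (s *\<^sub>R v + t *\<^sub>R w)" by (simp add: dist_norm algebra_simps)
      also have "\<dots> \<le> s * norm v + t * norm w"
        using norm_triangle_ineq[of "s *\<^sub>R v" "t *\<^sub>R w"] that by simp
      also have "\<dots> \<le> h * norm v + h * norm w"
        using that by (intro add_mono mult_right_mono) auto
      also have "\<dots> < d" using h hd by (simp add: algebra_simps)
      finally show ?thesis .
    qed
    have inW: "x + s *\<^sub>R v + t *\<^sub>R w \<in> W" if "0 \<le> s" "s \<le> h" "0 \<le> t" "t \<le> h" for s t
      using near[OF that] e by (auto simp: d_def dist_commute)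
    have diff: "g differentiable (at (x + s *\<^sub>R v + t *\<^sub>R w))"
      if "smooth_on W g" "0 \<le> s" "s \<le> h" "0 \<le> t" "t \<le> h" for g :: "'a \<Rightarrow> real" and s t
      using smooth_on_imp_differentiable[OF that(1) inW[OF that(2-)]] .
    obtain s t where st: "0 < s" "s < h" "0 < t" "t < h"
      "f (x + h *\<^sub>R v + h *\<^sub>R w) - f (x + h *\<^sub>R v) - f (x + h *\<^sub>R w) + f x
      = h * h * D w (D v f) (x + s *\<^sub>R v + t *\<^sub>R w)"
      using second_difference_eq_mixed_derivative[OF h, of f x v w] diff[OF f] diff[OF sm(1)] unfolding D_def by blast
    have swapped: "f differentiable (at (x + s *\<^sub>R w + t *\<^sub>R v)) \<and>
        D w f differentiable (at (x + s *\<^sub>R w + t *\<^sub>R v))"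
      if "0 \<le> s" "s \<le> h" "0 \<le> t" "t \<le> h" for s t
    proof -
      have "x + s *\<^sub>R w + t *\<^sub>R v = x + t *\<^sub>R v + s *\<^sub>R w" by simp
      then show ?thesis using diff[OF f, of t s] diff[OF sm(4), of t s] that by metis
    qed
    obtain s' t' where st': "0 < s'" "s' < h" "0 < t'" "t' < h"
      "f (x + h *\<^sub>R w + h *\<^sub>R v) - f (x + h *\<^sub>R w) - f (x + h *\<^sub>R v) + f x
      = h * h * D v (D w f) (x + s' *\<^sub>R w + t' *\<^sub>R v)"
      using second_difference_eq_mixed_derivative[OF h, of f x w v] swapped unfolding D_def by blast
    have "h * h * D w (D v f) (x + s *\<^sub>R v + t *\<^sub>R w) = h * h * D v (D w f) (x + t' *\<^sub>R v + s' *\<^sub>R w)"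
      using st(5) st'(5) by (simp add: algebra_simps)
    then have "D w (D v f) (x + s *\<^sub>R v + t *\<^sub>R w) = D v (D w f) (x + t' *\<^sub>R v + s' *\<^sub>R w)"
      using h by simp
    moreover have "dist (D w (D v f) (x + s *\<^sub>R v + t *\<^sub>R w)) (D w (D v f) x) < \<epsilon> / 2"
      using near[of s t] st by (intro d1) (auto simp: d_def)
    moreover have "dist (D v (D w f) (x + t' *\<^sub>R v + s' *\<^sub>R w)) (D v (D w f) x) < \<epsilon> / 2"
      using near[of t' s'] st' by (intro d2) (auto simp: d_def)
    ultimately show ?thesis
      by (metis dist_commute dist_triangle_half_l)
  qed
  then have "D w (D v f) x = D v (D w f) x"
    by (meson dist_pos_lt order_less_irrefl)
  then show ?thesis unfolding D_def[abs_def] by simp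
qed

lemma pd_commute:
  "open W \<Longrightarrow> x \<in> W \<Longrightarrow> smooth_on W f \<Longrightarrow> pd i (pd j f) x = pd j (pd i f) x"
  using frechet_derivative_commute unfolding pd_def[abs_def] by blast

lemma pd_cong:
  "open S \<Longrightarrow> y \<in> S \<Longrightarrow> (\<And>y. y \<in> S \<Longrightarrow> f y = g y) \<Longrightarrow> pd i f y = pd i g y"
  unfolding pd_def using frechet_derivative_cong_open by metis

lemma pdy_eq_pd_slice:
  "F differentiable (at (a, y)) \<Longrightarrow> pdy i F (a, y) = pd i (\<lambda>y. F (a, y)) y"
  unfolding pdy_def pd_def using frechet_derivative_at[OF has_derivative_slice] by metis

lemma pd_component: "pd i (\<lambda>y. y $ a) y = (if a = i then 1 else 0)"
proof -
  have "((\<lambda>y. y $ a) has_derivative (\<lambda>y. y $ a)) (at y)"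
    using bounded_linear_imp_has_derivative bounded_linear_vec_nth by blast
  then have "frechet_derivative (\<lambda>y. y $ a) (at y) = (\<lambda>y. y $ a)"
    by (rule frechet_derivative_at[symmetric])
  then show ?thesis
    by (simp add: pd_def axis_def)
qed

lemma pd_const: "pd i (\<lambda>y. c) y = 0"
  by (simp add: pd_def frechet_derivative_const)

lemma pd_add:
  "f differentiable (at y) \<Longrightarrow> g differentiable (at y) \<Longrightarrow> pd i (\<lambda>y. f y + g y) y = pd i f y + pd i g y"
  by (simp add: pd_def frechet_derivative_add_fun)

lemma pd_mult:
  "f differentiable (at y) \<Longrightarrow> g differentiable (at y) \<Longrightarrow>
    pd i (\<lambda>y. f y * g y) y = f y * pd i g y + pd i f y * g y"
  by (simp add: pd_def frechet_derivative_mult_fun)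

lemma pd_cmult: "f differentiable (at y) \<Longrightarrow> pd i (\<lambda>y. c * f y) y = c * pd i f y"
  by (simp add: pd_mult pd_const)

lemma pd_sum:
  "(\<And>a. a \<in> I \<Longrightarrow> f a differentiable (at y)) \<Longrightarrow> pd i (\<lambda>y. \<Sum>a\<in>I. f a y) y = (\<Sum>a\<in>I. pd i (f a) y)"
  by (induction I rule: infinite_finite_induct) (auto simp: pd_const pd_add)

text \<open>Multiplying by \<open>f\<close> avoids the exponent \<open>k - 1\<close>, so that \<open>k = 0\<close> is not a special case.\<close>

lemma pd_power:
  assumes "f differentiable (at y)"
  shows "f y * pd i (\<lambda>y. f y ^ k) y = real k * f y ^ k * pd i f y"
proof (induction k)
  case (Suc k)
  have "(\<lambda>y. f y ^ k) differentiable (at y)" using assms by simp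
  then have "f y * pd i (\<lambda>y. f y ^ Suc k) y = f y * (f y * pd i (\<lambda>y. f y ^ k) y) + f y * pd i f y * f y ^ k"
    using assms by (simp add: pd_mult algebra_simps)
  with Suc show ?case by (simp add: algebra_simps)
qed (simp add: pd_const)

lemma frechet_derivative_eq_sum_axis:
  fixes f :: "real^'n::finite \<Rightarrow> 'b::euclidean_space"
  assumes "f differentiable (at x)"
  shows "frechet_derivative f (at x) v = (\<Sum>i\<in>UNIV. v $ i *\<^sub>R frechet_derivative f (at x) (axis i 1))"
proof -
  have lin: "linear (frechet_derivative f (at x))"
    by (rule linear_frechet_derivative[OF assms])
  have "frechet_derivative f (at x) v = frechet_derivative f (at x) (\<Sum>i\<in>UNIV. v $ i *\<^sub>R axis i 1)"
    using basis_expansion[of v] by (simp add: scalar_mult_eq_scaleR)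
  then show ?thesis
    by (simp add: linear_sum[OF lin] linear_scale[OF lin])
qed

lemma frechet_derivative_eq_sum_pd:
  fixes f :: "real^'n::finite \<Rightarrow> real"
  assumes "f differentiable (at x)"
  shows "frechet_derivative f (at x) v = (\<Sum>i\<in>UNIV. v $ i * pd i f x)"
  using frechet_derivative_eq_sum_axis[OF assms, of v] by (simp add: pd_def)

lemma second_derivative_eq_sum_pd:
  fixes f :: "real^'n::finite \<Rightarrow> real"
  assumes W: "open W" "x \<in> W" and f: "smooth_on W f"
  shows "frechet_derivative (\<lambda>x. frechet_derivative f (at x) v) (at x) v
    = (\<Sum>i\<in>UNIV. \<Sum>j\<in>UNIV. v $ i * v $ j * pd j (pd i f) x)"
proof -
  have "frechet_derivative (\<lambda>x. frechet_derivative f (at x) v) (at x) v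
    = (\<Sum>i\<in>UNIV. v $ i * pd i (\<lambda>x. frechet_derivative f (at x) v) x)"
    by (intro frechet_derivative_eq_sum_pd smooth_on_imp_differentiable[OF smooth_on_frechet_derivative[OF f] W(2)])
  also have "\<dots> = (\<Sum>i\<in>UNIV. v $ i * frechet_derivative (pd i f) (at x) v)"
    using frechet_derivative_commute[OF W f] unfolding pd_def[abs_def] by simp
  also have "\<dots> = (\<Sum>i\<in>UNIV. v $ i * (\<Sum>j\<in>UNIV. v $ j * pd j (pd i f) x))"
    by (simp add: frechet_derivative_eq_sum_pd smooth_on_imp_differentiable[OF smooth_on_pd[OF f] W(2)])
  finally show ?thesis by (simp add: sum_distrib_left mult.assoc)
qed

lemma lipschitz_at_point:
  fixes f :: "'a::euclidean_space \<Rightarrow> real"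
  assumes "f differentiable (at x)"
  shows "\<exists>K d. d > 0 \<and> (\<forall>y. dist y x < d \<longrightarrow> \<bar>f y - f x\<bar> \<le> K * norm (y - x))"
proof -
  let ?D = "frechet_derivative f (at x)"
  have D: "(f has_derivative ?D) (at x)" using assms by (simp add: frechet_derivative_works)
  then obtain B where B: "\<And>v. norm (?D v) \<le> norm v * B"
    using bounded_linear.bounded[OF has_derivative_bounded_linear[OF D]] by blast
  obtain d where d: "d > 0" "\<And>y. norm (y - x) < d \<Longrightarrow> norm (f y - f x - ?D (y - x)) \<le> 1 * norm (y - x)"
    using D unfolding has_derivative_at_alt by (meson zero_less_one)
  have "\<bar>f y - f x\<bar> \<le> (B + 1) * norm (y - x)" if "dist y x < d" for y
    using d(2)[of y] B[of "y - x"] that by (simp add: dist_norm algebra_simps)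
  then show ?thesis using d(1) by blast
qed

lemma smooth_on_pdy: "smooth_on W F \<Longrightarrow> smooth_on W (pdy i F)"
  unfolding pdy_def[abs_def] by (rule smooth_on_frechet_derivative)

lemma pdy_cong:
  "open W \<Longrightarrow> z \<in> W \<Longrightarrow> (\<And>z. z \<in> W \<Longrightarrow> F z = G z) \<Longrightarrow> pdy i F z = pdy i G z"
  unfolding pdy_def using frechet_derivative_cong_open by metis

lemma pdy_slice: "smooth_on W F \<Longrightarrow> (a, y) \<in> W \<Longrightarrow> pdy i F (a, y) = pd i (\<lambda>y. F (a, y)) y"
  by (rule pdy_eq_pd_slice) (rule smooth_on_imp_differentiable)

lemma pdy_pdy_slice:
  assumes W: "open W" and F: "smooth_on W F" and y: "(a, y) \<in> W"
  shows "pdy j (pdy i F) (a, y) = pd j (pd i (\<lambda>y. F (a, y))) y"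
proof -
  have "pdy j (pdy i F) (a, y) = pd j (\<lambda>y. pdy i F (a, y)) y"
    by (rule pdy_slice[OF smooth_on_pdy[OF F] y])
  also have "\<dots> = pd j (pd i (\<lambda>y. F (a, y))) y"
    by (rule pd_cong[OF open_slice[OF W]]) (use y pdy_slice[OF F] in auto)
  finally show ?thesis .
qed

section \<open>Homogeneous functions on a cone, smooth up to a boundary point\<close>

text \<open>In the application \<open>S\<close> is \<open>A\<^sub>p\<close> in the coordinates of a chart and \<open>y0\<close> is one point of its boundary.
  All components that enter the affine equation are positively homogeneous in \<open>y\<close> and extend smoothly across
  \<open>y0\<close>; these two properties are tracked together, because Euler's relation needs the degree.\<close>

locale cone_domain =
  fixes S :: "(real^'n::finite) set" and y0 :: "real^'n"
  assumes open_S: "open S" and cone: "\<And>y t. y \<in> S \<Longrightarrow> t > 0 \<Longrightarrow> t *\<^sub>R y \<in> S"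
begin

text \<open>The degree is an integer because dividing by \<open>L\<^sup>k\<close> turns degree \<open>2\<close> into degree \<open>2 - 2k\<close>.\<close>

definition hom_smooth :: "int \<Rightarrow> (real^'n \<Rightarrow> real) \<Rightarrow> bool" where
  "hom_smooth m f \<longleftrightarrow> extends_smoothly S {y0} f \<and> (\<forall>y\<in>S. \<forall>t>0. f (t *\<^sub>R y) = t powi m * f y)"

lemma hom_smooth_extension:
  assumes "hom_smooth m f"
  shows "\<exists>W F. open W \<and> S \<subseteq> W \<and> y0 \<in> W \<and> smooth_on W F \<and> (\<forall>y\<in>S. F y = f y)"
  using assms unfolding hom_smooth_def extends_smoothly_def smooth_extension_def by auto

lemma hom_smooth_homogeneous: "hom_smooth m f \<Longrightarrow> y \<in> S \<Longrightarrow> t > 0 \<Longrightarrow> f (t *\<^sub>R y) = t powi m * f y"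
  unfolding hom_smooth_def by blast

lemma hom_smoothI:
  assumes "open W" "S \<subseteq> W" "y0 \<in> W" "smooth_on W F" "\<And>y. y \<in> S \<Longrightarrow> F y = f y"
    and "\<And>y t. y \<in> S \<Longrightarrow> t > 0 \<Longrightarrow> f (t *\<^sub>R y) = t powi m * f y"
  shows "hom_smooth m f"
  using assms unfolding hom_smooth_def extends_smoothly_def smooth_extension_def by auto

lemma hom_smooth_smooth: "hom_smooth m f \<Longrightarrow> smooth_on S f"
  by (metis open_S hom_smooth_extension smooth_on_cong smooth_on_subset)

lemma hom_smooth_differentiable: "hom_smooth m f \<Longrightarrow> y \<in> S \<Longrightarrow> f differentiable (at y)"
  using hom_smooth_smooth smooth_on_imp_differentiable by blast

lemma hom_smooth_const: "hom_smooth 0 (\<lambda>y. c)"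
  by (rule hom_smoothI[of UNIV "\<lambda>y. c"]) (auto intro: smooth_on_const)

lemma hom_smooth_component: "hom_smooth 1 (\<lambda>y. y $ a)"
  by (rule hom_smoothI[of UNIV "\<lambda>y. y $ a"]) (auto intro: smooth_on_component)

lemma hom_smooth_add:
  assumes "hom_smooth m f" "hom_smooth m g"
  shows "hom_smooth m (\<lambda>y. f y + g y)"
proof -
  obtain V F where F: "open V" "S \<subseteq> V" "y0 \<in> V" "smooth_on V F" "\<And>y. y \<in> S \<Longrightarrow> F y = f y"
    using hom_smooth_extension[OF assms(1)] by blast
  obtain W G where G: "open W" "S \<subseteq> W" "y0 \<in> W" "smooth_on W G" "\<And>y. y \<in> S \<Longrightarrow> G y = g y"
    using hom_smooth_extension[OF assms(2)] by blast
  show ?thesis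
    by (rule hom_smoothI[of "V \<inter> W" "\<lambda>y. F y + G y"])
      (use F G assms in \<open>auto simp: hom_smooth_homogeneous algebra_simps intro!: smooth_on_add intro: smooth_on_subset\<close>)
qed

lemma hom_smooth_mult:
  assumes "hom_smooth m f" "hom_smooth k g" "m + k = l"
  shows "hom_smooth l (\<lambda>y. f y * g y)"
proof -
  obtain V F where F: "open V" "S \<subseteq> V" "y0 \<in> V" "smooth_on V F" "\<And>y. y \<in> S \<Longrightarrow> F y = f y"
    using hom_smooth_extension[OF assms(1)] by blast
  obtain W G where G: "open W" "S \<subseteq> W" "y0 \<in> W" "smooth_on W G" "\<And>y. y \<in> S \<Longrightarrow> G y = g y"
    using hom_smooth_extension[OF assms(2)] by blast
  show ?thesis
    by (rule hom_smoothI[of "V \<inter> W" "\<lambda>y. F y * G y"])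
      (use F G assms in \<open>auto simp: hom_smooth_homogeneous power_int_add intro!: smooth_on_mult intro: smooth_on_subset\<close>)
qed

lemma hom_smooth_cmult: "hom_smooth m f \<Longrightarrow> hom_smooth m (\<lambda>y. c * f y)"
  by (rule hom_smooth_mult[OF hom_smooth_const]) auto

lemma hom_smooth_diff: "hom_smooth m f \<Longrightarrow> hom_smooth m g \<Longrightarrow> hom_smooth m (\<lambda>y. f y - g y)"
  using hom_smooth_add[of m f "\<lambda>y. (- 1) * g y"] hom_smooth_cmult[of m g "- 1"] by simp

lemma hom_smooth_zero: "hom_smooth m (\<lambda>y. 0)"
  by (rule hom_smoothI[of UNIV "\<lambda>y. 0"]) (auto intro: smooth_on_const)

lemma hom_smooth_sum: "(\<And>a. a \<in> I \<Longrightarrow> hom_smooth m (f a)) \<Longrightarrow> hom_smooth m (\<lambda>y. \<Sum>a\<in>I. f a y)"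
  by (induction I rule: infinite_finite_induct) (auto intro: hom_smooth_zero hom_smooth_add)

lemma hom_smooth_pd:
  assumes f: "hom_smooth m f" and l: "m - 1 = l"
  shows "hom_smooth l (pd i f)"
proof -
  obtain W F where F: "open W" "S \<subseteq> W" "y0 \<in> W" "smooth_on W F" "\<And>y. y \<in> S \<Longrightarrow> F y = f y"
    using hom_smooth_extension[OF f] by blast
  show ?thesis
  proof (rule hom_smoothI[of W "pd i F"])
    show "pd i F y = pd i f y" if "y \<in> S" for y
      using pd_cong[OF open_S that] F by blast
    fix y :: "real^'n" and t :: real
    assume y: "y \<in> S" and t: "t > 0"
    let ?D = "frechet_derivative f (at (t *\<^sub>R y))"
    have D: "(f has_derivative ?D) (at (t *\<^sub>R y))"
      using hom_smooth_differentiable[OF f cone[OF y t]] by (simp add: frechet_derivative_works)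
    have "((\<lambda>y. t *\<^sub>R y) has_derivative (\<lambda>v. t *\<^sub>R v)) (at y)"
      by (auto intro!: derivative_eq_intros)
    from has_derivative_compose[OF this D]
    have "((\<lambda>y. f (t *\<^sub>R y)) has_derivative (\<lambda>v. ?D (t *\<^sub>R v))) (at y)" .
    then have "pd i (\<lambda>y. f (t *\<^sub>R y)) y = ?D (t *\<^sub>R axis i 1)"
      unfolding pd_def by (metis frechet_derivative_at)
    also have "\<dots> = t * pd i f (t *\<^sub>R y)"
      using has_derivative_linear[OF D] by (simp add: pd_def linear_scale)
    finally have "t * pd i f (t *\<^sub>R y) = pd i (\<lambda>y. f (t *\<^sub>R y)) y" ..
    also have "\<dots> = pd i (\<lambda>y. t powi m * f y) y"
      using y t by (intro pd_cong[OF open_S]) (auto simp: hom_smooth_homogeneous[OF f])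
    also have "\<dots> = t powi m * pd i f y"
      by (rule pd_cmult[OF hom_smooth_differentiable[OF f y]])
    finally show "pd i f (t *\<^sub>R y) = t powi l * pd i f y"
      using t l power_int_add[of t 1 l] by auto
  qed (use F smooth_on_pd in auto)
qed

text \<open>Euler's relation: both sides are the derivative of \<open>f (t y)\<close> in \<open>t\<close> at \<open>1\<close>.\<close>

lemma euler:
  assumes f: "hom_smooth m f" and y: "y \<in> S"
  shows "(\<Sum>a\<in>UNIV. y $ a * pd a f y) = of_int m * f y"
proof -
  let ?D = "frechet_derivative f (at y)"
  have "((\<lambda>t. f (t *\<^sub>R y)) has_real_derivative ?D y) (at 1)"
    using has_field_derivative_along_line[of f 0 1 y] hom_smooth_differentiable[OF f y] by simp
  moreover have "((\<lambda>t. f (t *\<^sub>R y)) has_real_derivative of_int m * f y) (at 1)"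
  proof (rule has_field_derivative_transform_within_open[where S = "{0<..}"])
    show "((\<lambda>t. t powi m * f y) has_real_derivative of_int m * f y) (at 1)"
      by (auto intro!: derivative_eq_intros)
  qed (auto simp: hom_smooth_homogeneous[OF f y])
  ultimately have "?D y = of_int m * f y" by (rule DERIV_unique)
  then show ?thesis
    using frechet_derivative_eq_sum_pd[OF hom_smooth_differentiable[OF f y], of y] by simp
qed

definition divergence :: "('n \<Rightarrow> real^'n \<Rightarrow> real) \<Rightarrow> real^'n \<Rightarrow> real" where
  "divergence u y = (\<Sum>a\<in>UNIV. pd a (u a) y)"

lemma hom_smooth_divergence: "(\<And>a. hom_smooth m (u a)) \<Longrightarrow> m - 1 = l \<Longrightarrow> hom_smooth l (divergence u)"
  unfolding divergence_def[abs_def] by (intro hom_smooth_sum hom_smooth_pd)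

lemma divergence_cong: "y \<in> S \<Longrightarrow> (\<And>a y. y \<in> S \<Longrightarrow> u a y = v a y) \<Longrightarrow> divergence u y = divergence v y"
  unfolding divergence_def by (intro sum.cong refl pd_cong[OF open_S]) auto

lemma divergence_add:
  assumes "\<And>a. u a differentiable (at y)" "\<And>a. v a differentiable (at y)"
  shows "divergence (\<lambda>a y. u a y + v a y) y = divergence u y + divergence v y"
  by (simp add: divergence_def pd_add assms sum.distrib)

lemma divergence_scale:
  assumes "f differentiable (at y)" "\<And>a. u a differentiable (at y)"
  shows "divergence (\<lambda>a y. f y * u a y) y = f y * divergence u y + (\<Sum>a\<in>UNIV. pd a f y * u a y)"
  by (simp add: divergence_def pd_mult assms sum.distrib sum_distrib_left)

lemma divergence_component: "divergence (\<lambda>a y. y $ a) y = CARD('n)"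
  by (simp add: divergence_def pd_component)

lemma component_differentiable: "(\<lambda>y :: real^'n. y $ a) differentiable (at y)"
  using bounded_linear_imp_differentiable bounded_linear_vec_nth by blast

text \<open>By Euler's relation the derivative of \<open>f\<close> in the direction \<open>y\<close> contributes the degree of \<open>f\<close>.\<close>

lemma divergence_radial:
  assumes f: "hom_smooth m f" and y: "y \<in> S"
  shows "divergence (\<lambda>a y. f y * y $ a) y = (real CARD('n) + of_int m) * f y"
proof -
  have "divergence (\<lambda>a y. f y * y $ a) y = f y * CARD('n) + (\<Sum>a\<in>UNIV. y $ a * pd a f y)"
    using divergence_scale[OF hom_smooth_differentiable[OF f y], of "\<lambda>a y. y $ a"]
    by (simp add: component_differentiable divergence_component mult.commute)
  then show ?thesis
    by (simp add: euler[OF f y] algebra_simps)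
qed

lemma hom_smooth_bounded:
  assumes "hom_smooth m f"
  shows "\<exists>K d. d > 0 \<and> (\<forall>y\<in>S \<inter> ball y0 d. \<bar>f y\<bar> \<le> K)"
proof -
  obtain W F where F: "open W" "S \<subseteq> W" "y0 \<in> W" "smooth_on W F" "\<And>y. y \<in> S \<Longrightarrow> F y = f y"
    using hom_smooth_extension[OF assms] by blast
  obtain K d where d: "d > 0" "\<And>y. dist y y0 < d \<Longrightarrow> \<bar>F y - F y0\<bar> \<le> K * norm (y - y0)"
    using lipschitz_at_point[OF smooth_on_imp_differentiable[OF F(4,3)]] by blast
  have "\<bar>f y\<bar> \<le> \<bar>F y0\<bar> + \<bar>K\<bar> * d" if y: "y \<in> S \<inter> ball y0 d" for y
  proof -
    have n: "norm (y - y0) < d" using y by (simp add: dist_norm norm_minus_commute)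
    have "\<bar>F y - F y0\<bar> \<le> K * norm (y - y0)" using d(2)[of y] n by (simp add: dist_norm)
    also have "\<dots> \<le> \<bar>K\<bar> * d" using n by (intro mult_mono) auto
    finally show ?thesis using F(5)[of y] y by simp
  qed
  then show ?thesis using d(1) by blast
qed

end

section \<open>The affine equation on one tangent space\<close>

text \<open>The restriction of a pseudo-Finsler metric to one tangent space: \<open>h\<close> is the inverse of the fundamental
  tensor. Its smoothness up to \<open>y0\<close> encodes the non-degeneracy of the metric on the boundary.\<close>

locale finsler_fibre = cone_domain S y0 for S :: "(real^'n::finite) set" and y0 +
  fixes L :: "real^'n \<Rightarrow> real" and h :: "'n \<Rightarrow> 'n \<Rightarrow> real^'n \<Rightarrow> real"
  assumes dim: "3 \<le> CARD('n)"
    and L: "hom_smooth 2 L" and L_pos: "\<And>y. y \<in> S \<Longrightarrow> L y > 0"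
    and h: "\<And>i j. hom_smooth 0 (h i j)"
    and h_inverse: "\<And>y a c. y \<in> S \<Longrightarrow> (\<Sum>b\<in>UNIV. h a b y * (1/2 * pd c (pd b L) y)) = kron a c"
begin

definition g :: "'n \<Rightarrow> 'n \<Rightarrow> real^'n \<Rightarrow> real" where
  "g i j y = 1/2 * pd j (pd i L) y"

definition y_flat :: "'n \<Rightarrow> real^'n \<Rightarrow> real" where
  "y_flat i y = (\<Sum>a\<in>UNIV. g i a y * y $ a)"

text \<open>The mean Cartan covector \<open>C\<^sub>i = g\<^sup>a\<^sup>b C\<^sub>a\<^sub>b\<^sub>i\<close>.\<close>

definition C :: "'n \<Rightarrow> real^'n \<Rightarrow> real" where
  "C i y = (\<Sum>a\<in>UNIV. \<Sum>b\<in>UNIV. h a b y * (1/2 * pd i (g a b) y))"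

lemma hom_smooth_g: "hom_smooth 0 (g i j)"
  unfolding g_def[abs_def] by (intro hom_smooth_cmult hom_smooth_pd[OF hom_smooth_pd[OF L refl]]) auto

lemma g_sym: "y \<in> S \<Longrightarrow> g i j y = g j i y"
  unfolding g_def using pd_commute[OF open_S _ hom_smooth_smooth[OF L]] by simp

lemma h_g: "y \<in> S \<Longrightarrow> (\<Sum>b\<in>UNIV. h a b y * g b c y) = kron a c"
  unfolding g_def using h_inverse by simp

lemma pd_L: 
  assumes "y \<in> S" shows "pd i L y = 2 * y_flat i y"
proof -
  have "hom_smooth 1 (pd i L)" by (rule hom_smooth_pd[OF L]) simp
  from euler[OF this assms] show ?thesis
    by (simp add: y_flat_def g_def sum_distrib_left mult.commute)
qed

lemma hom_smooth_y_flat: "hom_smooth 1 (y_flat i)"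
  unfolding y_flat_def[abs_def] by (rule hom_smooth_sum, rule hom_smooth_mult[OF hom_smooth_g hom_smooth_component]) simp

lemma pd_y_flat:
  assumes "y \<in> S" shows "pd j (y_flat i) y = g i j y"
proof -
  have "pd j (y_flat i) y = pd j (\<lambda>y. 1/2 * pd i L y) y"
    by (rule pd_cong[OF open_S assms]) (simp add: pd_L)
  also have "\<dots> = g i j y"
    unfolding g_def using hom_smooth_pd[OF L] assms by (intro pd_cmult hom_smooth_differentiable) auto
  finally show ?thesis .
qed

lemma y_flat_y: "y \<in> S \<Longrightarrow> (\<Sum>a\<in>UNIV. y_flat a y * y $ a) = L y"
  using euler[OF L, of y] by (simp add: pd_L sum_distrib_left[symmetric] mult.left_commute[of _ 2] mult.commute[of "_ $ _"])

lemma raise_lower: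
  assumes "y \<in> S"
  shows "(\<Sum>b\<in>UNIV. h a b y * (\<Sum>c\<in>UNIV. g b c y * u c)) = u a"
proof -
  have "(\<Sum>b\<in>UNIV. h a b y * (\<Sum>c\<in>UNIV. g b c y * u c)) = (\<Sum>c\<in>UNIV. (\<Sum>b\<in>UNIV. h a b y * g b c y) * u c)"
    by (simp add: sum_distrib_left sum_distrib_right mult.assoc) (rule sum.swap)
  also have "\<dots> = (\<Sum>c\<in>UNIV. if c = a then u c else 0)"
    by (intro sum.cong) (auto simp: h_g[OF assms] kron_def)
  also have "\<dots> = u a" by simp
  finally show ?thesis .
qed

lemma hom_smooth_C: "hom_smooth (-1) (C i)"
  unfolding C_def[abs_def]
  by (intro hom_smooth_sum hom_smooth_mult[OF h] hom_smooth_cmult hom_smooth_pd[OF hom_smooth_g]) auto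

text \<open>The components of \<open>g\<close> have degree \<open>0\<close>, so their radial derivative vanishes.\<close>

lemma C_y:
  assumes "y \<in> S" shows "(\<Sum>i\<in>UNIV. C i y * y $ i) = 0"
proof -
  have "(\<Sum>i\<in>UNIV. C i y * y $ i) =
    (\<Sum>i\<in>UNIV. \<Sum>a\<in>UNIV. \<Sum>b\<in>UNIV. h a b y * (1/2 * (y $ i * pd i (g a b) y)))"
    by (simp add: C_def sum_distrib_left mult.commute mult.left_commute)
  also have "\<dots> = (\<Sum>a\<in>UNIV. \<Sum>b\<in>UNIV. \<Sum>i\<in>UNIV. h a b y * (1/2 * (y $ i * pd i (g a b) y)))"
    by (subst sum.swap, rule sum.cong[OF refl], rule sum.swap)
  also have "\<dots> = 0"
  proof -
    have "(\<Sum>i\<in>UNIV. h a b y * (1/2 * (y $ i * pd i (g a b) y))) = 0" for a b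
      using euler[OF hom_smooth_g assms, of a b] by (simp add: sum_distrib_left[symmetric] sum_divide_distrib[symmetric])
    then show ?thesis by simp
  qed
  finally show ?thesis .
qed

text \<open>Again in a form without the exponent \<open>k - 1\<close>.\<close>

lemma pd_L_power:
  assumes "y \<in> S"
  shows "L y * pd b (\<lambda>y. L y ^ k) y = 2 * real k * L y ^ k * y_flat b y"
  using pd_power[OF hom_smooth_differentiable[OF L assms], of b k] pd_L[OF assms] by simp

lemma L_power_differentiable: "y \<in> S \<Longrightarrow> (\<lambda>y. L y ^ k) differentiable (at y)"
  using hom_smooth_differentiable[OF L] by simp

text \<open>Differentiating the orthogonality relation turns a first derivative of \<open>u\<close> into \<open>u\<close> itself, since
  \<open>y\<^sub>a\<^sub>\<cdot>\<^sub>b = g\<^sub>a\<^sub>b\<close>.\<close>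

lemma y_flat_pd_orthogonal:
  assumes u: "\<And>a. hom_smooth m (u a)" and orth: "\<And>y. y \<in> S \<Longrightarrow> (\<Sum>a\<in>UNIV. y_flat a y * u a y) = 0" and y: "y \<in> S"
  shows "(\<Sum>a\<in>UNIV. y_flat a y * pd b (u a) y) = - (\<Sum>a\<in>UNIV. g a b y * u a y)"
proof -
  have "0 = pd b (\<lambda>y. \<Sum>a\<in>UNIV. y_flat a y * u a y) y"
    using pd_cong[OF open_S y, of "\<lambda>y. 0" "\<lambda>y. \<Sum>a\<in>UNIV. y_flat a y * u a y" b] orth by (simp add: pd_const)
  also have "\<dots> = (\<Sum>a\<in>UNIV. y_flat a y * pd b (u a) y + g a b y * u a y)"
    using hom_smooth_differentiable[OF u y] hom_smooth_differentiable[OF hom_smooth_y_flat y]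
    by (simp add: pd_sum pd_mult pd_y_flat[OF y])
  finally show ?thesis by (simp add: sum.distrib)
qed

text \<open>The homogeneous linear equation for the difference of two solutions. The division by \<open>L\<close> in the
  affine equation is cleared, so that the equation makes sense up to the boundary, where \<open>L = 0\<close>.\<close>

definition affine_eq :: "('n \<Rightarrow> real^'n \<Rightarrow> real) \<Rightarrow> bool" where
  "affine_eq z \<longleftrightarrow> (\<forall>y\<in>S. \<forall>b. (real CARD('n) + 2) * (\<Sum>a\<in>UNIV. y_flat a y * pd b (z a) y) =
     2 * L y * ((\<Sum>a\<in>UNIV. C a y * pd b (z a) y) + pd b (divergence z) y))"

lemma contract_second:
  fixes u :: "'n \<Rightarrow> real" and w :: "'n \<Rightarrow> 'n \<Rightarrow> real"
  shows "(\<Sum>b\<in>UNIV. v b * (\<Sum>a\<in>UNIV. u a * w a b)) = (\<Sum>a\<in>UNIV. u a * (\<Sum>b\<in>UNIV. v b * w a b))"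
  by (simp add: sum_distrib_left mult.left_commute[of "v _"]) (rule sum.swap)

text \<open>Contracting the equation with \<open>y\<^sup>b\<close> gives, by Euler's relation, \<open>y\<^sub>a z\<^sup>a = L \<rho>\<close> with
  \<open>(n+2) \<rho> = 2 C\<^sub>a z\<^sup>a + z\<^sup>a\<^sub>\<cdot>\<^sub>a\<close>. This is the first division by \<open>L\<close>, and it makes \<open>\<rho>\<close> smooth up to the boundary.
  The remaining conclusions rewrite the equation in terms of \<open>\<eta> = z - \<rho> y\<close>.\<close>

lemma orthogonal_splitting:
  assumes z: "\<And>a. hom_smooth 2 (z a)" and eq: "affine_eq z"
  obtains \<rho> \<eta> where "hom_smooth 1 \<rho>" "\<And>a. hom_smooth 2 (\<eta> a)"
    "\<And>a y. y \<in> S \<Longrightarrow> z a y = \<eta> a y + \<rho> y * y $ a"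
    "\<And>y. y \<in> S \<Longrightarrow> (\<Sum>a\<in>UNIV. y_flat a y * \<eta> a y) = 0"
    "\<And>y. y \<in> S \<Longrightarrow> \<rho> y = divergence \<eta> y + 2 * (\<Sum>a\<in>UNIV. C a y * \<eta> a y)"
    "\<And>b y. y \<in> S \<Longrightarrow> (real CARD('n) + 2) * (\<Sum>a\<in>UNIV. g a b y * \<eta> a y) =
       (real CARD('n) + 2) * \<rho> y * y_flat b y - L y * (2 * (\<Sum>a\<in>UNIV. C a y * pd b (\<eta> a) y)
         + 2 * \<rho> y * C b y + 2 * pd b (divergence \<eta>) y + real CARD('n) * pd b \<rho> y)"
proof -
  let ?n = "real CARD('n)"
  define \<rho> where "\<rho> y = 1 / (?n + 2) * (2 * (\<Sum>a\<in>UNIV. C a y * z a y) + divergence z y)" for y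
  define \<eta> where "\<eta> a y = z a y - \<rho> y * y $ a" for a y
  have \<rho>: "hom_smooth 1 \<rho>"
    unfolding \<rho>_def[abs_def] by (intro hom_smooth_cmult hom_smooth_add hom_smooth_sum hom_smooth_mult[OF hom_smooth_C z] hom_smooth_divergence[OF z]) auto
  have \<eta>: "hom_smooth 2 (\<eta> a)" for a
    unfolding \<eta>_def[abs_def] by (intro hom_smooth_diff z hom_smooth_mult[OF \<rho> hom_smooth_component]) auto
  have z_eq: "z a y = \<eta> a y + \<rho> y * y $ a" for a y
    by (simp add: \<eta>_def)
  have \<rho>_eq: "(?n + 2) * \<rho> y = 2 * (\<Sum>a\<in>UNIV. C a y * z a y) + divergence z y" for y
    by (simp add: \<rho>_def)
  have dvz: "divergence z y = divergence \<eta> y + (?n + 1) * \<rho> y" if y: "y \<in> S" for y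
  proof -
    have "divergence z y = divergence (\<lambda>a y. \<eta> a y + \<rho> y * y $ a) y"
      by (rule divergence_cong[OF y]) (simp add: z_eq)
    also have "\<dots> = divergence \<eta> y + divergence (\<lambda>a y. \<rho> y * y $ a) y"
      by (rule divergence_add) (use hom_smooth_differentiable[OF _ y] \<eta> \<rho> component_differentiable in auto)
    finally show ?thesis using divergence_radial[OF \<rho> y] by (simp add: algebra_simps)
  qed
  have orth: "(\<Sum>a\<in>UNIV. y_flat a y * \<eta> a y) = 0" if y: "y \<in> S" for y
  proof -
    have "(?n + 2) * (\<Sum>b\<in>UNIV. y $ b * (\<Sum>a\<in>UNIV. y_flat a y * pd b (z a) y))
      = 2 * L y * ((\<Sum>b\<in>UNIV. y $ b * (\<Sum>a\<in>UNIV. C a y * pd b (z a) y)) + (\<Sum>b\<in>UNIV. y $ b * pd b (divergence z) y))"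
    proof -
      have "(\<Sum>b\<in>UNIV. y $ b * ((?n + 2) * (\<Sum>a\<in>UNIV. y_flat a y * pd b (z a) y)))
        = (\<Sum>b\<in>UNIV. y $ b * (2 * L y * ((\<Sum>a\<in>UNIV. C a y * pd b (z a) y) + pd b (divergence z) y)))"
        using eq y unfolding affine_eq_def by (intro sum.cong) auto
      then show ?thesis
        by (simp only: mult.left_commute[of "_ $ _"] sum_distrib_left[symmetric] distrib_left sum.distrib)
    qed
    moreover have "(\<Sum>b\<in>UNIV. y $ b * (\<Sum>a\<in>UNIV. v a * pd b (z a) y)) = 2 * (\<Sum>a\<in>UNIV. v a * z a y)" for v
      by (subst contract_second) (simp add: euler[OF z y] sum_distrib_left mult.left_commute)
    moreover have "(\<Sum>b\<in>UNIV. y $ b * pd b (divergence z) y) = divergence z y"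
      using euler[OF hom_smooth_divergence[OF z refl] y] by simp
    ultimately have "(?n + 2) * (2 * (\<Sum>a\<in>UNIV. y_flat a y * z a y))
      = 2 * L y * (2 * (\<Sum>a\<in>UNIV. C a y * z a y) + divergence z y)"
      by simp
    then have "(?n + 2) * (\<Sum>a\<in>UNIV. y_flat a y * z a y) = (?n + 2) * (\<rho> y * L y)"
      unfolding \<rho>_eq[of y, symmetric] by algebra
    then have "(\<Sum>a\<in>UNIV. y_flat a y * z a y) = \<rho> y * L y" by simp
    then show ?thesis
      using y_flat_y[OF y]
      by (simp add: \<eta>_def right_diff_distrib sum_subtractf mult.left_commute[of _ "\<rho> y"] sum_distrib_left[symmetric])
  qed
  have Cz: "(\<Sum>a\<in>UNIV. C a y * z a y) = (\<Sum>a\<in>UNIV. C a y * \<eta> a y)" if y: "y \<in> S" for y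
    using C_y[OF y] by (simp add: z_eq distrib_left sum.distrib mult.left_commute[of _ "\<rho> y"] sum_distrib_left[symmetric])
  have \<rho>\<eta>: "\<rho> y = divergence \<eta> y + 2 * (\<Sum>a\<in>UNIV. C a y * \<eta> a y)" if y: "y \<in> S" for y
    using \<rho>_eq[of y] dvz[OF y] Cz[OF y] by (simp add: algebra_simps)
  have low: "(?n + 2) * (\<Sum>a\<in>UNIV. g a b y * \<eta> a y) =
       (?n + 2) * \<rho> y * y_flat b y - L y * (2 * (\<Sum>a\<in>UNIV. C a y * pd b (\<eta> a) y)
         + 2 * \<rho> y * C b y + 2 * pd b (divergence \<eta>) y + ?n * pd b \<rho> y)" if y: "y \<in> S" for b y
  proof -
    note diff = hom_smooth_differentiable[OF \<eta> y] hom_smooth_differentiable[OF \<rho> y] component_differentiable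
    have pdz: "pd b (z a) y = pd b (\<eta> a) y + pd b \<rho> y * y $ a + (if a = b then \<rho> y else 0)" for a
    proof -
      have "pd b (z a) y = pd b (\<lambda>y. \<eta> a y + \<rho> y * y $ a) y"
        by (rule pd_cong[OF open_S y]) (simp add: z_eq)
      also have "\<dots> = pd b (\<eta> a) y + pd b (\<lambda>y. \<rho> y * y $ a) y"
        using diff by (intro pd_add differentiable_mult)
      finally show ?thesis using diff by (simp add: pd_mult pd_component)
    qed
    have contr: "(\<Sum>a\<in>UNIV. v a * pd b (z a) y) =
      (\<Sum>a\<in>UNIV. v a * pd b (\<eta> a) y) + pd b \<rho> y * (\<Sum>a\<in>UNIV. v a * y $ a) + v b * \<rho> y" for v :: "'n \<Rightarrow> real"
    proof -
      have "(\<Sum>a\<in>UNIV. v a * pd b (z a) y) = (\<Sum>a\<in>UNIV. v a * pd b (\<eta> a) y + pd b \<rho> y * (v a * y $ a)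
          + (if a = b then v a * \<rho> y else 0))"
        by (intro sum.cong refl) (simp add: pdz algebra_simps)
      then show ?thesis by (simp add: sum.distrib sum_distrib_left)
    qed
    have pd_dvz: "pd b (divergence z) y = pd b (divergence \<eta>) y + (?n + 1) * pd b \<rho> y"
    proof -
      have "pd b (divergence z) y = pd b (\<lambda>y. divergence \<eta> y + (?n + 1) * \<rho> y) y"
        by (rule pd_cong[OF open_S y dvz])
      then show ?thesis
        using diff hom_smooth_differentiable[OF hom_smooth_divergence[OF \<eta> refl] y] by (simp add: pd_add pd_cmult)
    qed
    have "(?n + 2) * (\<Sum>a\<in>UNIV. y_flat a y * pd b (z a) y) =
        2 * L y * ((\<Sum>a\<in>UNIV. C a y * pd b (z a) y) + pd b (divergence z) y)"
      using eq y unfolding affine_eq_def by blast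
    then have "(?n + 2) * (- (\<Sum>a\<in>UNIV. g a b y * \<eta> a y) + pd b \<rho> y * L y + y_flat b y * \<rho> y)
      = 2 * L y * ((\<Sum>a\<in>UNIV. C a y * pd b (\<eta> a) y) + C b y * \<rho> y + (pd b (divergence \<eta>) y + (?n + 1) * pd b \<rho> y))"
      unfolding contr pd_dvz
      by (simp add: y_flat_pd_orthogonal[OF \<eta> orth y] y_flat_y[OF y] C_y[OF y])
    then show ?thesis by (simp add: algebra_simps)
  qed
  show thesis
    by (rule that[OF \<rho> \<eta> z_eq orth \<rho>\<eta> low])
qed


lemma pd_L_power_mult:
  assumes F: "\<And>y. y \<in> S \<Longrightarrow> F y = L y ^ k * f y" and f: "f differentiable (at y)" and y: "y \<in> S"
  shows "L y * pd b F y = L y ^ k * (L y * pd b f y + 2 * real k * y_flat b y * f y)"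
proof -
  have "pd b F y = pd b (\<lambda>y. L y ^ k * f y) y"
    by (rule pd_cong[OF open_S y F])
  also have "\<dots> = L y ^ k * pd b f y + pd b (\<lambda>y. L y ^ k) y * f y"
    by (rule pd_mult[OF L_power_differentiable[OF y] f])
  finally have "L y * pd b F y = L y * L y ^ k * pd b f y + (L y * pd b (\<lambda>y. L y ^ k) y) * f y"
    by (simp add: algebra_simps)
  then show ?thesis unfolding pd_L_power[OF y] by (simp add: algebra_simps)
qed

lemma orthogonal_L_power_cancel:
  assumes orth: "\<And>y. y \<in> S \<Longrightarrow> (\<Sum>a\<in>UNIV. y_flat a y * \<eta> a y) = 0"
    and \<eta>\<theta>: "\<And>a y. y \<in> S \<Longrightarrow> \<eta> a y = L y ^ k * \<theta> a y" and y: "y \<in> S"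
  shows "(\<Sum>a\<in>UNIV. y_flat a y * \<theta> a y) = 0"
proof -
  have "L y ^ k * (\<Sum>a\<in>UNIV. y_flat a y * \<theta> a y) = 0"
    using orth[OF y] by (simp add: \<eta>\<theta>[OF y] sum_distrib_left mult.left_commute)
  then show ?thesis using L_pos[OF y] by simp
qed

text \<open>The derivative of \<open>L\<^sup>k\<close> is proportional to \<open>y\<^sub>a\<close> and does not contribute, because \<open>\<theta>\<close> is orthogonal to \<open>y\<close>.
  This is why the splitting is made before dividing.\<close>

lemma divergence_L_power_mult:
  assumes \<theta>: "\<And>a. hom_smooth m (\<theta> a)" and \<eta>\<theta>: "\<And>a y. y \<in> S \<Longrightarrow> \<eta> a y = L y ^ k * \<theta> a y"
    and orth: "\<And>y. y \<in> S \<Longrightarrow> (\<Sum>a\<in>UNIV. y_flat a y * \<theta> a y) = 0" and y: "y \<in> S"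
  shows "divergence \<eta> y = L y ^ k * divergence \<theta> y"
proof -
  have "L y * divergence \<eta> y = (\<Sum>a\<in>UNIV. L y ^ k * (L y * pd a (\<theta> a) y + 2 * real k * (y_flat a y * \<theta> a y)))"
    by (simp add: divergence_def sum_distrib_left pd_L_power_mult[OF \<eta>\<theta> hom_smooth_differentiable[OF \<theta> y] y] mult.assoc)
  also have "\<dots> = L y ^ k * (L y * divergence \<theta> y + 2 * real k * (\<Sum>a\<in>UNIV. y_flat a y * \<theta> a y))"
    by (simp only: divergence_def sum_distrib_left[symmetric] sum.distrib)
  finally have "L y * divergence \<eta> y = L y * (L y ^ k * divergence \<theta> y)"
    by (simp add: orth[OF y])
  then show ?thesis using L_pos[OF y] by simp
qed

text \<open>The inductive step. Modulo \<open>L\<close> the equation forces \<open>\<theta> \<equiv> \<tau> y\<close> with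
  \<open>\<tau> = (1-2k) \<sigma> + 4k/(n+2) c\<close>. Orthogonality to \<open>y\<close> and the divergence of \<open>\<theta> = \<tau> y + L \<xi>\<close> give
  \<open>c \<equiv> 0\<close> and \<open>\<sigma> \<equiv> (n-1-2k) \<tau>\<close>, hence \<open>\<tau> \<equiv> (1-2k)(n-1-2k) \<tau>\<close>, and so \<open>\<tau> \<equiv> 0\<close> and \<open>\<theta> \<equiv> 0\<close>.
  The proof carries the multiples of \<open>L\<close> along explicitly, so that the quotient \<open>\<theta>'\<close> is
  visibly smooth up to the boundary.\<close>

lemma orthogonal_part_divide_by_L:
  assumes orth: "\<And>y. y \<in> S \<Longrightarrow> (\<Sum>a\<in>UNIV. y_flat a y * \<eta> a y) = 0"
    and \<rho>_eq: "\<And>y. y \<in> S \<Longrightarrow> \<rho> y = divergence \<eta> y + 2 * (\<Sum>a\<in>UNIV. C a y * \<eta> a y)"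
    and low: "\<And>b y. y \<in> S \<Longrightarrow> (real CARD('n) + 2) * (\<Sum>a\<in>UNIV. g a b y * \<eta> a y) =
       (real CARD('n) + 2) * \<rho> y * y_flat b y - L y * (2 * (\<Sum>a\<in>UNIV. C a y * pd b (\<eta> a) y)
         + 2 * \<rho> y * C b y + 2 * pd b (divergence \<eta>) y + real CARD('n) * pd b \<rho> y)"
    and \<theta>: "\<And>a. hom_smooth (2 - 2 * int k) (\<theta> a)" and \<eta>\<theta>: "\<And>a y. y \<in> S \<Longrightarrow> \<eta> a y = L y ^ k * \<theta> a y"
  shows "\<exists>\<theta>'. (\<forall>a. hom_smooth (2 - 2 * int (Suc k)) (\<theta>' a)) \<and> (\<forall>a. \<forall>y\<in>S. \<eta> a y = L y ^ Suc k * \<theta>' a y)"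
proof -
  let ?n = "real CARD('n)" and ?k = "real k"
  define c where "c y = (\<Sum>a\<in>UNIV. C a y * \<theta> a y)" for y
  define \<sigma> where "\<sigma> y = divergence \<theta> y + 2 * c y" for y
  \<comment> \<open>The terms of the lowered equation, divided by \<open>L\<^sup>k\<close>, in which the factor \<open>L\<close> survives.\<close>
  define E where "E b y = 2 * (\<Sum>a\<in>UNIV. C a y * pd b (\<theta> a) y) + 2 * (\<sigma> y * C b y)
      + 2 * pd b (divergence \<theta>) y + ?n * pd b \<sigma> y" for b y
  define \<tau> where "\<tau> y = (1 - 2 * ?k) * \<sigma> y + 4 * ?k / (?n + 2) * c y" for y
  define \<xi> where "\<xi> a y = - 1 / (?n + 2) * (\<Sum>b\<in>UNIV. h a b y * E b y)" for a y
  define e where "e y = (\<Sum>a\<in>UNIV. C a y * \<xi> a y)" for y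
  define m where "m = 1 - (1 - 2 * ?k) * (?n - 1 - 2 * ?k)"
  \<comment> \<open>The quotient of \<open>\<tau>\<close> by \<open>L\<close>, obtained by solving for \<open>\<tau>\<close> below.\<close>
  define u where "u y = 1 / m * ((1 - 2 * ?k) * (divergence \<xi> y + 2 * e y) + 4 * ?k / (?n + 2) * e y)" for y
  define \<theta>' where "\<theta>' a y = u y * y $ a + \<xi> a y" for a y

  have c: "hom_smooth (1 - 2 * int k) c"
    unfolding c_def[abs_def] by (intro hom_smooth_sum hom_smooth_mult[OF hom_smooth_C \<theta>]) auto
  have \<sigma>: "hom_smooth (1 - 2 * int k) \<sigma>"
    unfolding \<sigma>_def[abs_def] by (intro hom_smooth_add hom_smooth_cmult c hom_smooth_divergence[OF \<theta>]) auto
  have E: "hom_smooth (- 2 * int k) (E b)" for b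
    unfolding E_def[abs_def]
    by (intro hom_smooth_add hom_smooth_cmult hom_smooth_sum hom_smooth_mult[OF hom_smooth_C hom_smooth_pd[OF \<theta> refl]] hom_smooth_mult[OF \<sigma> hom_smooth_C]
        hom_smooth_pd[OF hom_smooth_divergence[OF \<theta> refl]] hom_smooth_pd[OF \<sigma>]) auto
  have \<tau>: "hom_smooth (1 - 2 * int k) \<tau>"
    unfolding \<tau>_def[abs_def] by (intro hom_smooth_add hom_smooth_cmult c \<sigma>)
  have \<xi>: "hom_smooth (- 2 * int k) (\<xi> a)" for a
    unfolding \<xi>_def[abs_def] by (intro hom_smooth_cmult hom_smooth_sum hom_smooth_mult[OF h E]) auto
  have e: "hom_smooth (- 1 - 2 * int k) e"
    unfolding e_def[abs_def] by (intro hom_smooth_sum hom_smooth_mult[OF hom_smooth_C \<xi>]) auto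
  have u: "hom_smooth (- 1 - 2 * int k) u"
    unfolding u_def[abs_def] by (intro hom_smooth_add hom_smooth_cmult e hom_smooth_divergence[OF \<xi>]) auto
  have \<theta>': "hom_smooth (2 - 2 * int (Suc k)) (\<theta>' a)" for a
    unfolding \<theta>'_def[abs_def] by (rule hom_smooth_add) (rule hom_smooth_mult[OF u hom_smooth_component], simp, use \<xi> in simp)

  have \<theta>_orth: "(\<Sum>a\<in>UNIV. y_flat a y * \<theta> a y) = 0" if "y \<in> S" for y
    by (rule orthogonal_L_power_cancel[OF orth \<eta>\<theta> that])
  have pd_\<eta>: "L y * pd b (\<eta> a) y = L y ^ k * (L y * pd b (\<theta> a) y + 2 * ?k * y_flat b y * \<theta> a y)"
    if "y \<in> S" for a b y
    by (rule pd_L_power_mult[OF \<eta>\<theta> hom_smooth_differentiable[OF \<theta> that] that])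
  have divergence_\<eta>: "divergence \<eta> y = L y ^ k * divergence \<theta> y" if "y \<in> S" for y
    by (rule divergence_L_power_mult[OF \<theta> \<eta>\<theta> \<theta>_orth that])
  have C\<eta>: "(\<Sum>a\<in>UNIV. C a y * \<eta> a y) = L y ^ k * c y" if y: "y \<in> S" for y
    by (simp add: c_def \<eta>\<theta>[OF y] sum_distrib_left mult.left_commute)
  have \<rho>\<sigma>: "\<rho> y = L y ^ k * \<sigma> y" if y: "y \<in> S" for y
    unfolding \<rho>_eq[OF y] divergence_\<eta>[OF y] C\<eta>[OF y] by (simp add: \<sigma>_def algebra_simps)
  have pd_\<rho>: "L y * pd b \<rho> y = L y ^ k * (L y * pd b \<sigma> y + 2 * ?k * y_flat b y * \<sigma> y)" if y: "y \<in> S" for b y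
    by (rule pd_L_power_mult[OF \<rho>\<sigma> hom_smooth_differentiable[OF \<sigma> y] y])
  have pd_divergence_\<eta>: "L y * pd b (divergence \<eta>) y = L y ^ k * (L y * pd b (divergence \<theta>) y + 2 * ?k * y_flat b y * divergence \<theta> y)"
    if y: "y \<in> S" for b y
    by (rule pd_L_power_mult[OF divergence_\<eta> hom_smooth_differentiable[OF hom_smooth_divergence[OF \<theta> refl] y] y])
  have C_pd_\<eta>: "L y * (\<Sum>a\<in>UNIV. C a y * pd b (\<eta> a) y)
      = L y ^ k * (L y * (\<Sum>a\<in>UNIV. C a y * pd b (\<theta> a) y) + 2 * ?k * y_flat b y * c y)"
    if y: "y \<in> S" for b y
  proof -
    have "L y * (\<Sum>a\<in>UNIV. C a y * pd b (\<eta> a) y) = (\<Sum>a\<in>UNIV. C a y * (L y * pd b (\<eta> a) y))"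
      by (simp add: sum_distrib_left mult.left_commute)
    also have "\<dots> = (\<Sum>a\<in>UNIV. L y ^ k * (L y * (C a y * pd b (\<theta> a) y) + 2 * ?k * y_flat b y * (C a y * \<theta> a y)))"
      by (simp add: pd_\<eta>[OF y] algebra_simps)
    also have "\<dots> = L y ^ k * (L y * (\<Sum>a\<in>UNIV. C a y * pd b (\<theta> a) y) + 2 * ?k * y_flat b y * c y)"
      by (simp only: c_def sum_distrib_left[symmetric] sum.distrib)
    finally show ?thesis .
  qed
  have lowered: "(\<Sum>a\<in>UNIV. g a b y * \<theta> a y) = \<tau> y * y_flat b y - 1 / (?n + 2) * L y * E b y" if y: "y \<in> S" for b y
  proof -
    have "L y ^ k * ((?n + 2) * (\<Sum>a\<in>UNIV. g a b y * \<theta> a y)) = (?n + 2) * (\<Sum>a\<in>UNIV. g a b y * \<eta> a y)"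
      by (simp add: \<eta>\<theta>[OF y] sum_distrib_left mult.left_commute)
    also have "\<dots> = (?n + 2) * \<rho> y * y_flat b y - (2 * (L y * (\<Sum>a\<in>UNIV. C a y * pd b (\<eta> a) y))
         + 2 * L y * \<rho> y * C b y + 2 * (L y * pd b (divergence \<eta>) y) + ?n * (L y * pd b \<rho> y))"
      unfolding low[OF y] by (simp add: algebra_simps)
    also have "\<dots> = L y ^ k * ((?n + 2) * \<sigma> y * y_flat b y - (2 * (2 * ?k * y_flat b y * c y)
         + 2 * (2 * ?k * y_flat b y * divergence \<theta> y) + ?n * (2 * ?k * y_flat b y * \<sigma> y)) - L y * E b y)"
      unfolding C_pd_\<eta>[OF y] pd_divergence_\<eta>[OF y] pd_\<rho>[OF y] unfolding \<rho>\<sigma>[OF y] E_def by (simp add: algebra_simps)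
    also have "(?n + 2) * \<sigma> y * y_flat b y - (2 * (2 * ?k * y_flat b y * c y)
         + 2 * (2 * ?k * y_flat b y * divergence \<theta> y) + ?n * (2 * ?k * y_flat b y * \<sigma> y)) = (?n + 2) * \<tau> y * y_flat b y"
    proof -
      have divergence: "divergence \<theta> y = \<sigma> y - 2 * c y" by (simp add: \<sigma>_def)
      have "(?n + 2) * \<tau> y = (?n + 2) * (1 - 2 * ?k) * \<sigma> y + 4 * ?k * c y"
        unfolding \<tau>_def by (simp add: field_simps)
      then have "(?n + 2) * \<tau> y * y_flat b y = ((?n + 2) * (1 - 2 * ?k) * \<sigma> y + 4 * ?k * c y) * y_flat b y"
        by simp
      then show ?thesis unfolding divergence by (simp add: algebra_simps)
    qed
    finally have "(?n + 2) * (\<Sum>a\<in>UNIV. g a b y * \<theta> a y) = (?n + 2) * \<tau> y * y_flat b y - L y * E b y"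
      using L_pos[OF y] by simp
    then show ?thesis by (simp add: field_simps)
  qed
  have raised: "\<theta> a y = \<tau> y * y $ a + L y * \<xi> a y" if y: "y \<in> S" for a y
  proof -
    have "\<theta> a y = (\<Sum>b\<in>UNIV. h a b y * (\<Sum>c\<in>UNIV. g b c y * \<theta> c y))"
      by (rule raise_lower[OF y, symmetric])
    also have "\<dots> = (\<Sum>b\<in>UNIV. h a b y * (\<tau> y * y_flat b y - 1 / (?n + 2) * L y * E b y))"
      using lowered[OF y] g_sym[OF y] by simp
    also have "\<dots> = \<tau> y * (\<Sum>b\<in>UNIV. h a b y * y_flat b y) + L y * \<xi> a y"
      by (simp add: \<xi>_def right_diff_distrib sum_subtractf sum_negf sum_distrib_left mult.left_commute)
    also have "(\<Sum>b\<in>UNIV. h a b y * y_flat b y) = y $ a"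
      unfolding y_flat_def by (rule raise_lower[OF y])
    finally show ?thesis .
  qed
  have \<tau>_\<xi>: "\<tau> y = - (\<Sum>a\<in>UNIV. y_flat a y * \<xi> a y)" if y: "y \<in> S" for y
  proof -
    have "0 = \<tau> y * (\<Sum>a\<in>UNIV. y_flat a y * y $ a) + L y * (\<Sum>a\<in>UNIV. y_flat a y * \<xi> a y)"
      using \<theta>_orth[OF y] by (simp add: raised[OF y] distrib_left sum.distrib sum_distrib_left mult.left_commute)
    then have "L y * (\<tau> y + (\<Sum>a\<in>UNIV. y_flat a y * \<xi> a y)) = 0"
      unfolding y_flat_y[OF y] by (simp add: algebra_simps)
    then show ?thesis using L_pos[OF y] by simp
  qed
  have c_e: "c y = L y * e y" if y: "y \<in> S" for y
  proof -
    have "c y = \<tau> y * (\<Sum>a\<in>UNIV. C a y * y $ a) + L y * e y"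
      unfolding c_def e_def by (simp add: raised[OF y] distrib_left sum.distrib sum_distrib_left mult.left_commute)
    then show ?thesis by (simp add: C_y[OF y])
  qed
  have divergence_\<theta>: "divergence \<theta> y = (?n - 1 - 2 * ?k) * \<tau> y + L y * divergence \<xi> y" if y: "y \<in> S" for y
  proof -
    note diff = hom_smooth_differentiable[OF \<tau> y] hom_smooth_differentiable[OF \<xi> y] hom_smooth_differentiable[OF L y]
      component_differentiable
    have "divergence \<theta> y = divergence (\<lambda>a y. \<tau> y * y $ a + L y * \<xi> a y) y"
      by (rule divergence_cong[OF y raised])
    also have "\<dots> = divergence (\<lambda>a y. \<tau> y * y $ a) y + divergence (\<lambda>a y. L y * \<xi> a y) y"
      using diff by (intro divergence_add differentiable_mult)
    also have "\<dots> = (?n + of_int (1 - 2 * int k)) * \<tau> y + L y * divergence \<xi> y + (\<Sum>a\<in>UNIV. pd a L y * \<xi> a y)"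
      using divergence_radial[OF \<tau> y] divergence_scale[of L y \<xi>] diff by simp
    also have "(\<Sum>a\<in>UNIV. pd a L y * \<xi> a y) = - 2 * \<tau> y"
      by (simp add: \<tau>_\<xi>[OF y] pd_L[OF y] sum_distrib_left sum_negf mult.assoc)
    finally show ?thesis by (simp add: algebra_simps)
  qed
  \<comment> \<open>Two integers with product \<open>1\<close> are both \<open>1\<close> or both \<open>-1\<close>; here this means \<open>n = 2\<close>, with \<open>k = 0\<close> or \<open>k = 1\<close>.\<close>
  have m: "m \<noteq> 0"
  proof
    assume "m = 0"
    then have "(1 - 2 * ?k) * (?n - 1 - 2 * ?k) = 1" by (simp add: m_def)
    then have "of_int ((1 - 2 * int k) * (int CARD('n) - 1 - 2 * int k)) = (of_int 1 :: real)"
      by simp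
    then have "(1 - 2 * int k) * (int CARD('n) - 1 - 2 * int k) = 1"
      by (simp only: of_int_eq_iff)
    then show False
      using dim zmult_eq_1_iff[of "1 - 2 * int k"] by auto
  qed
  have \<tau>_u: "\<tau> y = L y * u y" if y: "y \<in> S" for y
  proof -
    have "m * \<tau> y = L y * ((1 - 2 * ?k) * (divergence \<xi> y + 2 * e y) + 4 * ?k / (?n + 2) * e y)"
      using \<tau>_def[of y] unfolding \<sigma>_def c_e[OF y] divergence_\<theta>[OF y] m_def by (simp add: algebra_simps)
    moreover have "m * u y = (1 - 2 * ?k) * (divergence \<xi> y + 2 * e y) + 4 * ?k / (?n + 2) * e y"
      using m by (simp add: u_def)
    ultimately have "m * \<tau> y = m * (L y * u y)" by simp
    then show ?thesis using m by simp
  qed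
  have "\<eta> a y = L y ^ Suc k * \<theta>' a y" if y: "y \<in> S" for a y
    by (simp add: \<eta>\<theta>[OF y] raised[OF y] \<tau>_u[OF y] \<theta>'_def algebra_simps)
  with \<theta>' show ?thesis by blast
qed

text \<open>The radial part inherits the divisibility from the orthogonal part, being its weighted divergence.\<close>

lemma affine_eq_divisible:
  assumes z: "\<And>a. hom_smooth 2 (z a)" and eq: "affine_eq z"
  shows "\<exists>w. (\<forall>a. hom_smooth (2 - 2 * int k) (w a)) \<and> (\<forall>a. \<forall>y\<in>S. z a y = L y ^ k * w a y)"
proof -
  obtain \<rho> \<eta> where split1: "hom_smooth 1 \<rho>" "\<And>a. hom_smooth 2 (\<eta> a)"
    and z_eq: "\<And>a y. y \<in> S \<Longrightarrow> z a y = \<eta> a y + \<rho> y * y $ a"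
    and split2: "\<And>y. y \<in> S \<Longrightarrow> (\<Sum>a\<in>UNIV. y_flat a y * \<eta> a y) = 0"
    "\<And>y. y \<in> S \<Longrightarrow> \<rho> y = divergence \<eta> y + 2 * (\<Sum>a\<in>UNIV. C a y * \<eta> a y)"
    "\<And>b y. y \<in> S \<Longrightarrow> (real CARD('n) + 2) * (\<Sum>a\<in>UNIV. g a b y * \<eta> a y) =
       (real CARD('n) + 2) * \<rho> y * y_flat b y - L y * (2 * (\<Sum>a\<in>UNIV. C a y * pd b (\<eta> a) y)
         + 2 * \<rho> y * C b y + 2 * pd b (divergence \<eta>) y + real CARD('n) * pd b \<rho> y)"
    by (rule orthogonal_splitting[OF z eq]) (rule that)
  have "\<exists>\<theta>. (\<forall>a. hom_smooth (2 - 2 * int k) (\<theta> a)) \<and> (\<forall>a. \<forall>y\<in>S. \<eta> a y = L y ^ k * \<theta> a y)"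
  proof (induction k)
    case 0
    show ?case using split1(2) by (intro exI[of _ \<eta>]) simp
  next
    case (Suc k)
    then obtain \<theta> where \<theta>: "\<And>a. hom_smooth (2 - 2 * int k) (\<theta> a)" and \<eta>\<theta>: "\<And>a y. y \<in> S \<Longrightarrow> \<eta> a y = L y ^ k * \<theta> a y"
      by blast
    show ?case by (rule orthogonal_part_divide_by_L[OF split2 \<theta> \<eta>\<theta>])
  qed
  then obtain \<theta> where \<theta>: "\<And>a. hom_smooth (2 - 2 * int k) (\<theta> a)" and \<eta>\<theta>: "\<And>a y. y \<in> S \<Longrightarrow> \<eta> a y = L y ^ k * \<theta> a y"
    by blast
  define \<sigma> where "\<sigma> y = divergence \<theta> y + 2 * (\<Sum>a\<in>UNIV. C a y * \<theta> a y)" for y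
  have \<sigma>: "hom_smooth (1 - 2 * int k) \<sigma>"
    unfolding \<sigma>_def[abs_def] by (intro hom_smooth_add hom_smooth_cmult hom_smooth_sum hom_smooth_mult[OF hom_smooth_C \<theta>] hom_smooth_divergence[OF \<theta>]) auto
  have "\<rho> y = L y ^ k * \<sigma> y" if y: "y \<in> S" for y
    using split2(2)[OF y] divergence_L_power_mult[OF \<theta> \<eta>\<theta> orthogonal_L_power_cancel[OF split2(1) \<eta>\<theta>] y]
    by (simp add: \<sigma>_def \<eta>\<theta>[OF y] sum_distrib_left algebra_simps)
  then have "z a y = L y ^ k * (\<theta> a y + \<sigma> y * y $ a)" if "y \<in> S" for a y
    using z_eq[OF that] \<eta>\<theta>[OF that] that by (simp add: algebra_simps)
  moreover have "hom_smooth (2 - 2 * int k) (\<lambda>y. \<theta> a y + \<sigma> y * y $ a)" for a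
    by (rule hom_smooth_add[OF \<theta>], rule hom_smooth_mult[OF \<sigma> hom_smooth_component]) simp
  ultimately show ?thesis by (intro exI[of _ "\<lambda>a y. \<theta> a y + \<sigma> y * y $ a"]) blast
qed

text \<open>The quotients by powers of \<open>L\<close> are bounded near \<open>y0\<close>, and \<open>L\<close> vanishes there at least linearly.\<close>

lemma affine_eq_flat_at_boundary:
  assumes z: "\<And>a. hom_smooth 2 (z a)" and eq: "affine_eq z"
    and E: "y0 \<in> W" "smooth_on W E" "\<And>y. y \<in> S \<Longrightarrow> E y = L y" "E y0 = 0"
  shows "\<exists>K d. d > 0 \<and> (\<forall>y\<in>S \<inter> ball y0 d. \<bar>z a y\<bar> \<le> K * norm (y - y0) ^ k)"
proof -
  obtain w where w: "\<And>a. hom_smooth (2 - 2 * int k) (w a)" "\<And>a y. y \<in> S \<Longrightarrow> z a y = L y ^ k * w a y"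
    using affine_eq_divisible[OF z eq, of k] by blast
  obtain K d where d: "d > 0" "\<And>y. y \<in> S \<inter> ball y0 d \<Longrightarrow> \<bar>w a y\<bar> \<le> K"
    using hom_smooth_bounded[OF w(1)] by blast
  obtain M e where e: "e > 0" "\<And>y. dist y y0 < e \<Longrightarrow> \<bar>E y\<bar> \<le> M * norm (y - y0)"
    using lipschitz_at_point[OF smooth_on_imp_differentiable[OF E(2,1)]] E(4) by auto
  have "\<bar>z a y\<bar> \<le> (\<bar>M\<bar> ^ k * K) * norm (y - y0) ^ k" if y: "y \<in> S \<inter> ball y0 (min d e)" for y
  proof -
    have "\<bar>L y\<bar> \<le> M * norm (y - y0)"
      using e(2)[of y] E(3)[of y] y by (simp add: dist_commute)
    also have "\<dots> \<le> \<bar>M\<bar> * norm (y - y0)" by (intro mult_right_mono) auto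
    finally have "\<bar>L y\<bar> ^ k \<le> (\<bar>M\<bar> * norm (y - y0)) ^ k"
      by (intro power_mono) auto
    then have "\<bar>L y\<bar> ^ k * \<bar>w a y\<bar> \<le> (\<bar>M\<bar> * norm (y - y0)) ^ k * K"
      using d(2)[of y] y by (intro mult_mono) auto
    then show ?thesis
      using w(2)[of y a] y by (simp add: abs_mult power_abs power_mult_distrib mult_ac)
  qed
  then show ?thesis using d(1) e(1) by (intro exI[of _ "\<bar>M\<bar> ^ k * K"] exI[of _ "min d e"]) auto
qed

end

section \<open>Real analytic functions on lines\<close>

text \<open>A power series is controlled from below by its first nonzero term. It serves twice: a series that is flat at \<open>0\<close>
  and a series with zeros accumulating at \<open>0\<close> both have no first nonzero term.\<close>

lemma powser_leading_term_bound:
  fixes c :: "nat \<Rightarrow> real"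
  assumes "\<epsilon> > 0" and summ: "\<And>t. \<bar>t\<bar> < \<epsilon> \<Longrightarrow> summable (\<lambda>m. c m * t ^ m)"
    and M: "c M \<noteq> 0" "\<And>m. m < M \<Longrightarrow> c m = 0"
  shows "\<exists>\<delta>>0. \<forall>t. \<bar>t\<bar> < \<delta> \<longrightarrow> \<bar>c M\<bar> / 2 * \<bar>t\<bar> ^ M \<le> \<bar>\<Sum>m. c m * t ^ m\<bar>"
proof -
  define G where "G t = (\<Sum>m. c (m + M) * t ^ m)" for t
  have K: "summable (\<lambda>m. c (m + M) * (\<epsilon> / 2) ^ m)"
  proof -
    have "summable (\<lambda>m. c (m + M) * (\<epsilon> / 2) ^ (m + M))"
      using summ[of "\<epsilon> / 2"] \<open>\<epsilon> > 0\<close> by (subst summable_iff_shift) auto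
    then have "summable (\<lambda>m. (\<epsilon> / 2) ^ M * (c (m + M) * (\<epsilon> / 2) ^ m))"
      by (simp add: power_add mult_ac)
    then show ?thesis
      using \<open>\<epsilon> > 0\<close> by (subst (asm) summable_cmult_iff) auto
  qed
  have G0: "G 0 = c M"
    unfolding G_def using powser_zero[of "\<lambda>m. c (m + M)"] by simp
  have "isCont G 0"
    unfolding G_def[abs_def] using \<open>\<epsilon> > 0\<close> by (intro isCont_powser[OF K]) auto
  then obtain d where d: "d > 0" "\<And>t. \<bar>t\<bar> < d \<Longrightarrow> \<bar>G t - c M\<bar> < \<bar>c M\<bar> / 2"
    using M(1) unfolding continuous_at_eps_delta dist_real_def G0
    by (metis diff_zero half_gt_zero zero_less_abs_iff)
  have "\<bar>c M\<bar> / 2 * \<bar>t\<bar> ^ M \<le> \<bar>\<Sum>m. c m * t ^ m\<bar>" if t: "\<bar>t\<bar> < min d (\<epsilon> / 2)" for t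
  proof -
    have t': "\<bar>t\<bar> < \<epsilon>" using t by linarith
    have sG: "summable (\<lambda>m. c (m + M) * t ^ m)"
      using powser_inside[OF K, of t] t by simp
    have "(\<Sum>m. c m * t ^ m) = (\<Sum>m. c (m + M) * t ^ (m + M)) + (\<Sum>m<M. c m * t ^ m)"
      by (rule suminf_split_initial_segment[OF summ[OF t']])
    also have "(\<Sum>m<M. c m * t ^ m) = 0" using M(2) by simp
    also have "(\<Sum>m. c (m + M) * t ^ (m + M)) = t ^ M * G t"
      unfolding G_def by (subst suminf_mult[OF sG, symmetric]) (simp add: power_add mult_ac)
    finally have "\<bar>\<Sum>m. c m * t ^ m\<bar> = \<bar>t\<bar> ^ M * \<bar>G t\<bar>"
      by (simp add: abs_mult power_abs)
    moreover have "\<bar>c M\<bar> / 2 \<le> \<bar>G t\<bar>"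
      using d(2)[of t] t by linarith
    ultimately show ?thesis
      by (metis mult.commute mult_left_mono zero_le_power abs_ge_zero)
  qed
  then show ?thesis using d(1) \<open>\<epsilon> > 0\<close> by (intro exI[of _ "min d (\<epsilon> / 2)"]) auto
qed

lemma powser_eq_zero_if_flat:
  fixes c :: "nat \<Rightarrow> real"
  assumes \<epsilon>: "\<epsilon> > 0" and summ: "\<And>t. \<bar>t\<bar> < \<epsilon> \<Longrightarrow> summable (\<lambda>m. c m * t ^ m)"
    and flat: "\<And>k. \<exists>K. \<forall>\<delta>>0. \<exists>t. t \<noteq> 0 \<and> \<bar>t\<bar> < \<delta> \<and> \<bar>\<Sum>m. c m * t ^ m\<bar> \<le> K * \<bar>t\<bar> ^ k"
  shows "c m = 0"
proof (rule ccontr)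
  assume "c m \<noteq> 0"
  define M where "M = (LEAST m. c m \<noteq> 0)"
  have M: "c M \<noteq> 0" "\<And>m. m < M \<Longrightarrow> c m = 0"
    unfolding M_def using \<open>c m \<noteq> 0\<close> LeastI[of "\<lambda>m. c m \<noteq> 0"] not_less_Least by blast+
  obtain \<delta> where \<delta>: "\<delta> > 0" "\<And>t. \<bar>t\<bar> < \<delta> \<Longrightarrow> \<bar>c M\<bar> / 2 * \<bar>t\<bar> ^ M \<le> \<bar>\<Sum>m. c m * t ^ m\<bar>"
    using powser_leading_term_bound[OF \<epsilon> summ M] by auto
  obtain K where K: "\<And>\<delta>. \<delta> > 0 \<Longrightarrow> \<exists>t. t \<noteq> 0 \<and> \<bar>t\<bar> < \<delta> \<and> \<bar>\<Sum>m. c m * t ^ m\<bar> \<le> K * \<bar>t\<bar> ^ Suc M"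
    using flat[of "Suc M"] by blast
  define \<delta>' where "\<delta>' = min \<delta> (\<bar>c M\<bar> / (2 * (\<bar>K\<bar> + 1)))"
  have "\<delta>' > 0" using \<delta>(1) M(1) by (simp add: \<delta>'_def)
  then obtain t where t: "t \<noteq> 0" "\<bar>t\<bar> < \<delta>'" "\<bar>\<Sum>m. c m * t ^ m\<bar> \<le> K * \<bar>t\<bar> ^ Suc M"
    using K by blast
  have "\<bar>t\<bar> < \<delta>" using t(2) by (simp add: \<delta>'_def)
  from order_trans[OF \<delta>(2)[OF this] t(3)]
  have "\<bar>c M\<bar> / 2 * \<bar>t\<bar> ^ M \<le> (K * \<bar>t\<bar>) * \<bar>t\<bar> ^ M"
    by (simp only: power_Suc mult.assoc)
  then have "\<bar>c M\<bar> / 2 \<le> K * \<bar>t\<bar>"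
    by (rule mult_right_le_imp_le) (use t(1) in simp)
  also have "\<dots> \<le> (\<bar>K\<bar> + 1) * \<bar>t\<bar>"
    by (intro mult_right_mono) auto
  also have "\<dots> < (\<bar>K\<bar> + 1) * (\<bar>c M\<bar> / (2 * (\<bar>K\<bar> + 1)))"
    using t(2) by (intro mult_strict_left_mono) (auto simp: \<delta>'_def)
  also have "\<dots> = \<bar>c M\<bar> / 2" by (simp add: field_simps)
  finally show False by simp
qed

definition line_analytic :: "real set \<Rightarrow> (real \<Rightarrow> real) \<Rightarrow> bool" where
  "line_analytic I p \<longleftrightarrow> (\<forall>s\<in>I. \<exists>c \<epsilon>. \<epsilon> > 0 \<and> (\<forall>t. \<bar>t\<bar> < \<epsilon> \<longrightarrow> summable (\<lambda>m. c m * t ^ m)) \<and>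
     (\<forall>t. \<bar>t\<bar> < \<epsilon> \<longrightarrow> s + t \<in> I \<longrightarrow> (\<lambda>m. c m * t ^ m) sums p (s + t)))"

lemma line_analytic_identity:
  assumes I: "open I" "connected I" and p: "line_analytic I p"
    and U: "open U" "U \<noteq> {}" "U \<subseteq> I" "\<And>t. t \<in> U \<Longrightarrow> p t = 0" and t: "t \<in> I"
  shows "p t = 0"
proof -
  define V where "V = interior {t \<in> I. p t = 0}"
  have V: "V \<subseteq> I" "\<And>t. t \<in> V \<Longrightarrow> p t = 0" "open V"
    unfolding V_def using interior_subset by auto
  have "U \<subseteq> V" unfolding V_def using U by (intro interior_maximal) auto
  have "closedin (top_of_set I) V"
    unfolding closedin_limpt
  proof (intro conjI allI impI)
    fix s assume s: "s islimpt V \<and> s \<in> I"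
    have "s \<in> I" using s by simp
    obtain c \<epsilon> where c': "\<epsilon> > 0" "\<forall>t. \<bar>t\<bar> < \<epsilon> \<longrightarrow> summable (\<lambda>m. c m * t ^ m)"
      "\<forall>t. \<bar>t\<bar> < \<epsilon> \<longrightarrow> s + t \<in> I \<longrightarrow> (\<lambda>m. c m * t ^ m) sums p (s + t)"
      using bspec[OF p[unfolded line_analytic_def] \<open>s \<in> I\<close>] by (elim conjE exE) (rule that)
    note c = c'[rule_format]
    have "c m = 0" for m
    proof (rule powser_eq_zero_if_flat[OF c(1,2)])
      fix k
      have "\<exists>t. t \<noteq> 0 \<and> \<bar>t\<bar> < \<delta> \<and> \<bar>\<Sum>m. c m * t ^ m\<bar> \<le> 0 * \<bar>t\<bar> ^ k" if "\<delta> > 0" for \<delta>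
      proof -
        have "min \<delta> \<epsilon> > 0" using that c(1) by simp
        then obtain x where x: "x \<in> V" "x \<noteq> s" "dist x s < min \<delta> \<epsilon>"
          using s unfolding islimpt_approachable by blast
        then have "(\<lambda>m. c m * (x - s) ^ m) sums p (s + (x - s))"
          using V by (intro c(3)) (auto simp: dist_real_def)
        then have "(\<Sum>m. c m * (x - s) ^ m) = 0"
          using V(2)[OF x(1)] by (simp add: sums_iff)
        then show ?thesis using x by (intro exI[of _ "x - s"]) (auto simp: dist_real_def)
      qed
      then show "\<exists>K. \<forall>\<delta>>0. \<exists>t. t \<noteq> 0 \<and> \<bar>t\<bar> < \<delta> \<and> \<bar>\<Sum>m. c m * t ^ m\<bar> \<le> K * \<bar>t\<bar> ^ k"
        by blast
    qed
    then have "p x = 0" if "x \<in> I" "dist s x < \<epsilon>" for x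
      using c(3)[of "x - s"] that by (auto simp: dist_real_def sums_iff)
    then have "ball s \<epsilon> \<inter> I \<subseteq> V"
      unfolding V_def using I(1) by (intro interior_maximal) auto
    then show "s \<in> V" using s c(1) by auto
  qed (use V in auto)
  moreover have "openin (top_of_set I) V"
    using V by (simp add: open_subset)
  ultimately have "V = {} \<or> V = I"
    using I(2) unfolding connected_clopen by blast
  with \<open>U \<subseteq> V\<close> U(2) have "V = I" by auto
  with V(2) t show ?thesis by blast
qed

lemma finite_multi_indices: "finite {\<alpha> :: 'n::finite \<Rightarrow> nat. sum \<alpha> UNIV = m}"
proof (rule finite_subset)
  show "{\<alpha> :: 'n \<Rightarrow> nat. sum \<alpha> UNIV = m} \<subseteq> PiE UNIV (\<lambda>_. {..m})"
    by (auto simp: PiE_UNIV_domain intro: member_le_sum)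
qed (auto intro: finite_PiE)

text \<open>On a line through the centre, the terms of the power series in several variables that have the same total degree
  \<open>m\<close> combine to a single term \<open>c m * t ^ m\<close>.\<close>

lemma real_analytic_on_line:
  fixes f :: "real^'n::finite \<Rightarrow> real"
  assumes "real_analytic_on T f" "y \<in> T"
  shows "\<exists>c \<epsilon>. \<epsilon> > 0 \<and> (\<forall>t. \<bar>t\<bar> < \<epsilon> \<longrightarrow> summable (\<lambda>m. c m * t ^ m)) \<and>
     (\<forall>t. \<bar>t\<bar> < \<epsilon> \<longrightarrow> y + t *\<^sub>R v \<in> T \<longrightarrow> (\<lambda>m. c m * t ^ m) sums f (y + t *\<^sub>R v))"
proof -
  define A where "A m = {\<alpha> :: 'n \<Rightarrow> nat. sum \<alpha> UNIV = m}" for m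
  obtain a r where ar: "r > 0 \<and>
      (\<forall>z\<in>ball y r. (\<lambda>\<alpha>. a \<alpha> * (\<Prod>i\<in>UNIV. (z$i - y$i) ^ \<alpha> i)) summable_on UNIV) \<and>
      (\<forall>z\<in>T \<inter> ball y r. ((\<lambda>\<alpha>. a \<alpha> * (\<Prod>i\<in>UNIV. (z$i - y$i) ^ \<alpha> i)) has_sum f z) UNIV)"
    using bspec[OF assms(1)[unfolded real_analytic_on_def] assms(2)] by (elim exE) (rule that)
  then have r: "r > 0"
    and summ: "\<And>z. z \<in> ball y r \<Longrightarrow> (\<lambda>\<alpha>. a \<alpha> * (\<Prod>i\<in>UNIV. (z$i - y$i) ^ \<alpha> i)) summable_on UNIV"
    and sum: "\<And>z. z \<in> T \<inter> ball y r \<Longrightarrow> ((\<lambda>\<alpha>. a \<alpha> * (\<Prod>i\<in>UNIV. (z$i - y$i) ^ \<alpha> i)) has_sum f z) UNIV"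
    by (simp_all only: conj_assoc)
  define c where "c m = (\<Sum>\<alpha>\<in>A m. a \<alpha> * (\<Prod>i\<in>UNIV. (v $ i) ^ \<alpha> i))" for m
  define \<epsilon> where "\<epsilon> = r / (norm v + 1)"
  have pos: "norm v + 1 > 0" by (smt (verit) norm_ge_zero)
  have \<epsilon>: "\<epsilon> > 0" using r pos by (simp add: \<epsilon>_def)
  have inball: "y + t *\<^sub>R v \<in> ball y r" if "\<bar>t\<bar> < \<epsilon>" for t
  proof -
    have "\<bar>t\<bar> * norm v \<le> \<bar>t\<bar> * (norm v + 1)" by (intro mult_left_mono) auto
    also have "\<dots> < r" using that pos by (simp add: \<epsilon>_def pos_less_divide_eq)
    finally show ?thesis by (simp add: dist_norm)
  qed
  have sums: "(\<lambda>m. c m * t ^ m) sums F"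
    if "((\<lambda>\<alpha>. a \<alpha> * (\<Prod>i\<in>UNIV. ((y + t *\<^sub>R v)$i - y$i) ^ \<alpha> i)) has_sum F) UNIV" for t F
  proof -
    let ?b = "\<lambda>\<alpha>. a \<alpha> * (\<Prod>i\<in>UNIV. ((y + t *\<^sub>R v)$i - y$i) ^ \<alpha> i)"
    have bij: "bij_betw snd (Sigma UNIV A) UNIV"
      by (rule bij_betwI[where g = "\<lambda>\<alpha>. (sum \<alpha> UNIV, \<alpha>)"]) (auto simp: A_def)
    have "((\<lambda>x. ?b (snd x)) has_sum F) (Sigma UNIV A)"
      using that by (simp only: has_sum_reindex_bij_betw[OF bij, of ?b])
    then have "((\<lambda>m. c m * t ^ m) has_sum F) UNIV"
    proof (rule has_sum_SigmaD)
      fix m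
      have "(\<Sum>\<alpha>\<in>A m. ?b \<alpha>) = c m * t ^ m"
        unfolding c_def sum_distrib_right
        by (intro sum.cong) (auto simp: A_def power_mult_distrib prod.distrib power_sum)
      then show "((\<lambda>\<alpha>. ?b (snd (m, \<alpha>))) has_sum c m * t ^ m) (A m)"
        using has_sum_finite[of "A m" ?b] finite_multi_indices[of m] by (simp add: A_def)
    qed
    then show ?thesis by (rule has_sum_imp_sums)
  qed
  show ?thesis
  proof (intro exI[of _ c] exI[of _ \<epsilon>] conjI allI impI \<epsilon>)
    fix t :: real assume t: "\<bar>t\<bar> < \<epsilon>"
    show "summable (\<lambda>m. c m * t ^ m)"
      using sums[OF has_sum_infsum[OF summ[OF inball[OF t]]]] by (rule sums_summable)
    show "(\<lambda>m. c m * t ^ m) sums f (y + t *\<^sub>R v)" if "y + t *\<^sub>R v \<in> T"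
      using that inball[OF t] by (intro sums sum) auto
  qed
qed

lemma real_analytic_on_imp_line_analytic:
  assumes f: "real_analytic_on T f" and I: "\<And>t. t \<in> I \<Longrightarrow> q + t *\<^sub>R v \<in> T"
  shows "line_analytic I (\<lambda>t. f (q + t *\<^sub>R v))"
  unfolding line_analytic_def
proof
  fix s assume s: "s \<in> I"
  obtain c \<epsilon> where c: "\<epsilon> > 0" "\<forall>t. \<bar>t\<bar> < \<epsilon> \<longrightarrow> summable (\<lambda>m. c m * t ^ m)"
      "\<forall>t. \<bar>t\<bar> < \<epsilon> \<longrightarrow> q + s *\<^sub>R v + t *\<^sub>R v \<in> T \<longrightarrow> (\<lambda>m. c m * t ^ m) sums f (q + s *\<^sub>R v + t *\<^sub>R v)"
    using real_analytic_on_line[OF f I[OF s], of v] by (elim conjE exE) (rule that)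
  have eq: "q + s *\<^sub>R v + t *\<^sub>R v = q + (s + t) *\<^sub>R v" for t
    by (simp add: algebra_simps)
  show "\<exists>c \<epsilon>. \<epsilon> > 0 \<and> (\<forall>t. \<bar>t\<bar> < \<epsilon> \<longrightarrow> summable (\<lambda>m. c m * t ^ m)) \<and>
     (\<forall>t. \<bar>t\<bar> < \<epsilon> \<longrightarrow> s + t \<in> I \<longrightarrow> (\<lambda>m. c m * t ^ m) sums f (q + (s + t) *\<^sub>R v))"
    by (intro exI[of _ c] exI[of _ \<epsilon>]) (use c I eq in auto)
qed

lemma real_analytic_on_convex_identity:
  fixes f :: "real^'n::finite \<Rightarrow> real"
  assumes f: "real_analytic_on T f" and B: "open B" "convex B" "B \<subseteq> T"
    and U: "open U" "\<And>t. t \<in> U \<Longrightarrow> q + t *\<^sub>R v \<in> B \<and> f (q + t *\<^sub>R v) = 0" "U \<noteq> {}"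
    and z: "q + s *\<^sub>R v \<in> B"
  shows "f (q + s *\<^sub>R v) = 0"
proof -
  define I where "I = (\<lambda>t. q + t *\<^sub>R v) -` B"
  have "open I"
    unfolding I_def by (rule open_vimage[OF B(1)]) (intro continuous_intros)
  moreover have "convex I"
    unfolding convex_def I_def
  proof (clarsimp)
    fix x y u w :: real
    assume "q + x *\<^sub>R v \<in> B" "q + y *\<^sub>R v \<in> B" and u: "0 \<le> u" "0 \<le> w" "u + w = 1"
    then have "u *\<^sub>R (q + x *\<^sub>R v) + w *\<^sub>R (q + y *\<^sub>R v) \<in> B"
      using B(2) unfolding convex_def by blast
    moreover have "u *\<^sub>R (q + x *\<^sub>R v) + w *\<^sub>R (q + y *\<^sub>R v) = (u + w) *\<^sub>R q + (u * x + w * y) *\<^sub>R v"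
      by (simp add: algebra_simps)
    ultimately show "q + (u * x + w * y) *\<^sub>R v \<in> B" using u by simp
  qed
  moreover have "line_analytic I (\<lambda>t. f (q + t *\<^sub>R v))"
    using B(3) by (intro real_analytic_on_imp_line_analytic[OF f]) (auto simp: I_def)
  ultimately show ?thesis
    using line_analytic_identity[of I "\<lambda>t. f (q + t *\<^sub>R v)" U s] U z convex_connected[of I]
    by (auto simp: I_def)
qed

text \<open>The set near which \<open>f\<close> vanishes is closed in \<open>S\<close>: a ball around a limit point meets it in some \<open>q\<close>, and on each
  segment from \<open>q\<close> to a point of the ball the identity theorem in one variable applies.\<close>

lemma real_analytic_on_identity:
  fixes f :: "real^'n::finite \<Rightarrow> real"
  assumes f: "real_analytic_on T f" and S: "open S" "connected S" "S \<subseteq> T"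
    and U: "open U" "U \<noteq> {}" "U \<subseteq> S" "\<And>y. y \<in> U \<Longrightarrow> f y = 0" and y: "y \<in> S"
  shows "f y = 0"
proof -
  define V where "V = interior {y \<in> S. f y = 0}"
  have V: "V \<subseteq> S" "\<And>y. y \<in> V \<Longrightarrow> f y = 0" "open V"
    unfolding V_def using interior_subset by auto
  have "U \<subseteq> V" unfolding V_def using U by (intro interior_maximal) auto
  have "closedin (top_of_set S) V"
    unfolding closedin_limpt
  proof (intro conjI allI impI)
    fix x assume x: "x islimpt V \<and> x \<in> S"
    then obtain e where e: "e > 0" "ball x e \<subseteq> S" using S(1) openE by blast
    obtain q where q: "q \<in> V" "q \<in> ball x e"
      using x e(1) unfolding islimpt_approachable by (auto simp: dist_commute)
    have "f z = 0" if z: "z \<in> ball x e" for z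
    proof -
      have "f (q + 1 *\<^sub>R (z - q)) = 0"
      proof (rule real_analytic_on_convex_identity[OF f, where B = "ball x e" and U = "(\<lambda>t. q + t *\<^sub>R (z - q)) -` (V \<inter> ball x e)"])
        show "open ((\<lambda>t. q + t *\<^sub>R (z - q)) -` (V \<inter> ball x e))"
          using V(3) by (intro open_vimage continuous_intros) auto
        have "0 \<in> (\<lambda>t. q + t *\<^sub>R (z - q)) -` (V \<inter> ball x e)" using q by simp
        then show "(\<lambda>t. q + t *\<^sub>R (z - q)) -` (V \<inter> ball x e) \<noteq> {}" by blast
      qed (use e S V z in auto)
      then show ?thesis by simp
    qed
    then have "ball x e \<subseteq> V"
      unfolding V_def using e by (intro interior_maximal) auto
    then show "x \<in> V" using e by auto
  qed (use V in auto)
  moreover have "openin (top_of_set S) V"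
    using V by (simp add: open_subset)
  ultimately have "V = {} \<or> V = S"
    using S(2) unfolding connected_clopen by blast
  with \<open>U \<subseteq> V\<close> U(2) have "V = S" by auto
  with V(2) y show ?thesis by blast
qed

text \<open>The ball touching \<open>y0\<close> provides segments from \<open>y0\<close> into \<open>S\<close> that fill an open set. Along each of them the
  expansion of \<open>f\<close> at \<open>y0\<close> is flat, so it is zero.\<close>

lemma real_analytic_on_flat_at_boundary:
  fixes f :: "real^'n::finite \<Rightarrow> real"
  assumes f: "real_analytic_on T f" and S: "open S" "connected S" "S \<subseteq> T"
    and y0: "y0 \<in> T" and B: "r > 0" "ball y1 r \<subseteq> S" "dist y1 y0 = r"
    and flat: "\<And>k. \<exists>K e. e > 0 \<and> (\<forall>y\<in>S \<inter> ball y0 e. \<bar>f y\<bar> \<le> K * norm (y - y0) ^ k)"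
    and y: "y \<in> S"
  shows "f y = 0"
proof (rule real_analytic_on_identity[OF f S])
  fix z assume z: "z \<in> ball y1 r"
  define v where "v = z - y0"
  have seg: "y0 + t *\<^sub>R v \<in> ball y1 r" if t: "0 < t" "t \<le> 1" for t
  proof -
    have "y1 - (y0 + t *\<^sub>R v) = (1 - t) *\<^sub>R (y1 - y0) + t *\<^sub>R (y1 - z)"
      by (simp add: v_def algebra_simps)
    then have "norm (y1 - (y0 + t *\<^sub>R v)) \<le> (1 - t) * norm (y1 - y0) + t * norm (y1 - z)"
      using t norm_triangle_ineq[of "(1 - t) *\<^sub>R (y1 - y0)" "t *\<^sub>R (y1 - z)"] by simp
    also have "\<dots> < (1 - t) * r + t * r"
      using B z t by (simp add: dist_norm)
    finally show ?thesis by (simp add: dist_norm algebra_simps)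
  qed
  obtain c \<epsilon> where c': "\<epsilon> > 0" "\<forall>t. \<bar>t\<bar> < \<epsilon> \<longrightarrow> summable (\<lambda>m. c m * t ^ m)"
      "\<forall>t. \<bar>t\<bar> < \<epsilon> \<longrightarrow> y0 + t *\<^sub>R v \<in> T \<longrightarrow> (\<lambda>m. c m * t ^ m) sums f (y0 + t *\<^sub>R v)"
    using real_analytic_on_line[OF f y0, of v] by (elim conjE exE) (rule that)
  note c = c'[rule_format]
  have sums: "(\<lambda>m. c m * t ^ m) sums f (y0 + t *\<^sub>R v)" if "0 < t" "t < min \<epsilon> 1" for t
    using seg[of t] that B(2) S(3) by (intro c(3)) auto
  have c0: "c m = 0" for m
  proof (rule powser_eq_zero_if_flat[OF c(1,2)])
    fix k
    obtain K e where K: "e > 0" "\<And>y. y \<in> S \<inter> ball y0 e \<Longrightarrow> \<bar>f y\<bar> \<le> K * norm (y - y0) ^ k"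
      using flat[of k] by blast
    have "\<exists>t. t \<noteq> 0 \<and> \<bar>t\<bar> < \<delta> \<and> \<bar>\<Sum>m. c m * t ^ m\<bar> \<le> K * norm v ^ k * \<bar>t\<bar> ^ k" if "\<delta> > 0" for \<delta>
    proof -
      define M where "M = min (min \<epsilon> 1) (min \<delta> (e / (norm v + 1)))"
      define t where "t = M / 2"
      have pos: "norm v + 1 > 0" by (smt (verit) norm_ge_zero)
      then have "M > 0" using K(1) c(1) that by (simp add: M_def)
      moreover have "M \<le> min \<epsilon> 1" "M \<le> \<delta>" "M \<le> e / (norm v + 1)"
        unfolding M_def by (rule min.cobounded1) (auto intro: min.coboundedI2)
      ultimately have t: "0 < t" "t < min \<epsilon> 1" "t < \<delta>" "t < e / (norm v + 1)"
        unfolding t_def by linarith+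
      have "t * norm v \<le> t * (norm v + 1)" using t by (intro mult_left_mono) auto
      also have "\<dots> < e" using t(4) pos by (simp add: pos_less_divide_eq)
      finally have "y0 + t *\<^sub>R v \<in> S \<inter> ball y0 e"
        using seg[of t] t B(2) by (auto simp: dist_norm)
      from K(2)[OF this] show ?thesis
        using sums[OF t(1,2)] t by (intro exI[of _ t]) (auto simp: sums_iff power_mult_distrib mult_ac)
    qed
    then show "\<exists>K. \<forall>\<delta>>0. \<exists>t. t \<noteq> 0 \<and> \<bar>t\<bar> < \<delta> \<and> \<bar>\<Sum>m. c m * t ^ m\<bar> \<le> K * \<bar>t\<bar> ^ k"
      by blast
  qed
  have "f (y0 + 1 *\<^sub>R v) = 0"
  proof (rule real_analytic_on_convex_identity[OF f, where U = "{0<..<min \<epsilon> 1}" and B = "ball y1 r"])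
    show "y0 + t *\<^sub>R v \<in> ball y1 r \<and> f (y0 + t *\<^sub>R v) = 0" if "t \<in> {0<..<min \<epsilon> 1}" for t
      using sums[of t] seg[of t] that by (simp add: c0 sums_iff)
  qed (use B S c(1) z in \<open>auto simp: v_def\<close>)
  then show "f z = 0" by (simp add: v_def)
qed (use B y in auto)

lemma has_sum_real_diff:
  fixes f g :: "'i \<Rightarrow> real"
  assumes "(f has_sum a) I" "(g has_sum b) I"
  shows "((\<lambda>i. f i - g i) has_sum (a - b)) I"
  using has_sum_add[OF assms(1), of "\<lambda>i. - g i" "- b"] assms(2) by (simp add: has_sum_uminus)

lemma real_analytic_on_diff:
  assumes "real_analytic_on T f" "real_analytic_on T g"
  shows "real_analytic_on T (\<lambda>y. f y - g y)"
  unfolding real_analytic_on_def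
proof
  fix y assume y: "y \<in> T"
  let ?m = "\<lambda>z \<alpha>. \<Prod>i\<in>UNIV. (z$i - y$i) ^ \<alpha> i"
  obtain a r where a: "r > 0 \<and> (\<forall>z\<in>ball y r. (\<lambda>\<alpha>. a \<alpha> * ?m z \<alpha>) summable_on UNIV) \<and>
      (\<forall>z\<in>T \<inter> ball y r. ((\<lambda>\<alpha>. a \<alpha> * ?m z \<alpha>) has_sum f z) UNIV)"
    using bspec[OF assms(1)[unfolded real_analytic_on_def] y] by (elim exE) (rule that)
  obtain b s where b: "s > 0 \<and> (\<forall>z\<in>ball y s. (\<lambda>\<alpha>. b \<alpha> * ?m z \<alpha>) summable_on UNIV) \<and>
      (\<forall>z\<in>T \<inter> ball y s. ((\<lambda>\<alpha>. b \<alpha> * ?m z \<alpha>) has_sum g z) UNIV)"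
    using bspec[OF assms(2)[unfolded real_analytic_on_def] y] by (elim exE) (rule that)
  have "(\<lambda>\<alpha>. (a \<alpha> - b \<alpha>) * ?m z \<alpha>) summable_on UNIV" if "z \<in> ball y (min r s)" for z
  proof -
    have "(\<lambda>\<alpha>. a \<alpha> * ?m z \<alpha>) summable_on UNIV" "(\<lambda>\<alpha>. b \<alpha> * ?m z \<alpha>) summable_on UNIV"
      using a b that by auto
    then show ?thesis
      unfolding left_diff_distrib by (intro has_sum_imp_summable[OF has_sum_real_diff[OF has_sum_infsum has_sum_infsum]])
  qed
  moreover have "((\<lambda>\<alpha>. (a \<alpha> - b \<alpha>) * ?m z \<alpha>) has_sum (f z - g z)) UNIV" if "z \<in> T \<inter> ball y (min r s)" for z
    unfolding left_diff_distrib using a b that by (intro has_sum_real_diff) auto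
  moreover have "min r s > 0" using a b by simp
  ultimately show "\<exists>a r. r > 0 \<and> (\<forall>z\<in>ball y r. (\<lambda>\<alpha>. a \<alpha> * ?m z \<alpha>) summable_on UNIV) \<and>
      (\<forall>z\<in>T \<inter> ball y r. ((\<lambda>\<alpha>. a \<alpha> * ?m z \<alpha>) has_sum (f z - g z)) UNIV)"
    by (intro exI[of _ "\<lambda>\<alpha>. a \<alpha> - b \<alpha>"] exI[of _ "min r s"]) blast
qed

section \<open>Boundary points of open cones\<close>

text \<open>In dimension at least two the punctured space is connected, so its proper nonempty open subset \<open>S\<close> has a
  frontier point \<open>q'\<close> other than \<open>0\<close>.
  The point of the complement nearest to some \<open>y1 \<in> S\<close> is the required \<open>y0\<close>; if \<open>y1\<close> is close enough to \<open>q'\<close>, it is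
  different from \<open>0\<close>.\<close>

lemma exists_touching_ball:
  fixes S :: "'a::euclidean_space set"
  assumes S: "open S" "S \<noteq> {}" "0 \<notin> S" "S \<noteq> - {0}" and dim: "2 \<le> DIM('a)"
  shows "\<exists>y0 y1 r. y0 \<noteq> 0 \<and> y0 \<notin> S \<and> y0 \<in> closure S \<and> r > 0 \<and> ball y1 r \<subseteq> S \<and> dist y1 y0 = r"
proof -
  have "connected (- {0 :: 'a})" by (rule connected_punctured_universe[OF dim])
  moreover have sub: "S \<subseteq> - {0}" using S(3) by auto
  then have "- {0} \<inter> S \<noteq> {}" using S(2) by (simp add: inf.absorb2)
  moreover have "- {0} - S \<noteq> {}" using S(4) sub by (metis Diff_eq_empty_iff subset_antisym)
  ultimately have "- {0} \<inter> frontier S \<noteq> {}" by (rule connected_Int_frontier)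
  then obtain q' where q': "q' \<noteq> 0" "q' \<in> closure S" "q' \<notin> S"
    using S(1) by (auto simp: frontier_def interior_open)
  obtain y1 where y1: "y1 \<in> S" "dist y1 q' < norm q' / 2"
    using q' unfolding closure_approachable by (metis half_gt_zero zero_less_norm_iff)
  obtain y0 where y0: "y0 \<in> - S" "\<And>y. y \<in> - S \<Longrightarrow> dist y1 y0 \<le> dist y1 y"
    using distance_attains_inf[of "- S" y1] S(1) q'(3) by auto
  define r where "r = dist y1 y0"
  have r: "r > 0" using y0(1) y1(1) by (auto simp: r_def)
  have ball: "ball y1 r \<subseteq> S" using y0(2) by (force simp: r_def)
  have "y0 \<in> closure (ball y1 r)" using r by (simp add: r_def)
  then have "y0 \<in> closure S" using closure_mono[OF ball] by blast
  moreover have "y0 \<noteq> 0"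
  proof
    assume "y0 = 0"
    then have "norm y1 \<le> dist y1 q'" using y0(2)[of q'] q'(3) by simp
    moreover have "norm q' \<le> norm y1 + dist y1 q'"
      using norm_triangle_ineq4[of y1 "y1 - q'"] by (simp add: dist_norm)
    ultimately show False using y1(2) by simp
  qed
  ultimately show ?thesis using y0(1) r ball r_def by blast
qed

text \<open>At a minimum \<open>y\<close> of \<open>L\<close> on the unit sphere, with value \<open>m > 0\<close>, homogeneity gives \<open>L x \<ge> m |x|\<^sup>2\<close> with equality
  at \<open>y\<close>. So the Hessian of \<open>L\<close> at \<open>y\<close> is at least that of \<open>m |x|\<^sup>2\<close>.\<close>

lemma positive_function_hessian_definite_somewhere:
  fixes L :: "real^'n::finite \<Rightarrow> real"
  assumes L: "smooth_on (- {0}) L" and hom: "\<And>y t. y \<noteq> 0 \<Longrightarrow> t > 0 \<Longrightarrow> L (t *\<^sub>R y) = t\<^sup>2 * L y"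
    and pos: "\<And>y. y \<noteq> 0 \<Longrightarrow> L y > 0"
  shows "\<exists>y. y \<noteq> 0 \<and> (\<forall>v. v \<noteq> 0 \<longrightarrow> 0 < (\<Sum>i\<in>UNIV. \<Sum>j\<in>UNIV. v $ i * v $ j * pd j (pd i L) y))"
proof -
  have "compact (sphere (0 :: real^'n) 1)" "sphere (0 :: real^'n) 1 \<noteq> {}"
    by auto
  moreover have "continuous_on (sphere 0 1) L"
    by (rule continuous_on_subset[OF smooth_on_imp_continuous_on[OF L]]) auto
  ultimately obtain y where y: "norm y = 1" "\<And>x. norm x = 1 \<Longrightarrow> L y \<le> L x"
    using continuous_attains_inf[of "sphere 0 1" L] by auto
  have y0: "y \<noteq> 0" using y(1) by auto
  define m where "m = L y"
  have m: "m > 0" using pos y0 by (simp add: m_def)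
  have lower: "m * (x \<bullet> x) \<le> L x" if x: "x \<noteq> 0" for x
  proof -
    have "L x = L (norm x *\<^sub>R (x /\<^sub>R norm x))" using x by simp
    also have "\<dots> = (norm x)\<^sup>2 * L (x /\<^sub>R norm x)" using x by (intro hom) auto
    also have "\<dots> \<ge> (norm x)\<^sup>2 * m" unfolding m_def using x by (intro mult_left_mono y(2)) auto
    finally show ?thesis by (simp add: power2_norm_eq_inner mult.commute)
  qed
  have "0 < (\<Sum>i\<in>UNIV. \<Sum>j\<in>UNIV. v $ i * v $ j * pd j (pd i L) y)" if v: "v \<noteq> 0" for v
  proof -
    define D where "D x = frechet_derivative L (at x) v" for x
    define u where "u t = L (y + t *\<^sub>R v) - m * ((y + t *\<^sub>R v) \<bullet> (y + t *\<^sub>R v))" for t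
    define q where "q t = D (y + t *\<^sub>R v) - 2 * m * (y \<bullet> v + t * (v \<bullet> v))" for t
    define Q where "Q = frechet_derivative D (at y) v"
    define \<delta> where "\<delta> = 1 / norm v"
    have \<delta>: "\<delta> > 0" using v by (simp add: \<delta>_def)
    have nz: "y + t *\<^sub>R v \<noteq> 0" if "\<bar>t\<bar> < \<delta>" for t
    proof
      assume "y + t *\<^sub>R v = 0"
      then have "norm y = norm (t *\<^sub>R v)" by (metis add_eq_0_iff norm_minus_cancel)
      then show False using that v y(1) by (simp add: \<delta>_def pos_less_divide_eq)
    qed
    have u0: "u 0 = 0" using y(1) by (simp add: u_def m_def norm_eq_sqrt_inner)
    have upos: "0 \<le> u t" if "\<bar>t\<bar> < \<delta>" for t
      using lower[OF nz[OF that]] by (simp add: u_def)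
    have du: "(u has_real_derivative q t) (at t)" if t: "\<bar>t\<bar> < \<delta>" for t
    proof -
      have "((\<lambda>t. L (y + t *\<^sub>R v)) has_real_derivative D (y + t *\<^sub>R v)) (at t)"
        unfolding D_def using nz[OF t]
        by (intro has_field_derivative_along_line smooth_on_imp_differentiable[OF L]) auto
      moreover have "((\<lambda>t. (y + t *\<^sub>R v) \<bullet> (y + t *\<^sub>R v)) has_real_derivative 2 * (y \<bullet> v + t * (v \<bullet> v))) (at t)"
        by (auto simp: inner_add_left inner_add_right inner_commute[of v y] algebra_simps
            intro!: derivative_eq_intros)
      ultimately have "((\<lambda>t. L (y + t *\<^sub>R v) - m * ((y + t *\<^sub>R v) \<bullet> (y + t *\<^sub>R v))) has_real_derivative
          D (y + t *\<^sub>R v) - m * (2 * (y \<bullet> v + t * (v \<bullet> v)))) (at t)"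
        by (intro DERIV_diff DERIV_cmult)
      moreover have "m * (2 * (y \<bullet> v + t * (v \<bullet> v))) = 2 * m * (y \<bullet> v + t * (v \<bullet> v))" by simp
      ultimately show ?thesis unfolding u_def[abs_def] q_def by metis
    qed
    have dq: "(q has_real_derivative Q - 2 * m * (v \<bullet> v)) (at 0)"
    proof -
      have "smooth_on (- {0}) D" unfolding D_def by (rule smooth_on_frechet_derivative[OF L])
      then have "D differentiable (at (y + 0 *\<^sub>R v))"
        using smooth_on_imp_differentiable y0 by auto
      from has_field_derivative_along_line[OF this]
      have "((\<lambda>t. D (y + t *\<^sub>R v)) has_real_derivative Q) (at 0)" by (simp add: Q_def)
      then show ?thesis unfolding q_def[abs_def] by (auto intro!: derivative_eq_intros)
    qed
    have q0: "q 0 = 0"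
      using DERIV_local_min[OF du \<delta>, of 0] \<delta> upos u0 by auto
    have "Q - 2 * m * (v \<bullet> v) \<ge> 0"
    proof (rule ccontr)
      assume "\<not> ?thesis"
      then have "Q - 2 * m * (v \<bullet> v) < 0" by simp
      from DERIV_neg_dec_right[OF dq this] obtain d where
        d: "d > 0" "\<And>h. 0 < h \<Longrightarrow> h < d \<Longrightarrow> q h < 0"
        using q0 by auto
      define h where "h = min d \<delta> / 2"
      have h: "0 < h" "h < d" "h < \<delta>" using d(1) \<delta> by (auto simp: h_def min_def)
      obtain s where s: "0 < s" "s < h" "u h - u 0 = (h - 0) * q s"
        using MVT2[of 0 h u q] du h by auto
      have "u h < 0" using s d(2)[of s] h u0 by (simp add: mult_pos_neg)
      then show False using upos[of h] h by simp
    qed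
    moreover have "2 * m * (v \<bullet> v) > 0" using m v by simp
    ultimately have "Q > 0" by linarith
    then show ?thesis
      unfolding Q_def D_def[abs_def] using second_derivative_eq_sum_pd[OF _ _ L, of y v] y0 by (simp add: open_Compl)
  qed
  then show ?thesis using y0 by blast
qed

section \<open>Induced charts of the tangent bundle\<close>

locale atlas =
  fixes X :: "'m topology" and \<A> :: "('m, 'n::finite) chart set"
  assumes atlas: "smooth_atlas X \<A>"
begin

lemma chart_open: "c \<in> \<A> \<Longrightarrow> openin X (fst c)"
  and chart_image_open: "c \<in> \<A> \<Longrightarrow> open (snd c ` fst c)"
  and chart_homeomorphic: "c \<in> \<A> \<Longrightarrow>
    homeomorphic_map (subtopology X (fst c)) (top_of_set (snd c ` fst c)) (snd c)"
  and transition_smooth: "c \<in> \<A> \<Longrightarrow> d \<in> \<A> \<Longrightarrow> smooth_on (snd c ` (fst c \<inter> fst d)) (transition c d)"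
  using atlas unfolding smooth_atlas_def by auto

lemma chart_inj:
  assumes "c \<in> \<A>" shows "inj_on (snd c) (fst c)"
proof -
  have "topspace (subtopology X (fst c)) = fst c"
    using openin_subset[OF chart_open[OF assms]] by (simp add: topspace_subtopology inf.absorb2)
  then show ?thesis
    using homeomorphic_imp_injective_map[OF chart_homeomorphic[OF assms]] by simp
qed

lemma overlap_open:
  assumes "c \<in> \<A>" "d \<in> \<A>" shows "open (snd c ` (fst c \<inter> fst d))"
proof -
  have "openin (subtopology X (fst c)) (fst c \<inter> fst d)"
    using chart_open[OF assms(2)] by (metis inf_commute openin_subtopology)
  then have "openin (top_of_set (snd c ` fst c)) (snd c ` (fst c \<inter> fst d))"
    using homeomorphic_imp_open_map[OF chart_homeomorphic[OF assms(1)]] unfolding open_map_def by blast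
  then show ?thesis
    using chart_image_open[OF assms(1)] openin_open_trans by blast
qed

lemma transition_apply: "c \<in> \<A> \<Longrightarrow> p \<in> fst c \<Longrightarrow> transition c d (snd c p) = snd d p"
  unfolding transition_def using chart_inj by simp

abbreviation Dtrans :: "('m, 'n) chart \<Rightarrow> ('m, 'n) chart \<Rightarrow> 'm \<Rightarrow> real^'n \<Rightarrow> real^'n" where
  "Dtrans c d p \<equiv> frechet_derivative (transition c d) (at (snd c p))"

lemma transition_differentiable:
  "c \<in> \<A> \<Longrightarrow> d \<in> \<A> \<Longrightarrow> p \<in> fst c \<inter> fst d \<Longrightarrow> transition c d differentiable (at (snd c p))"
  using smooth_on_imp_differentiable[OF transition_smooth, of c d "snd c p"] by blast

lemma transition_linear:
  "c \<in> \<A> \<Longrightarrow> d \<in> \<A> \<Longrightarrow> p \<in> fst c \<inter> fst d \<Longrightarrow> linear (Dtrans c d p)"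
  by (intro linear_frechet_derivative transition_differentiable)

lemma transition_id:
  assumes "c \<in> \<A>" "p \<in> fst c" shows "Dtrans c c p v = v"
proof -
  have "Dtrans c c p = frechet_derivative (\<lambda>x. x) (at (snd c p))"
    by (rule frechet_derivative_cong_open[OF chart_image_open[OF assms(1)]])
      (use assms transition_apply[OF assms(1), where d = c] in auto)
  then show ?thesis by (simp add: frechet_derivative_ident)
qed

text \<open>The chain rule for transition maps. It is what makes \<open>tvec_of\<close> satisfy the compatibility conditions of a tangent vector.\<close>

lemma transition_chain:
  assumes c: "c \<in> \<A>" "d \<in> \<A>" "e \<in> \<A>" and p: "p \<in> fst c" "p \<in> fst d" "p \<in> fst e"
  shows "Dtrans d e p (Dtrans c d p v) = Dtrans c e p v"
proof -
  let ?O = "snd c ` (fst c \<inter> fst d) \<inter> snd c ` (fst c \<inter> fst e)"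
  have "open ?O" using overlap_open c by blast
  moreover have "snd c p \<in> ?O" using p by blast
  moreover have "transition c e x = (transition d e \<circ> transition c d) x" if x: "x \<in> ?O" for x
  proof -
    obtain q where q: "x = snd c q" "q \<in> fst c" "q \<in> fst d"
      using x by auto
    obtain r where r: "x = snd c r" "r \<in> fst c" "r \<in> fst e"
      using x by auto
    have "q = r" using inj_onD[OF chart_inj[OF c(1)], of q r] q r by simp
    with q r show ?thesis using c by (simp add: transition_apply)
  qed
  ultimately have "Dtrans c e p = frechet_derivative (transition d e \<circ> transition c d) (at (snd c p))"
    by (rule frechet_derivative_cong_open)
  also have "\<dots> = frechet_derivative (transition d e) (at (transition c d (snd c p))) \<circ> Dtrans c d p"
    using transition_differentiable c p
    by (intro frechet_derivative_compose) (auto simp: transition_apply)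
  finally show ?thesis using c p by (simp add: transition_apply)
qed

text \<open>The tangent vector at \<open>p\<close> with components \<open>y\<close> in the chart \<open>c\<close>: the inverse of the induced chart on the fibre.\<close>

definition tvec_of :: "('m, 'n) chart \<Rightarrow> 'm \<Rightarrow> real^'n \<Rightarrow> ('m, 'n) tvec" where
  "tvec_of c p y = (p, \<lambda>d. if d \<in> \<A> \<and> p \<in> fst d then Dtrans c d p y else 0)"

lemma tvec_of_tdom: "c \<in> \<A> \<Longrightarrow> p \<in> fst c \<Longrightarrow> tvec_of c p y \<in> tdom \<A> c"
  unfolding tdom_def tangent_bundle_def tvec_of_def
  by (auto simp: transition_chain split_paired_all simp del: split_paired_Ex)

lemma tchart_tvec_of: "c \<in> \<A> \<Longrightarrow> p \<in> fst c \<Longrightarrow> tchart c (tvec_of c p y) = (snd c p, y)"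
  by (simp add: tchart_def tvec_of_def transition_id)

lemma fst_tvec_of: "fst (tvec_of c p y) = p"
  by (simp add: tvec_of_def)

lemma snd_tvec_of: "c \<in> \<A> \<Longrightarrow> p \<in> fst c \<Longrightarrow> snd (tvec_of c p y) c = y"
  by (simp add: tvec_of_def transition_id)

lemma tangent_bundle_components:
  assumes "w \<in> tangent_bundle \<A>"
  shows "c \<in> \<A> \<Longrightarrow> d \<in> \<A> \<Longrightarrow> fst w \<in> fst c \<inter> fst d \<Longrightarrow> snd w d = Dtrans c d (fst w) (snd w c)"
    and "d \<notin> \<A> \<or> fst w \<notin> fst d \<Longrightarrow> snd w d = 0"
proof -
  obtain p v where w: "w = (p, v)" by (rule prod.exhaust)
  have "(\<forall>c\<in>\<A>. \<forall>d\<in>\<A>. p \<in> fst c \<inter> fst d \<longrightarrow> v d = Dtrans c d p (v c)) \<and>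
      (\<forall>c. c \<notin> \<A> \<or> p \<notin> fst c \<longrightarrow> v c = 0)"
    using assms unfolding tangent_bundle_def w mem_Collect_eq prod.case by (elim conjE) (intro conjI)
  then show "c \<in> \<A> \<Longrightarrow> d \<in> \<A> \<Longrightarrow> fst w \<in> fst c \<inter> fst d \<Longrightarrow> snd w d = Dtrans c d (fst w) (snd w c)"
    and "d \<notin> \<A> \<or> fst w \<notin> fst d \<Longrightarrow> snd w d = 0"
    unfolding w fst_conv snd_conv by blast+
qed

lemma tvec_of_unique:
  assumes c: "c \<in> \<A>" and w: "w \<in> tdom \<A> c"
  shows "w = tvec_of c (fst w) (snd w c)"
proof (rule prod_eqI)
  have w': "w \<in> tangent_bundle \<A>" "fst w \<in> fst c" using w unfolding tdom_def by blast+
  show "snd w = snd (tvec_of c (fst w) (snd w c))"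
  proof (rule ext)
    fix d
    show "snd w d = snd (tvec_of c (fst w) (snd w c)) d"
      unfolding tvec_of_def snd_conv
      using tangent_bundle_components(1)[OF w'(1) c, of d] tangent_bundle_components(2)[OF w'(1), of d] w'(2)
      by (cases "d \<in> \<A> \<and> fst w \<in> fst d") (simp_all only: Int_iff simp_thms if_True if_False, blast)
  qed
qed (simp add: fst_tvec_of)

lemma tchart_inj: 
  assumes "c \<in> \<A>" shows "inj_on (tchart c) (tdom \<A> c)"
proof (rule inj_onI)
  fix w w' assume w: "w \<in> tdom \<A> c" "w' \<in> tdom \<A> c" "tchart c w = tchart c w'"
  then have "fst w = fst w'"
    using chart_inj[OF assms] by (auto simp: tdom_def tchart_def inj_on_def)
  then show "w = w'"
    using w tvec_of_unique[OF assms, of w] tvec_of_unique[OF assms, of w'] by (simp add: tchart_def)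
qed

lemma coord_fun_tchart: "c \<in> \<A> \<Longrightarrow> w \<in> tdom \<A> c \<Longrightarrow> coord_fun \<A> c f (tchart c w) = f w"
  unfolding coord_fun_def using tchart_inj by simp

lemma coord_set_iff:
  assumes "c \<in> \<A>" "p \<in> fst c"
  shows "(snd c p, y) \<in> coord_set \<A> c B \<longleftrightarrow> tvec_of c p y \<in> B"
proof
  assume "(snd c p, y) \<in> coord_set \<A> c B"
  then obtain w where w: "w \<in> B" "w \<in> tdom \<A> c" "tchart c w = tchart c (tvec_of c p y)"
    unfolding coord_set_def by (auto simp: tchart_tvec_of[OF assms])
  then have "w = tvec_of c p y"
    using tchart_inj[OF assms(1)] tvec_of_tdom[OF assms, of y] unfolding inj_on_def by blast
  with w show "tvec_of c p y \<in> B" by simp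
next
  assume "tvec_of c p y \<in> B"
  then show "(snd c p, y) \<in> coord_set \<A> c B"
    unfolding coord_set_def using tvec_of_tdom[OF assms] tchart_tvec_of[OF assms, symmetric] by blast
qed

lemma coord_setE:
  assumes "z \<in> coord_set \<A> c B"
  obtains p y where "p \<in> fst c" "z = (snd c p, y)"
  using assms unfolding coord_set_def tdom_def tchart_def by auto

lemma change_of_coordinates_continuous:
  assumes "c \<in> \<A>" "d \<in> \<A>"
  shows "continuous_on (snd c ` (fst c \<inter> fst d) \<times> UNIV)
    (\<lambda>(x, y). (transition c d x, frechet_derivative (transition c d) (at x) y))"
proof -
  let ?O = "snd c ` (fst c \<inter> fst d)"
  note sm = transition_smooth[OF assms]
  have "continuous_on (?O \<times> UNIV) (\<lambda>z. (transition c d (fst z),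
      \<Sum>i\<in>UNIV. snd z $ i *\<^sub>R frechet_derivative (transition c d) (at (fst z)) (axis i 1)))"
    by (intro continuous_intros continuous_on_sum
        continuous_on_compose2[OF smooth_on_imp_continuous_on[OF sm]]
        continuous_on_compose2[OF smooth_on_imp_continuous_on[OF smooth_on_frechet_derivative[OF sm]]]) auto
  then show ?thesis
    by (rule continuous_on_eq)
      (auto simp: frechet_derivative_eq_sum_axis[OF smooth_on_imp_differentiable[OF sm], of "snd c _"])
qed

text \<open>The tangent topology is generated by sets that are open in some induced chart; the claim passes from these to all
  open sets by induction, since changes of induced charts are continuous.\<close>

lemma open_coord_set:
  assumes B: "openin (tangent_topology \<A>) B" and c: "c \<in> \<A>"
  shows "open (coord_set \<A> c B)"
proof -
  have "generate_topology_on {tdom \<A> c \<inter> tchart c -` W | c W. c \<in> \<A> \<and> open W} B"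
    using B unfolding tangent_topology_def by (rule openin_topology_generated_by)
  then show ?thesis
  proof (induction rule: generate_topology_on.induct)
    case Empty
    then show ?case by (simp add: coord_set_def)
  next
    case (Int a b)
    have "coord_set \<A> c (a \<inter> b) = coord_set \<A> c a \<inter> coord_set \<A> c b"
      unfolding coord_set_def
      by (subst inj_on_image_Int[OF tchart_inj[OF c], symmetric]) (auto intro: arg_cong[where f = "\<lambda>s. tchart c ` s"])
    then show ?case using Int by auto
  next
    case (UN K)
    have "coord_set \<A> c (\<Union>K) = (\<Union>k\<in>K. coord_set \<A> c k)"
      unfolding coord_set_def by blast
    then show ?case using UN by auto
  next
    case (Basis s)
    then obtain d W where d: "s = tdom \<A> d \<inter> tchart d -` W" "d \<in> \<A>" "open W" by blast
    let ?O = "snd c ` (fst c \<inter> fst d) \<times> (UNIV :: (real^'n) set)"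
    let ?T = "\<lambda>(x, y). (transition c d x, frechet_derivative (transition c d) (at x) y)"
    have "(x, y) \<in> coord_set \<A> c s \<longleftrightarrow> (x, y) \<in> ?O \<inter> ?T -` W" for x y
    proof (cases "x \<in> snd c ` fst c")
      case True
      then obtain p where p: "p \<in> fst c" "x = snd c p" by blast
      have "x \<in> snd c ` (fst c \<inter> fst d) \<longleftrightarrow> p \<in> fst d"
        using p chart_inj[OF c] by (auto simp: inj_on_def)
      moreover have "tvec_of c p y \<in> s \<longleftrightarrow> p \<in> fst d \<and> (snd d p, Dtrans c d p y) \<in> W"
        using tvec_of_tdom[OF c p(1), of y] d(2) unfolding d(1) by (auto simp: tdom_def tchart_def tvec_of_def)
      ultimately show ?thesis
        using coord_set_iff[OF c p(1), of y s] p c by (auto simp: transition_apply)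
    next
      case False
      then show ?thesis by (auto simp: coord_set_def tdom_def tchart_def)
    qed
    then have "coord_set \<A> c s = ?O \<inter> ?T -` W" by auto
    moreover have "open (?O \<inter> ?T -` W)"
      by (intro continuous_open_preimage change_of_coordinates_continuous open_Times overlap_open c d open_UNIV)
    ultimately show ?case by simp
  qed
qed

lemma openin_tdom_vimage:
  assumes "c \<in> \<A>" "open W"
  shows "openin (tangent_topology \<A>) (tdom \<A> c \<inter> tchart c -` W)"
  unfolding tangent_topology_def by (rule topology_generated_by_Basis) (use assms in blast)

lemma tdom_topspace: "c \<in> \<A> \<Longrightarrow> tdom \<A> c \<subseteq> topspace (tangent_topology \<A>)"
  using openin_subset[OF openin_tdom_vimage[of c UNIV]] by simp

lemma open_fibre_set:
  assumes "openin (tangent_topology \<A>) B" "c \<in> \<A>" "p \<in> fst c"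
  shows "open {y. tvec_of c p y \<in> B}"
proof -
  have "open ((\<lambda>y. (snd c p, y)) -` coord_set \<A> c B)"
    using open_coord_set[OF assms(1,2)] by (intro open_vimage continuous_intros)
  then show ?thesis
    using coord_set_iff[OF assms(2,3)] by (simp add: vimage_def)
qed

lemma fibre_image:
  assumes "B \<subseteq> tangent_bundle \<A>" "c \<in> \<A>" "p \<in> fst c"
  shows "(\<lambda>w. snd w c) ` fibre B p = {y. tvec_of c p y \<in> B}"
proof (intro set_eqI iffI)
  fix y assume "y \<in> (\<lambda>w. snd w c) ` fibre B p"
  then obtain w where w: "w \<in> B" "fst w = p" "y = snd w c" unfolding fibre_def by blast
  then have "w = tvec_of c p y"
    using tvec_of_unique[OF assms(2), of w] assms by (auto simp: tdom_def)
  with w(1) show "y \<in> {y. tvec_of c p y \<in> B}" by simp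
next
  fix y assume "y \<in> {y. tvec_of c p y \<in> B}"
  then show "y \<in> (\<lambda>w. snd w c) ` fibre B p"
    unfolding fibre_def using snd_tvec_of[OF assms(2,3)] fst_tvec_of
    by (intro image_eqI[of _ _ "tvec_of c p y"]) auto
qed

lemma connected_fibre_set:
  assumes con: "connectedin (tangent_topology \<A>) (fibre B p)"
    and B: "B \<subseteq> tangent_bundle \<A>" and c: "c \<in> \<A>" "p \<in> fst c"
  shows "connected {y. tvec_of c p y \<in> B}"
proof -
  let ?T = "subtopology (tangent_topology \<A>) (tdom \<A> c)"
  have top: "topspace ?T = tdom \<A> c"
    using tdom_topspace[OF c(1)] by (auto simp: topspace_subtopology)
  have "continuous_map ?T euclidean (\<lambda>w. snd w c)"
    unfolding continuous_map_def
  proof (intro conjI allI impI)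
    fix V :: "(real^'n) set" assume "openin euclidean V"
    then have "open V" by simp
    then have "openin (tangent_topology \<A>) (tdom \<A> c \<inter> tchart c -` (UNIV \<times> V))"
      by (intro openin_tdom_vimage c open_Times) auto
    then show "openin ?T {w \<in> topspace ?T. snd w c \<in> V}"
      unfolding top openin_subtopology by (intro exI[of _ "tdom \<A> c \<inter> tchart c -` (UNIV \<times> V)"]) (auto simp: tchart_def)
  qed auto
  moreover have "connectedin ?T (fibre B p)"
    using con B c(2) by (auto simp: connectedin_subtopology fibre_def tdom_def)
  ultimately have "connectedin euclidean ((\<lambda>w. snd w c) ` fibre B p)"
    by (rule connectedin_continuous_map_image)
  then show ?thesis using fibre_image[OF B c] by simp
qed

lemma tvec_of_slit:
  assumes "c \<in> \<A>" "p \<in> fst c"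
  shows "tvec_of c p y \<in> slit_tangent_bundle \<A> \<longleftrightarrow> y \<noteq> 0"
proof
  assume "tvec_of c p y \<in> slit_tangent_bundle \<A>"
  then have "snd (tvec_of c p y) \<noteq> (\<lambda>c. 0)" by (simp add: slit_tangent_bundle_def)
  moreover have "snd (tvec_of c p 0) = (\<lambda>c. 0)"
    using assms by (auto simp: tvec_of_def linear_0[OF transition_linear])
  ultimately show "y \<noteq> 0" by auto
next
  assume "y \<noteq> 0"
  then show "tvec_of c p y \<in> slit_tangent_bundle \<A>"
    using tvec_of_tdom[OF assms, of y] snd_tvec_of[OF assms, of y]
    by (auto simp: slit_tangent_bundle_def tdom_def)
qed

lemma tvec_of_scale:
  assumes "c \<in> \<A>" "p \<in> fst c"
  shows "tvec_of c p (t *\<^sub>R y) = scale_tvec t (tvec_of c p y)"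
  using assms by (auto simp: tvec_of_def scale_tvec_def linear_scale[OF transition_linear])

text \<open>Closures within a tangent space in coordinates give points in both closures, the one in
  the fibre and the one in the whole slit tangent bundle.\<close>

lemma closure_fibre_set:
  assumes B: "B \<subseteq> slit_tangent_bundle \<A>" and c: "c \<in> \<A>" "p \<in> fst c"
    and y: "y \<in> closure {y. tvec_of c p y \<in> B}" "y \<noteq> 0"
  shows "tvec_of c p y \<in> fibre_closure \<A> B p" "tvec_of c p y \<in> slit_closure \<A> B"
proof -
  let ?w = "tvec_of c p y"
  have meets: "\<exists>y'. tvec_of c p y' \<in> B \<and> tvec_of c p y' \<in> U"
    if "openin (tangent_topology \<A>) U" "?w \<in> U" for U
  proof -
    have "{y. tvec_of c p y \<in> U} \<inter> closure {y. tvec_of c p y \<in> B} \<noteq> {}"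
      using that(2) y(1) by blast
    then show ?thesis
      unfolding open_Int_closure_eq_empty[OF open_fibre_set[OF that(1) c]] by blast
  qed
  have w: "?w \<in> slit_tangent_bundle \<A>" "?w \<in> topspace (tangent_topology \<A>)" "fst ?w = p"
    using tvec_of_slit[OF c] y(2) tdom_topspace[OF c(1)] tvec_of_tdom[OF c] fst_tvec_of by auto
  show "?w \<in> fibre_closure \<A> B p"
    unfolding fibre_closure_def in_closure_of
  proof (intro conjI allI impI)
    show "?w \<in> topspace (subtopology (tangent_topology \<A>) (fibre (slit_tangent_bundle \<A>) p))"
      using w by (simp add: topspace_subtopology fibre_def)
    fix T assume "?w \<in> T \<and> openin (subtopology (tangent_topology \<A>) (fibre (slit_tangent_bundle \<A>) p)) T"
    then obtain U where U: "openin (tangent_topology \<A>) U" "T = U \<inter> fibre (slit_tangent_bundle \<A>) p" "?w \<in> U"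
      unfolding openin_subtopology by blast
    then obtain y' where "tvec_of c p y' \<in> B" "tvec_of c p y' \<in> U" using meets by blast
    then show "\<exists>w. w \<in> fibre B p \<and> w \<in> T"
      using B U(2) by (intro exI[of _ "tvec_of c p y'"]) (auto simp: fibre_def fst_tvec_of)
  qed
  show "?w \<in> slit_closure \<A> B"
    unfolding slit_closure_def in_closure_of
  proof (intro conjI allI impI)
    show "?w \<in> topspace (subtopology (tangent_topology \<A>) (slit_tangent_bundle \<A>))"
      using w by (simp add: topspace_subtopology)
    fix T assume "?w \<in> T \<and> openin (subtopology (tangent_topology \<A>) (slit_tangent_bundle \<A>)) T"
    then obtain U where U: "openin (tangent_topology \<A>) U" "T = U \<inter> slit_tangent_bundle \<A>" "?w \<in> U"
      unfolding openin_subtopology by blast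
    then obtain y' where "tvec_of c p y' \<in> B" "tvec_of c p y' \<in> U" using meets by blast
    then show "\<exists>w. w \<in> B \<and> w \<in> T"
      using B U(2) by blast
  qed
qed

end

section \<open>Uniqueness\<close>

text \<open>The expression in braces in the affine equation.\<close>

definition affine_covector ::
    "((real^'n::finite) \<times> (real^'n) \<Rightarrow> real) \<Rightarrow> ('n \<Rightarrow> 'n \<Rightarrow> (real^'n) \<times> (real^'n) \<Rightarrow> real) \<Rightarrow>
     'n \<Rightarrow> (real^'n) \<times> (real^'n) \<Rightarrow> real" where
  "affine_covector F J b z = 2 * mean_landsberg F b z
         + (real CARD('n) + 2) * (\<Sum>a\<in>UNIV. y_low F a z / F z * J b a z)
         - 2 * (\<Sum>a\<in>UNIV. mean_cartan F a z * J b a z)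
         - (\<Sum>a\<in>UNIV. pdy a (J b a) z + pdy b (J a a) z)"

lemma affine_covector_cong:
  assumes W: "open W" "z \<in> W" and eq: "\<And>i k z. z \<in> W \<Longrightarrow> J i k z = J' i k z"
  shows "affine_covector F J b z = affine_covector F J' b z"
  unfolding affine_covector_def
  using eq[OF W(2)] pdy_cong[OF W, of "J _ _" "J' _ _"] eq by simp

text \<open>When \<open>J\<close> has symmetric derivatives, the equation reads \<open>B\<^sub>i y\<^sup>j = (B\<^sub>b y\<^sup>b) \<delta>\<^sub>i\<^sup>j\<close> for the covector \<open>B\<close>. Its trace
  gives \<open>B\<^sub>b y\<^sup>b = n B\<^sub>b y\<^sup>b\<close>, so both sides vanish.\<close>

lemma affine_covector_zero:
  fixes F :: "(real^'n::finite) \<times> (real^'n) \<Rightarrow> real"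
  assumes eq: "\<And>i j. affine_lhs F J i j z = 0"
    and sym: "\<And>a i j. pdy a (J i j) z = pdy i (J a j) z"
    and z: "snd z \<noteq> 0" and n: "2 \<le> CARD('n)"
  shows "affine_covector F J b z = 0"
proof -
  define B where "B b = affine_covector F J b z" for b
  define s where "s = (\<Sum>b\<in>UNIV. B b * snd z $ b)"
  have main: "B i * snd z $ j = s * kron j i" for i j
  proof -
    have "0 = (\<Sum>b\<in>UNIV. B b * (kron b i * snd z $ j - snd z $ b * kron j i))"
      using eq[of i j] sym unfolding affine_lhs_def B_def affine_covector_def by simp
    also have "\<dots> = (\<Sum>b\<in>UNIV. (if b = i then B b * snd z $ j else 0)) - s * kron j i"
      unfolding s_def sum_distrib_right sum_subtractf[symmetric]
      by (intro sum.cong) (auto simp: kron_def algebra_simps)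
    finally show ?thesis by simp
  qed
  have "s = (\<Sum>i\<in>(UNIV :: 'n set). s * kron i i)"
    unfolding main[symmetric] by (rule s_def)
  also have "\<dots> = (\<Sum>i\<in>(UNIV :: 'n set). s)" by (simp add: kron_def)
  finally have "s = (\<Sum>i\<in>(UNIV :: 'n set). s)" .
  then have "s = real CARD('n) * s" by simp
  then have "s = 0" using n by auto
  obtain j where "snd z $ j \<noteq> 0" using z by (auto simp: vec_eq_iff)
  then show ?thesis using main[of b j] \<open>s = 0\<close> by (simp add: B_def)
qed

context atlas
begin

text \<open>On a single tangent space, the components in a chart turn the two solutions into a solution of the linear equation
  on the open cone \<open>S\<close>. It is flat at a touching boundary point and analytic there.\<close>

lemma fibre_uniqueness:
  assumes n: "3 \<le> CARD('n)" and A: "conic_domain \<A> A" and L: "proper_pseudo_finsler \<A> A L"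
    and nd: "nondefinite_signature \<A> A L" and c: "c \<in> \<A>" "p \<in> fst c"
    and Z: "hom_tensor10 2 \<A> A Z" "fiberwise_analytic10 \<A> A (\<lambda>c k z. - 2 * Z c k z)"
    and Z': "hom_tensor10 2 \<A> A Z'" "fiberwise_analytic10 \<A> A (\<lambda>c k z. - 2 * Z' c k z)"
    and eqZ: "\<And>z b. z \<in> coord_set \<A> c A \<Longrightarrow> affine_covector (coord_fun \<A> c L) (vertical_derivative Z c) b z = 0"
    and eqZ': "\<And>z b. z \<in> coord_set \<A> c A \<Longrightarrow> affine_covector (coord_fun \<A> c L) (vertical_derivative Z' c) b z = 0"
    and y: "tvec_of c p y \<in> A"
  shows "Z c k (snd c p, y) = Z' c k (snd c p, y)"
proof -
  define a0 where "a0 = snd c p"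
  define S where "S = {y. tvec_of c p y \<in> A}"
  define Om where "Om = coord_set \<A> c A"
  define F where "F = coord_fun \<A> c L"
  define l where "l y = F (a0, y)" for y

  have A_slit: "A \<subseteq> slit_tangent_bundle \<A>" and A_open: "openin (tangent_topology \<A>) A"
    and A_scale: "\<And>w t. w \<in> A \<Longrightarrow> t > 0 \<Longrightarrow> scale_tvec t w \<in> A"
    using A unfolding conic_domain_def by blast+
  have A_bundle: "A \<subseteq> tangent_bundle \<A>" using A_slit unfolding slit_tangent_bundle_def by blast
  have Om: "open Om" unfolding Om_def by (rule open_coord_set[OF A_open c(1)])
  have Om_iff: "(a0, y) \<in> Om \<longleftrightarrow> y \<in> S" for y
    unfolding Om_def a0_def S_def using coord_set_iff[OF c] by simp
  have S_open: "open S" unfolding S_def by (rule open_fibre_set[OF A_open c])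
  have S_cone: "t *\<^sub>R y \<in> S" if "y \<in> S" "t > 0" for y t
    using that A_scale by (simp add: S_def tvec_of_scale[OF c])
  have S0: "0 \<notin> S" using A_slit tvec_of_slit[OF c, of 0] by (auto simp: S_def)
  have S_conn: "connected S"
    unfolding S_def using L c A_bundle
    by (intro connected_fibre_set) (auto simp: proper_pseudo_finsler_def)
  have yS: "y \<in> S" using y by (simp add: S_def)

  have pf: "pseudo_finsler \<A> A L" and L_pos: "\<And>w. w \<in> A \<Longrightarrow> L w > 0"
    using L unfolding proper_pseudo_finsler_def by blast+
  have F_smooth: "smooth_on Om F" and F_inv: "\<And>z. z \<in> Om \<Longrightarrow> invertible (fund_tensor F z)"
    and L_hom: "\<And>w t. w \<in> A \<Longrightarrow> t > 0 \<Longrightarrow> L (scale_tvec t w) = t\<^sup>2 * L w"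
    using pf c(1) unfolding pseudo_finsler_def smooth_function_def Om_def F_def by blast+
  have l_eq: "l y = L (tvec_of c p y)" for y
    using coord_fun_tchart[OF c(1) tvec_of_tdom[OF c], of L y]
    by (simp add: l_def F_def a0_def tchart_tvec_of[OF c])
  have l_pos: "l y > 0" if "y \<in> S" for y
    using that L_pos by (simp add: l_eq S_def)
  have l_hom: "l (t *\<^sub>R y) = t\<^sup>2 * l y" if "y \<in> S" "t > 0" for y t
    using that L_hom by (simp add: l_eq S_def tvec_of_scale[OF c])
  have slice_Om: "{y. (a0, y) \<in> Om} = S" by (simp add: Om_iff)
  have l_smooth: "smooth_on S l"
    using smooth_on_slice[OF Om F_smooth, of a0] unfolding slice_Om l_def[abs_def] .
  have G: "fund_tensor F (a0, y) $ i $ j = 1/2 * pd j (pd i l) y" if "y \<in> S" for y i j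
    using pdy_pdy_slice[OF Om F_smooth, of a0 y j i] that by (simp add: fund_tensor_def Om_iff l_def[abs_def])

  \<comment> \<open>Here the signature enters: the whole punctured tangent space would carry a definite \<open>g\<close> somewhere.\<close>
  have S_ne: "S \<noteq> - {0}"
  proof
    assume S_eq: "S = - {0}"
    obtain x where x: "x \<noteq> 0"
      and pos: "\<And>v. v \<noteq> 0 \<Longrightarrow> 0 < (\<Sum>i\<in>UNIV. \<Sum>j\<in>UNIV. v $ i * v $ j * pd j (pd i l) x)"
      using positive_function_hessian_definite_somewhere[of l] l_smooth l_hom l_pos unfolding S_eq by auto
    have xS: "x \<in> S" using x S_eq by simp
    have "0 < v \<bullet> (fund_tensor F (a0, x) *v v)" if "v \<noteq> 0" for v
    proof -
      have "v \<bullet> (fund_tensor F (a0, x) *v v)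
        = 1/2 * (\<Sum>i\<in>UNIV. \<Sum>j\<in>UNIV. v $ i * v $ j * pd j (pd i l) x)"
        by (simp add: inner_vec_def matrix_vector_mult_def G[OF xS] sum_distrib_left mult_ac sum_divide_distrib)
      then show ?thesis using pos[OF that] by simp
    qed
    then have "definite_matrix (fund_tensor F (a0, x))" by (simp add: definite_matrix_def)
    moreover have "(a0, x) \<in> Om" using xS by (simp add: Om_iff)
    ultimately show False using nd c(1) unfolding nondefinite_signature_def F_def Om_def by blast
  qed
  have dim: "2 \<le> DIM(real^'n)" using n by simp
  have "S \<noteq> {}" using yS by auto
  obtain y0 y1 r where touching: "y0 \<noteq> 0 \<and> y0 \<notin> S \<and> y0 \<in> closure S \<and>
      r > 0 \<and> ball y1 r \<subseteq> S \<and> dist y1 y0 = r"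
    using exists_touching_ball[OF S_open \<open>S \<noteq> {}\<close> S0 S_ne dim] by (elim exE) (rule that)
  then have y0: "y0 \<noteq> 0" "y0 \<notin> S" "y0 \<in> closure S"
    and ball: "r > 0" "ball y1 r \<subseteq> S" "dist y1 y0 = r" by simp_all
  have closure_S: "tvec_of c p x \<in> fibre_closure \<A> A p" "tvec_of c p x \<in> slit_closure \<A> A"
    if "x \<in> closure S" "x \<noteq> 0" for x
    using closure_fibre_set[OF A_slit c, of x] that unfolding S_def by blast+

  obtain W L' where WL: "openin (tangent_topology \<A>) W \<and> slit_closure \<A> A \<subseteq> W \<and> smooth_function \<A> W L' \<and>
      (\<forall>w\<in>A. L' w = L w) \<and> (\<forall>w\<in>slit_boundary \<A> A. L' w = 0) \<and>
      (\<forall>c\<in>\<A>. \<forall>z\<in>coord_set \<A> c (slit_boundary \<A> A). invertible (fund_tensor (coord_fun \<A> c L') z))"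
    using L[unfolded proper_pseudo_finsler_def, THEN conjunct2, THEN conjunct2, THEN conjunct2]
    by (elim exE) (rule that)
  then have W: "openin (tangent_topology \<A>) W" "slit_closure \<A> A \<subseteq> W" "smooth_function \<A> W L'"
    and L': "\<And>w. w \<in> A \<Longrightarrow> L' w = L w" "\<And>w. w \<in> slit_boundary \<A> A \<Longrightarrow> L' w = 0"
      "\<And>z. z \<in> coord_set \<A> c (slit_boundary \<A> A) \<Longrightarrow> invertible (fund_tensor (coord_fun \<A> c L') z)"
    using c(1) by simp_all
  define F1 where "F1 = coord_fun \<A> c L'"
  define O1 where "O1 = coord_set \<A> c W"
  define V where "V = {y. (a0, y) \<in> O1}"
  have O1: "open O1" unfolding O1_def by (rule open_coord_set[OF W(1) c(1)])
  have F1: "smooth_on O1 F1" using W(3) c(1) unfolding smooth_function_def O1_def F1_def by blast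
  have V_open: "open V" unfolding V_def by (rule open_slice[OF O1])
  have V_closure: "x \<in> V" if "x \<in> closure S" "x \<noteq> 0" for x
    unfolding V_def O1_def a0_def using closure_S(2)[OF that] W(2) coord_set_iff[OF c, of x W] by blast
  have S_closure: "x \<in> closure S" "x \<noteq> 0" if "x \<in> S" for x
    using that S0 closure_subset by auto
  have SV: "S \<subseteq> V" using V_closure S_closure by blast
  have y0V: "y0 \<in> V" using V_closure y0 by blast
  have y0_bd: "tvec_of c p y0 \<in> slit_boundary \<A> A"
    using closure_S(2)[OF y0(3,1)] y0(2) unfolding slit_boundary_def S_def by blast
  have F1_tvec: "F1 (a0, x) = L' (tvec_of c p x)" for x
    using coord_fun_tchart[OF c(1) tvec_of_tdom[OF c], of L' x]
    by (simp add: F1_def a0_def tchart_tvec_of[OF c])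
  have F1_F: "F1 z = F z" if z: "z \<in> Om" for z
  proof -
    obtain w where w: "w \<in> A" "w \<in> tdom \<A> c" "z = tchart c w"
      using z unfolding Om_def coord_set_def by blast
    then show ?thesis
      unfolding F1_def F_def using L'(1) coord_fun_tchart[OF c(1) w(2)] by simp
  qed
  have G1: "fund_tensor F1 (a0, x) = fund_tensor F (a0, x)" if "x \<in> S" for x
  proof -
    have z: "(a0, x) \<in> Om" using that by (simp add: Om_iff)
    have "pdy j (pdy i F1) (a0, x) = pdy j (pdy i F) (a0, x)" for i j
      by (intro pdy_cong[OF Om z] pdy_cong[OF Om] F1_F) auto
    then show ?thesis by (simp add: fund_tensor_def)
  qed
  have F1_slice: "smooth_on V (\<lambda>y. F1 (a0, y))"
    unfolding V_def by (rule smooth_on_slice[OF O1 F1])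

  interpret K: cone_domain S y0
    by standard (use S_open S_cone in auto)
  have l_reg: "K.hom_smooth 2 l"
  proof (rule K.hom_smoothI[OF V_open SV y0V F1_slice])
    show "F1 (a0, x) = l x" if "x \<in> S" for x
      unfolding l_def by (rule F1_F) (simp add: that Om_iff)
  qed (use l_hom in auto)
  define h where "h i j y = g_up F i j (a0, y)" for i j y
  have h_reg: "K.hom_smooth 0 (h i j)" for i j
  proof -
    have entries: "smooth_on V (\<lambda>y. fund_tensor F1 (a0, y) $ i $ j)" for i j
      using smooth_on_mult[OF V_open smooth_on_const smooth_on_slice[OF O1 smooth_on_pdy[OF smooth_on_pdy[OF F1]], of a0, folded V_def], of "1/2"]
      by (simp add: fund_tensor_def)
    \<comment> \<open>Away from the closure of \<open>S\<close> the fundamental tensor of the extended metric may degenerate.\<close>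
    define V' where "V' = V \<inter> (\<lambda>y. det (fund_tensor F1 (a0, y))) -` (- {0})"
    have V': "open V'"
      unfolding V'_def
      by (intro continuous_open_preimage smooth_on_imp_continuous_on smooth_on_det entries V_open) (simp add: open_Compl)
    show ?thesis
    proof (rule K.hom_smoothI[of V' "\<lambda>y. matrix_inv (fund_tensor F1 (a0, y)) $ i $ j"])
      show "open V'" by (rule V')
      show "S \<subseteq> V'"
        using SV F_inv G1 Om_iff by (auto simp: V'_def invertible_det_nz)
      have "(a0, y0) \<in> coord_set \<A> c (slit_boundary \<A> A)"
        unfolding a0_def using coord_set_iff[OF c] y0_bd by blast
      then show "y0 \<in> V'"
        using y0V L'(3) by (auto simp: V'_def F1_def invertible_det_nz)
      show "smooth_on V' (\<lambda>y. matrix_inv (fund_tensor F1 (a0, y)) $ i $ j)"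
        by (intro smooth_on_matrix_inv[OF V'] smooth_on_subset[OF entries]) (auto simp: V'_def invertible_det_nz)
      show "matrix_inv (fund_tensor F1 (a0, x)) $ i $ j = h i j x" if "x \<in> S" for x
        by (simp add: h_def g_up_def G1[OF that])
      fix x t assume x: "x \<in> S" and t: "(t :: real) > 0"
      have "K.hom_smooth 0 (\<lambda>y. 1/2 * pd j (pd i l) y)" for i j
        by (intro K.hom_smooth_cmult K.hom_smooth_pd[OF K.hom_smooth_pd[OF l_reg refl]]) auto
      from K.hom_smooth_homogeneous[OF this x t]
      have "fund_tensor F (a0, t *\<^sub>R x) = fund_tensor F (a0, x)"
        by (simp add: vec_eq_iff G x t S_cone)
      then show "h i j (t *\<^sub>R x) = t powi 0 * h i j x"
        by (simp add: h_def g_up_def)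
    qed
  qed
  interpret K: finsler_fibre S y0 l h
  proof
    show "3 \<le> CARD('n)" by (rule n)
    show "K.hom_smooth 2 l" by (rule l_reg)
    show "l x > 0" if "x \<in> S" for x by (rule l_pos[OF that])
    show "K.hom_smooth 0 (h i j)" for i j by (rule h_reg)
    fix x a d assume x: "x \<in> S"
    have "matrix_inv (fund_tensor F (a0, x)) ** fund_tensor F (a0, x) = mat 1"
      using F_inv x Om_iff by (intro invertible_matrix_inv) auto
    then have "(matrix_inv (fund_tensor F (a0, x)) ** fund_tensor F (a0, x)) $ a $ d = mat 1 $ a $ d"
      by simp
    then show "(\<Sum>b\<in>UNIV. h a b x * (1/2 * pd d (pd b l) x)) = kron a d"
      by (simp add: matrix_matrix_mult_def mat_def kron_def h_def g_up_def G[OF x])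
  qed
  have g_low_eq: "g_low F i j (a0, x) = K.g i j x" if "x \<in> S" for i j x
    by (simp add: g_low_def G[OF that] K.g_def)
  have g_low_smooth: "smooth_on Om (g_low F i j)" for i j
    unfolding g_low_def[abs_def] fund_tensor_def
    using smooth_on_mult[OF Om smooth_on_const smooth_on_pdy[OF smooth_on_pdy[OF F_smooth]], of "1/2"] by simp
  have C_eq: "mean_cartan F i (a0, x) = K.C i x" if x: "x \<in> S" for i x
  proof -
    have "pdy i (g_low F a b) (a0, x) = pd i (K.g a b) x" for a b
    proof -
      have "pdy i (g_low F a b) (a0, x) = pd i (\<lambda>x. g_low F a b (a0, x)) x"
        by (rule pdy_slice[OF g_low_smooth]) (simp add: Om_iff x)
      also have "\<dots> = pd i (K.g a b) x"
        by (rule pd_cong[OF S_open x g_low_eq])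
      finally show ?thesis .
    qed
    then show ?thesis by (simp add: mean_cartan_def cartan_def K.C_def h_def)
  qed
  have y_flat_eq: "y_low F a (a0, x) = K.y_flat a x" if x: "x \<in> S" for a x
    by (simp add: y_low_def K.y_flat_def g_low_eq[OF x])

  define T where "T = (\<lambda>w. snd w c) ` fibre_closure \<A> A p"
  have T: "x \<in> T" if "x \<in> closure S" "x \<noteq> 0" for x
    unfolding T_def using closure_S(1)[OF that] snd_tvec_of[OF c, of x] by (metis image_eqI)
  have ST: "S \<subseteq> T" using T S_closure by blast
  have y0T: "y0 \<in> T" using T y0 by blast

  have extension: "K.hom_smooth 2 (\<lambda>y. Y c a (a0, y)) \<and> (\<exists>f. real_analytic_on T f \<and> (\<forall>x\<in>S. f x = - 2 * Y c a (a0, x)))"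
    if Y: "hom_tensor10 2 \<A> A Y" "fiberwise_analytic10 \<A> A (\<lambda>c k z. - 2 * Y c k z)" for Y :: "('m, 'n) comps10" and a
  proof -
    obtain Fa where Fa: "smooth_extension Om (coord_set \<A> c (slit_closure \<A> A)) (\<lambda>z. - 2 * Y c a z) Fa \<and>
      (\<forall>p\<in>fst c. real_analytic_on ((\<lambda>w. snd w c) ` fibre_closure \<A> A p) (\<lambda>y. Fa (snd c p, y)))"
      using bspec[OF Y(2)[unfolded fiberwise_analytic10_def] c(1), THEN spec, of a, folded Om_def]
      by (elim exE) (rule that)
    obtain U where U': "open U \<and> Om \<subseteq> U \<and> coord_set \<A> c (slit_closure \<A> A) \<subseteq> U \<and> smooth_on U Fa"
      using Fa[THEN conjunct1, unfolded smooth_extension_def, THEN conjunct1] by (elim exE) (rule that)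
    then have U: "open U" "Om \<subseteq> U" "coord_set \<A> c (slit_closure \<A> A) \<subseteq> U" "smooth_on U Fa"
      by simp_all
    have Fa_eq: "Fa z = - 2 * Y c a z" if "z \<in> Om" for z
      using Fa[THEN conjunct1, unfolded smooth_extension_def, THEN conjunct2] that by simp
    have "(a0, y0) \<in> coord_set \<A> c (slit_closure \<A> A)"
      unfolding a0_def using coord_set_iff[OF c] closure_S(2)[OF y0(3,1)] by blast
    then have y0U: "y0 \<in> {y. (a0, y) \<in> U}" using U(3) by blast
    have "K.hom_smooth 2 (\<lambda>y. Y c a (a0, y))"
    proof (rule K.hom_smoothI[of "{y. (a0, y) \<in> U}" "\<lambda>y. - 1/2 * Fa (a0, y)"])
      show "open {y. (a0, y) \<in> U}" by (rule open_slice[OF U(1)])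
      show "S \<subseteq> {y. (a0, y) \<in> U}" using U(2) Om_iff by blast
      show "smooth_on {y. (a0, y) \<in> U} (\<lambda>y. - 1/2 * Fa (a0, y))"
        by (intro smooth_on_mult open_slice smooth_on_const smooth_on_slice U)
      show "- 1/2 * Fa (a0, x) = Y c a (a0, x)" if "x \<in> S" for x
        using Fa_eq[of "(a0, x)"] that by (simp add: Om_iff)
      fix x t assume "x \<in> S" "(t :: real) > 0"
      moreover have "pos_homogeneous 2 Om (Y c a)"
        using Y(1) c(1) unfolding hom_tensor10_def Om_def by blast
      ultimately show "Y c a (a0, t *\<^sub>R x) = t powi 2 * Y c a (a0, x)"
        using Om_iff[of x] unfolding pos_homogeneous_def by force
    qed (rule y0U)
    moreover have "real_analytic_on T (\<lambda>y. Fa (a0, y))"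
      using bspec[OF Fa[THEN conjunct2] c(2)] unfolding T_def a0_def .
    ultimately show ?thesis using Fa_eq Om_iff by blast
  qed

  have equation: "2 * mean_landsberg F b (a0, x)
      + (real CARD('n) + 2) * (\<Sum>a\<in>UNIV. K.y_flat a x * pd b (\<lambda>y. Y c a (a0, y)) x) / l x
      - 2 * (\<Sum>a\<in>UNIV. K.C a x * pd b (\<lambda>y. Y c a (a0, y)) x)
      - 2 * pd b (K.divergence (\<lambda>a y. Y c a (a0, y))) x = 0"
    if Y: "hom_tensor10 2 \<A> A Y" and hom_smooth: "\<And>a. K.hom_smooth 2 (\<lambda>y. Y c a (a0, y))"
      and eq: "\<And>z b. z \<in> coord_set \<A> c A \<Longrightarrow> affine_covector (coord_fun \<A> c L) (vertical_derivative Y c) b z = 0"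
      and x: "x \<in> S" for Y :: "('m, 'n) comps10" and b x
  proof -
    let ?Y = "\<lambda>a y. Y c a (a0, y)"
    have z: "(a0, x) \<in> Om" using x by (simp add: Om_iff)
    have sm: "smooth_on Om (Y c a)" for a
      using Y c(1) unfolding hom_tensor10_def Om_def by blast
    have 1: "vertical_derivative Y c i a (a0, x) = pd i (?Y a) x" for i a
      unfolding vertical_derivative_def by (rule pdy_slice[OF sm z])
    have 2: "pdy j (vertical_derivative Y c i a) (a0, x) = pd j (pd i (?Y a)) x" for i j a
      unfolding vertical_derivative_def by (rule pdy_pdy_slice[OF Om sm z])
    have 3: "pd b (K.divergence ?Y) x = (\<Sum>a\<in>UNIV. pd b (pd a (?Y a)) x)"
      unfolding K.divergence_def[abs_def] by (rule pd_sum) (rule K.hom_smooth_differentiable[OF K.hom_smooth_pd[OF hom_smooth refl] x])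
    have 4: "pd a (pd b (?Y a)) x = pd b (pd a (?Y a)) x" for a
      by (rule pd_commute[OF S_open x K.hom_smooth_smooth[OF hom_smooth]])
    have "affine_covector F (vertical_derivative Y c) b (a0, x) = 0"
      using eq z unfolding F_def Om_def by blast
    then show ?thesis
      unfolding affine_covector_def 1 2 3 4 C_eq[OF x] y_flat_eq[OF x] l_def[symmetric]
      by (simp add: sum.distrib sum_divide_distrib sum_distrib_left)
  qed

  define \<zeta> where "\<zeta> a x = Z c a (a0, x) - Z' c a (a0, x)" for a x
  note comps = extension[OF Z, THEN conjunct1] extension[OF Z', THEN conjunct1]
  have \<zeta>: "K.hom_smooth 2 (\<zeta> a)" for a
    unfolding \<zeta>_def[abs_def] by (intro K.hom_smooth_diff comps)
  have pd_diff: "pd b (\<lambda>y. f y - g y) x = pd b f x - pd b g x"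
    if "f differentiable (at x)" "g differentiable (at x)" for f g :: "real^'n \<Rightarrow> real" and b x
    using pd_add[OF that(1), of "\<lambda>y. (- 1) * g y" b] pd_cmult[OF that(2), of b "- 1"] that(2) by simp
  have pd_\<zeta>: "pd b (\<zeta> a) x = pd b (\<lambda>y. Z c a (a0, y)) x - pd b (\<lambda>y. Z' c a (a0, y)) x" if "x \<in> S" for a b x
    unfolding \<zeta>_def[abs_def] by (rule pd_diff[OF K.hom_smooth_differentiable[OF comps(1) that] K.hom_smooth_differentiable[OF comps(2) that]])
  have "K.affine_eq \<zeta>"
    unfolding K.affine_eq_def
  proof (intro ballI allI)
    fix x b assume x: "x \<in> S"
    have "pd b (K.divergence \<zeta>) x = pd b (\<lambda>x. K.divergence (\<lambda>a y. Z c a (a0, y)) x - K.divergence (\<lambda>a y. Z' c a (a0, y)) x) x"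
      by (rule pd_cong[OF S_open x]) (simp add: K.divergence_def pd_\<zeta> sum_subtractf)
    also have "\<dots> = pd b (K.divergence (\<lambda>a y. Z c a (a0, y))) x - pd b (K.divergence (\<lambda>a y. Z' c a (a0, y))) x"
      by (intro pd_diff K.hom_smooth_differentiable[OF K.hom_smooth_divergence[OF comps(1) refl] x] K.hom_smooth_differentiable[OF K.hom_smooth_divergence[OF comps(2) refl] x])
    finally have divergence: "pd b (K.divergence \<zeta>) x = \<dots>" .
    have contr: "(\<Sum>a\<in>UNIV. v a * pd b (\<zeta> a) x)
      = (\<Sum>a\<in>UNIV. v a * pd b (\<lambda>y. Z c a (a0, y)) x) - (\<Sum>a\<in>UNIV. v a * pd b (\<lambda>y. Z' c a (a0, y)) x)" for v
      by (simp add: pd_\<zeta>[OF x] right_diff_distrib sum_subtractf)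
    show "(real CARD('n) + 2) * (\<Sum>a\<in>UNIV. K.y_flat a x * pd b (\<zeta> a) x) =
         2 * l x * ((\<Sum>a\<in>UNIV. K.C a x * pd b (\<zeta> a) x) + pd b (K.divergence \<zeta>) x)"
      unfolding contr divergence
      using equation[OF Z(1) comps(1) eqZ x, of b] equation[OF Z'(1) comps(2) eqZ' x, of b] l_pos[OF x]
      by (simp add: field_simps)
  qed
  note flat = K.affine_eq_flat_at_boundary[OF \<zeta> this y0V F1_slice]

  obtain f where f: "real_analytic_on T f" "\<And>x. x \<in> S \<Longrightarrow> f x = - 2 * Z c k (a0, x)"
    using extension[OF Z, of k] by blast
  obtain f' where f': "real_analytic_on T f'" "\<And>x. x \<in> S \<Longrightarrow> f' x = - 2 * Z' c k (a0, x)"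
    using extension[OF Z', of k] by blast
  have "f y - f' y = 0"
  proof (rule real_analytic_on_flat_at_boundary[OF real_analytic_on_diff[OF f(1) f'(1)] S_open S_conn ST y0T ball _ yS])
    fix m
    have "\<exists>K d. d > 0 \<and> (\<forall>x\<in>S \<inter> ball y0 d. \<bar>\<zeta> k x\<bar> \<le> K * norm (x - y0) ^ m)"
    proof (rule flat)
      show "F1 (a0, x) = l x" if "x \<in> S" for x
        unfolding l_def by (rule F1_F) (simp add: that Om_iff)
      show "F1 (a0, y0) = 0" using L'(2)[OF y0_bd] by (simp add: F1_tvec)
    qed
    then obtain B d where d: "d > 0" "\<And>x. x \<in> S \<inter> ball y0 d \<Longrightarrow> \<bar>\<zeta> k x\<bar> \<le> B * norm (x - y0) ^ m"
      by blast
    have "\<bar>f x - f' x\<bar> \<le> (2 * B) * norm (x - y0) ^ m" if "x \<in> S \<inter> ball y0 d" for x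
    proof -
      have "f x - f' x = - 2 * \<zeta> k x" using that f(2) f'(2) by (simp add: \<zeta>_def)
      then show ?thesis using d(2)[OF that] by (simp add: abs_mult)
    qed
    then show "\<exists>K e. e > 0 \<and> (\<forall>x\<in>S \<inter> ball y0 e. \<bar>f x - f' x\<bar> \<le> K * norm (x - y0) ^ m)"
      using d(1) by blast
  qed
  then show ?thesis using f(2)[OF yS] f'(2)[OF yS] by (simp add: a0_def)
qed

text \<open>The connection difference in the definition of a solution is determined by \<open>N\<close>, so it is the vertical derivative
  of \<open>Z\<close>, whose derivatives are symmetric by Schwarz's theorem.\<close>

lemma solution_covector_zero:
  assumes n: "2 \<le> CARD('n)" and A: "conic_domain \<A> A" and c: "c \<in> \<A>"
    and Z: "hom_tensor10 2 \<A> A Z" "sum_with_metric_conn \<A> A L (vertical_derivative Z) N"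
    and N: "affine_solution \<A> A L N" and z: "z \<in> coord_set \<A> c A"
  shows "affine_covector (coord_fun \<A> c L) (vertical_derivative Z c) b z = 0"
proof -
  let ?O = "coord_set \<A> c A" and ?F = "coord_fun \<A> c L"
  have op: "open ?O" using A c open_coord_set unfolding conic_domain_def by blast
  obtain J where J: "sum_with_metric_conn \<A> A L J N"
    "\<And>z i j. z \<in> ?O \<Longrightarrow> affine_lhs ?F (J c) i j z = 0"
    using N c unfolding affine_solution_def by blast
  have JZ: "J c i k z = vertical_derivative Z c i k z" if "z \<in> ?O" for i k z
  proof -
    have "N c i k z = metric_conn ?F i k z + J c i k z"
      using J(1) c that unfolding sum_with_metric_conn_def by blast
    moreover have "N c i k z = metric_conn ?F i k z + vertical_derivative Z c i k z"
      using Z(2) c that unfolding sum_with_metric_conn_def by blast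
    ultimately show ?thesis by simp
  qed
  have Z_smooth: "smooth_on ?O (Z c k)" for k
    using Z(1) c unfolding hom_tensor10_def by blast
  have sym: "pdy a (J c i j) z = pdy i (J c a j) z" for a i j
  proof -
    have "pdy a (J c i j) z = pdy a (pdy i (Z c j)) z"
      by (rule pdy_cong[OF op z]) (simp add: JZ vertical_derivative_def)
    also have "\<dots> = pdy i (pdy a (Z c j)) z"
      unfolding pdy_def[abs_def] by (rule frechet_derivative_commute[OF op z Z_smooth])
    also have "\<dots> = pdy i (J c a j) z"
      by (rule pdy_cong[OF op z]) (simp add: JZ vertical_derivative_def)
    finally show ?thesis .
  qed
  have "snd z \<noteq> 0"
  proof
    assume "snd z = 0"
    obtain p y where p: "p \<in> fst c" "z = (snd c p, y)" using z by (rule coord_setE)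
    then have "tvec_of c p 0 \<in> A" using coord_set_iff[OF c p(1)] z \<open>snd z = 0\<close> by auto
    then show False using A tvec_of_slit[OF c p(1), of 0] unfolding conic_domain_def by blast
  qed
  from affine_covector_zero[OF J(2)[OF z] sym this n]
  have "affine_covector ?F (J c) b z = 0" .
  then show ?thesis
    using affine_covector_cong[OF op z, of "J c" "vertical_derivative Z c"] JZ by simp
qed

end

theorem theorem5p8:
  fixes X :: "'m topology" and \<A> :: "('m, 'n::finite) chart set"
    and A :: "('m, 'n) tvec set" and L :: "('m, 'n) tvec \<Rightarrow> real"
    and N N' :: "('m, 'n) comps11" and Z Z' :: "('m, 'n) comps10"
  assumes "connected_smooth_manifold X \<A>" and "CARD('n) \<ge> 3"
    and "conic_domain \<A> A"
    and "proper_pseudo_finsler \<A> A L" and "nondefinite_signature \<A> A L"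
    and "hom_tensor10 2 \<A> A Z" and "sum_with_metric_conn \<A> A L (vertical_derivative Z) N"
    and "symmetric_connection \<A> A N" and "proper_affine_solution \<A> A L N"
    and "fiberwise_analytic10 \<A> A (\<lambda>c k z. - 2 * Z c k z)"
    and "hom_tensor10 2 \<A> A Z'" and "sum_with_metric_conn \<A> A L (vertical_derivative Z') N'"
    and "symmetric_connection \<A> A N'" and "proper_affine_solution \<A> A L N'"
    and "fiberwise_analytic10 \<A> A (\<lambda>c k z. - 2 * Z' c k z)"
  shows "connections_agree \<A> A N N'"
  unfolding connections_agree_def
proof (intro ballI allI)
  fix c z i k assume c: "c \<in> \<A>" and z: "z \<in> coord_set \<A> c A"
  interpret atlas X \<A>
    using assms(1) unfolding connected_smooth_manifold_def by unfold_locales blast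
  have op: "open (coord_set \<A> c A)"
    using assms(3) c open_coord_set unfolding conic_domain_def by blast
  have n: "2 \<le> CARD('n)" using assms(2) by simp
  have sol: "affine_solution \<A> A L N" "affine_solution \<A> A L N'"
    using assms(9,14) unfolding proper_affine_solution_def by blast+
  have "Z c k z = Z' c k z" if z: "z \<in> coord_set \<A> c A" for z
  proof -
    obtain p y where p: "p \<in> fst c" "z = (snd c p, y)" using z by (rule coord_setE)
    moreover have "tvec_of c p y \<in> A" using coord_set_iff[OF c p(1)] z p(2) by blast
    ultimately show ?thesis
      using fibre_uniqueness[OF assms(2,3,4,5) c p(1) assms(6,10,11,15)
        solution_covector_zero[OF n assms(3) c assms(6,7) sol(1)]
        solution_covector_zero[OF n assms(3) c assms(11,12) sol(2)]] by simp
  qed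
  then have "pdy i (Z c k) z = pdy i (Z' c k) z"
    by (rule pdy_cong[OF op z])
  then show "N c i k z = N' c i k z"
    using assms(7,12) c z unfolding sum_with_metric_conn_def vertical_derivative_def by simp
qed

end
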